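(* Let $\mathcal{A}$ be a line arrangement in $\mathbb{P}^2$ of $d=8$ lines whose maximal point multiplicity is $m=3$, and let $r=e_1$ be the minimal degree of a Jacobian relation. Then $\tau(\mathcal{A})\in\{29,30,31,32,33,34,35,36\}$ and the possible cases are the following. (1) If $\tau(\mathcal{A})=36$, then $r=4$, $n_3=8$, and $\mathcal{A}$ is nearly free with exponents $(4,4,4)$. (2) If $\tau(\mathcal{A})=35$, then $r=4$, $n_3=7$, and $\mathcal{A}$ is minimal POG with exponents $(4,4,5)$. (3) If $\tau(\mathcal{A})=34$, then $r=4$, $n_3=6$, and one of the following two cases occurs: (a) $\mathcal{A}$ is POG with exponents $(4,4,6)$; (b) $\mathcal{A}$ has type $2$ with exponents $(4,5,5,5)$. (4) If $\tau(\mathcal{A})=33$, then $n_3=5$, and one of the following cases occurs: (a) $\mathcal{A}$ has type $2$ with exponents $(4,5,5)$ and $r=4$; (b) $\mathcal{A}$ has type $2$ with exponents $(4,5,5,6)$ and $r=4$; (c) $\mathcal{A}$ has type $3$ with exponents $(5,5,5,5,5)$ and $r=5$. (5) If $\tau(\mathcal{A})=32$, then $n_3=4$, and one of the following cases occurs: (a) $\mathcal{A}$ has type $2$ with exponents $(4,5,6,6)$; (b) $\mathcal{A}$ has type $3$ with exponents $(5,5,5,5)$; (c) $\mathcal{A}$ has type $3$ with exponents $(5,5,5,5,6)$. (6) If $\tau(\mathcal{A})=31$, then $r=5$, $n_3=3$, and one of the following cases occurs: (a) $\mathcal{A}$ has type $3$ with exponents $(5,5,5,6)$; (b) $\mathcal{A}$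 has type $3$ with exponents $(5,5,5,6,6)$. (7) If $\tau(\mathcal{A})=30$, then $r=5$, $n_3=2$, and $\mathcal{A}$ has type $3$ with exponents $(5,5,6,6,6)$. (8) If $\tau(\mathcal{A})=29$, then $r=5$, $n_3=1$, and $\mathcal{A}$ has type $4$ with exponents $(5,6,6,6,6,6)$.
   Context: Let $S=\mathbb{C}[x,y,z]$ with the standard grading. A line arrangement $\mathcal{A}: f=0$ in $\mathbb{P}^2=\mathbb{P}^2_{\mathbb{C}}$ is given by $f=\ell_1\cdots\ell_d$ with $\ell_i\in S_1$ pairwise non-proportional. The multiplicity of a point is the number of lines of $\mathcal{A}$ through it; $n_k$ is the number of points of multiplicity exactly $k$; the total Tjurina number is $\tau(\mathcal{A})=\sum_{k\geq 2}n_k(k-1)^2$. Let $AR(f)=\{(a,b,c)\in S^3: af_x+bf_y+cf_z=0\}$, graded by the common degree of $a,b,c$. The exponents $(e_1,\ldots,e_s)$, $e_1\leq\cdots\leq e_s$, of $\mathcal{A}$ are the degrees of a minimal homogeneous generating set of $AR(f)$; $r=\mathrm{mdr}(f)=e_1$. $\mathcal{A}$ is plus-one generated (POG) if $s=3$ and $e_1+e_2=d$; it is nearly free if moreover $e_3=e_2$, and minimal POG if moreover $e_3=e_2+1$. The type of $\mathcal{A}$ is $t(\mathcal{A})=e_1+e_2-d+1$. *)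

theory Defs
  imports "HOL-Analysis.Analysis" "HOL-Library.Poly_Mapping"
begin

text \<open>The ring \<open>S = \<complex>[x,y,z]\<close>: finitely supported maps from monomials to coefficients, where a
  monomial is an exponent vector indexed by the three-element type \<open>3 = {1, 2, 3}\<close>
  (so \<open>x, y, z\<close> are the variables \<open>1, 2, 3\<close>).  Multiplication is the convolution product of
  \<open>Poly_Mapping\<close>, i.e. the product of polynomials.\<close>

type_synonym mono3 = "3 \<Rightarrow>\<^sub>0 nat"
type_synonym poly3 = "mono3 \<Rightarrow>\<^sub>0 complex"

definition mono_degree :: "mono3 \<Rightarrow> nat" where
  "mono_degree m = (\<Sum>i\<in>UNIV. Poly_Mapping.lookup m i)"

text \<open>The zero polynomial is homogeneous of every degree, so that
  \<open>{p. homogeneous k p}\<close> is the graded piece \<open>S\<^sub>k\<close>.\<close>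

definition homogeneous :: "nat \<Rightarrow> poly3 \<Rightarrow> bool" where
  "homogeneous k p \<longleftrightarrow> (\<forall>m\<in>Poly_Mapping.keys p. mono_degree m = k)"

definition const_poly :: "complex \<Rightarrow> poly3" where
  "const_poly c = Poly_Mapping.single 0 c"

definition eval_poly :: "poly3 \<Rightarrow> complex^3 \<Rightarrow> complex" where
  "eval_poly p v = (\<Sum>m\<in>Poly_Mapping.keys p.
     Poly_Mapping.lookup p m * (\<Prod>i\<in>UNIV. (v $ i) ^ Poly_Mapping.lookup m i))"

text \<open>Formal partial derivative. Where the exponent of the variable is \<open>0\<close>, the truncated
  subtraction on exponents is harmless because the new coefficient is \<open>0\<close>.\<close>

definition partial :: "3 \<Rightarrow> poly3 \<Rightarrow> poly3" where
  "partial i p = (\<Sum>m\<in>Poly_Mapping.keys p.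
     Poly_Mapping.single (m - Poly_Mapping.single i 1)
       (of_nat (Poly_Mapping.lookup m i) * Poly_Mapping.lookup p m))"


text \<open>A line arrangement is given by the list of its linear forms; \<open>d\<close> is the length of the list.\<close>

definition line_arrangement :: "poly3 list \<Rightarrow> bool" where
  "line_arrangement A \<longleftrightarrow>
     (\<forall>l\<in>set A. l \<noteq> 0 \<and> homogeneous 1 l) \<and>
     (\<forall>i<length A. \<forall>j<length A. i \<noteq> j \<longrightarrow> (\<nexists>c. A ! i = const_poly c * A ! j))"

definition defining_poly :: "poly3 list \<Rightarrow> poly3" where
  "defining_poly A = prod_list A"

text \<open>Points of \<open>\<P>\<^sup>2\<close> are the one-dimensional complex subspaces of \<open>\<complex>\<^sup>3\<close>
  (\<open>vec.span\<close> is the span over the field of scalars of the vectors, here \<open>\<complex>\<close>).\<close>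

definition proj_plane :: "(complex^3) set set" where
  "proj_plane = {vec.span {v} |v. v \<noteq> 0}"

definition multiplicity_at :: "poly3 list \<Rightarrow> (complex^3) set \<Rightarrow> nat" where
  "multiplicity_at A P = card {i. i < length A \<and> (\<forall>v\<in>P. eval_poly (A ! i) v = 0)}"

definition max_multiplicity :: "poly3 list \<Rightarrow> nat" where
  "max_multiplicity A = Max (multiplicity_at A ` proj_plane)"

definition num_points :: "nat \<Rightarrow> poly3 list \<Rightarrow> nat" where
  "num_points k A = card {P \<in> proj_plane. multiplicity_at A P = k}"

text \<open>No point has multiplicity greater than \<open>d\<close>, so the sum over \<open>k \<ge> 2\<close> stops at \<open>d\<close>.\<close>

definition tjurina :: "poly3 list \<Rightarrow> nat" where
  "tjurina A = (\<Sum>k = 2..length A. num_points k A * (k - 1)\<^sup>2)"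


text \<open>\<open>S\<^sup>3\<close> with the componentwise scalar multiplication, as an \<open>S\<close>-module, so that
  \<open>module.span\<close> gives the generated submodule.\<close>

lemma module_vec: "module (\<lambda>(c::'a::comm_ring_1) (v::'a^'n). c *s v)"
  by unfold_locales (simp_all add: vec_eq_iff algebra_simps)

abbreviation submodule_span :: "(poly3^3) set \<Rightarrow> (poly3^3) set" where
  "submodule_span \<equiv> module.span (\<lambda>c v. c *s v)"

definition AR :: "poly3 \<Rightarrow> (poly3^3) set" where
  "AR f = {\<rho>. \<rho> $ 1 * partial 1 f + \<rho> $ 2 * partial 2 f + \<rho> $ 3 * partial 3 f = 0}"

definition homogeneous_triple :: "nat \<Rightarrow> poly3^3 \<Rightarrow> bool" where
  "homogeneous_triple k \<rho> \<longleftrightarrow> (\<forall>i. homogeneous k (\<rho> $ i))"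

definition minimal_generating_set :: "(poly3^3) set \<Rightarrow> (poly3^3) set \<Rightarrow> bool" where
  "minimal_generating_set M G \<longleftrightarrow>
     submodule_span G = M \<and> (\<forall>H. H \<subset> G \<longrightarrow> submodule_span H \<noteq> M)"

text \<open>The exponents, in increasing order and indexed from \<open>0\<close>: \<open>e\<^sub>1 = exponents A ! 0\<close> etc.
  By graded Nakayama this list exists and does not depend on the generating set.\<close>

definition exponents :: "poly3 list \<Rightarrow> nat list" where
  "exponents A = (THE es. sorted es \<and>
     (\<exists>gs. distinct gs \<and> list_all2 homogeneous_triple es gs \<and>
           minimal_generating_set (AR (defining_poly A)) (set gs)))"

definition mdr :: "poly3 list \<Rightarrow> nat" where
  "mdr A = (LEAST k. \<exists>\<rho>\<in>AR (defining_poly A). \<rho> \<noteq> 0 \<and> homogeneous_triple k \<rho>)"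

definition plus_one_generated :: "poly3 list \<Rightarrow> bool" where
  "plus_one_generated A \<longleftrightarrow>
     length (exponents A) = 3 \<and> exponents A ! 0 + exponents A ! 1 = length A"

definition nearly_free :: "poly3 list \<Rightarrow> bool" where
  "nearly_free A \<longleftrightarrow> plus_one_generated A \<and> exponents A ! 2 = exponents A ! 1"

definition minimal_plus_one_generated :: "poly3 list \<Rightarrow> bool" where
  "minimal_plus_one_generated A \<longleftrightarrow>
     plus_one_generated A \<and> exponents A ! 2 = exponents A ! 1 + 1"

definition arrangement_type :: "poly3 list \<Rightarrow> int" where
  "arrangement_type A = int (exponents A ! 0) + int (exponents A ! 1) - int (length A) + 1"

end

theory Submission
  imports Defs "HOL-Computational_Algebra.Polynomial_Factorial" "HOL-Computational_Algebra.Field_as_Ring"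
begin

text \<open>Write \<open>S\<^sub>k\<close> for the forms of degree \<open>k\<close>, \<open>AR\<^sub>k\<close> for the Jacobian relations of degree \<open>k\<close>
and \<open>n\<close> for the number of triple points. Counting pairs of lines gives \<open>n\<^sub>2 + 3 n = 28\<close>, hence
\<open>\<tau> = n\<^sub>2 + 4 n = 28 + n\<close>. A line carries at most three triple points, so
\<open>n \<le> 8\<close>, and \<open>n \<ge> 1\<close> because the multiplicity \<open>3\<close> occurs. It remains to
read off the exponents, which are determined by the numbers \<open>dim AR\<^sub>k\<close> and \<open>dim S\<^sub>1 AR\<^sub>k\<close>
(graded Nakayama, lemmas \<open>card_generators_of_degree\<close> and \<open>exponents_unique\<close>).

A Jacobian relation is a derivation \<open>\<theta>\<close> that kills \<open>f\<close>. Modulo multiples of the Euler derivation,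
which form a direct summand, it is the same as a logarithmic derivation, one with
\<open>\<theta>(\<ell>)\<close> divisible by \<open>\<ell>\<close> for every line. These are built up one line at a time. When the line
\<open>\<ell>\<close> is added, the new condition is that the form \<open>\<theta>(\<ell>)\<close> vanishes on the line. On the line it always
vanishes at the double points of the old arrangement, and in high degree this is the only
constraint (\<open>surj_restriction\<close>): the products of all but two of the old linear forms with
the meeting point of the remaining two are logarithmic derivations, and by Lagrange
interpolation their restrictions span everything allowed. Starting from three lines that are not
concurrent, this gives \<open>dim AR\<^sub>5 = n\<close>, \<open>dim AR\<^sub>6 = n + 7\<close> (\<open>dim_D\<close>) and
\<open>AR\<^bsub>k+1\<^esub> = S\<^sub>1 AR\<^sub>k\<close> for \<open>k \<ge> 6\<close> (\<open>generation\<close>).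

In low degree a derivation of degree \<open>k\<close> is seen as a foliation of the plane. On an invariant line
it has \<open>k + 1\<close> singularities, among them all the points of the arrangement. If a line has more
points than that, the derivation is, up to a multiple of the Euler derivation, the linear form times a
derivation of the arrangement without this line (\<open>deletion\<close>). Deleting
lines repeatedly shows \<open>AR\<^sub>3 = 0\<close>, and \<open>AR\<^sub>4 = 0\<close> if \<open>n \<le> 3\<close>. Deletion is blocked
only by the seven lines of the Fano plane and by eight lines with eight triple points, the
combinatorics of the MacLane arrangement. There the Camacho-Sad indices along each line sum up
to \<open>1\<close>, while each triple point contributes \<open>1\<close> already and the two indices at a double point
are inverse to each other; this is contradictory (\<open>camacho_sad\<close>, \<open>only_Euler_low_degree\<close>).

Finally \<open>dim S\<^sub>1 AR\<^sub>k\<close> is squeezed between two bounds. With linear forms \<open>l\<close>, \<open>m\<close>, \<open>a\<close> that form a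
basis, \<open>l AR\<^sub>k\<close> and \<open>m AR\<^sub>k\<close> meet exactly in \<open>l m AR\<^bsub>k-1\<^esub>\<close>. If \<open>a x\<close> lies in
\<open>l AR\<^sub>k + m AR\<^sub>k\<close> then \<open>x\<close> vanishes at the point where \<open>l = m = 0\<close>, which may be chosen generic; so
the growth is governed by the rank of \<open>AR\<^sub>k\<close> (\<open>dim_S1_ge_2\<close>). Two relations of
which one has minimal degree are parallel only if one is a multiple of the other
(\<open>parallel_multiple\<close>), and thus the rank is two as soon as there is a relation that is not a multiple of one of
minimal degree. These bounds leave exactly the listed combinations (\<open>numerical_cases\<close>).\<close>

section \<open>Finite-dimensional subspaces\<close>

text \<open>The polynomial spaces below are infinite-dimensional, so dimensions are taken of subspaces that lie in
the span of a finite set.\<close>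

locale linspace = vector_space
begin

definition fin_dim :: "'b set \<Rightarrow> bool" where
  "fin_dim V \<longleftrightarrow> (\<exists>B. finite B \<and> V \<subseteq> span B)"

lemma fin_dim_subset: "fin_dim W \<Longrightarrow> V \<subseteq> W \<Longrightarrow> fin_dim V"
  unfolding fin_dim_def by blast

lemma fin_dim_finite_indep:
  assumes "fin_dim V" "independent B" "B \<subseteq> V"
  shows "finite B"
  using assms independent_span_bound unfolding fin_dim_def by (metis subset_trans)

lemma fin_dim_basis:
  assumes "fin_dim V" "subspace V"
  obtains B where "B \<subseteq> V" "independent B" "finite B" "span B = V" "card B = dim V"
proof -
  obtain B where B: "B \<subseteq> V" "independent B" "V \<subseteq> span B" "card B = dim V"
    by (rule basis_exists)
  moreover have "finite B" using fin_dim_finite_indep assms B by blast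
  moreover have "span B = V" using B assms(2) by (simp add: span_minimal subset_antisym)
  ultimately show ?thesis using that by blast
qed

text \<open>A basis of the small space extended to one of the large space: \<open>C\<close> represents a basis of the quotient.\<close>

lemma fin_dim_relative_basis:
  assumes fin_dim: "fin_dim V" and V: "subspace V" and W: "subspace W" and WV: "W \<subseteq> V"
  obtains B C where "B \<inter> C = {}" "finite B" "finite C" "independent (B \<union> C)"
    "span B = W" "span (B \<union> C) = V" "card B = dim W" "card B + card C = dim V"
proof -
  obtain B where B: "B \<subseteq> W" "independent B" "finite B" "span B = W" "card B = dim W"
    using fin_dim_basis[OF fin_dim_subset[OF fin_dim WV] W] by blast
  obtain D where D: "B \<subseteq> D" "D \<subseteq> V" "independent D" "V \<subseteq> span D"
    using maximal_independent_subset_extend[of B V] B WV by (metis subset_trans)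
  have fD: "finite D" using fin_dim_finite_indep[OF fin_dim D(3,2)] .
  have sD: "span D = V" using D V by (simp add: span_minimal subset_antisym)
  have "dim V = card D" using D by (metis basis_card_eq_dim)
  then have "card B + card (D - B) = dim V"
    using D fD by (metis B(3) card_Diff_subset card_mono le_add_diff_inverse)
  moreover have "B \<union> (D - B) = D" using D by blast
  ultimately show ?thesis using that[of B "D - B"] B D fD sD by auto
qed

lemma dim_mono_fin_dim:
  assumes "fin_dim W" "V \<subseteq> W" "subspace V" "subspace W"
  shows "dim V \<le> dim W"
  using fin_dim_relative_basis[OF assms(1,4,3,2)] by (metis le_add1)

lemma dim_zero_fin_dim:
  assumes "fin_dim V" "subspace V" "dim V = 0"
  shows "V = {0}"
proof -
  obtain B where "finite B" "span B = V" "card B = dim V" using fin_dim_basis[OF assms(1,2)] by metis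
  with assms show ?thesis by auto
qed

lemma dim_trivial [simp]: "dim {0} = 0"
  by (metis dim_le_card empty_subsetI card.empty finite.emptyI le_zero_eq span_empty order_refl)

lemma fin_dim_sums:
  assumes "fin_dim U" "fin_dim W"
  shows "fin_dim {x + y |x y. x \<in> U \<and> y \<in> W}"
proof -
  obtain B C where BC: "finite B" "U \<subseteq> span B" "finite C" "W \<subseteq> span C"
    using assms unfolding fin_dim_def by blast
  have "x + y \<in> span (B \<union> C)" if "x \<in> U" "y \<in> W" for x y
    using that BC by (meson span_add span_mono subsetD sup_ge1 sup_ge2)
  then show ?thesis unfolding fin_dim_def using BC by (intro exI[of _ "B \<union> C"]) auto
qed

end

locale linspace_pair = vs1: linspace s1 + vs2: linspace s2
  for s1 :: "'a::field \<Rightarrow> 'b::ab_group_add \<Rightarrow> 'b" and s2 :: "'a::field \<Rightarrow> 'c::ab_group_add \<Rightarrow> 'c"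
begin

sublocale vector_space_pair s1 s2 ..

lemma subspace_kernel_on:
  assumes "Vector_Spaces.linear s1 s2 f" "vs1.subspace V"
  shows "vs1.subspace {x \<in> V. f x = 0}"
proof -
  interpret f: Vector_Spaces.linear s1 s2 f by fact
  show ?thesis using assms(2) by (auto simp: vs1.subspace_def f.add f.scale f.zero)
qed

lemma rank_nullity:
  assumes f: "Vector_Spaces.linear s1 s2 f" and V: "vs1.subspace V" and fin_dim: "vs1.fin_dim V"
  shows "vs1.dim V = vs1.dim {x \<in> V. f x = 0} + vs2.dim (f ` V)"
    and "vs2.fin_dim (f ` V)" and "vs2.subspace (f ` V)"
proof -
  interpret f: Vector_Spaces.linear s1 s2 f by fact
  let ?K = "{x \<in> V. f x = 0}"
  obtain B C where BC: "B \<inter> C = {}" "finite B" "finite C" "vs1.independent (B \<union> C)"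
    "vs1.span B = ?K" "vs1.span (B \<union> C) = V" "card B = vs1.dim ?K" "card B + card C = vs1.dim V"
    using vs1.fin_dim_relative_basis[OF fin_dim V subspace_kernel_on[OF f V]] by auto
  have "f ` V = vs2.span (f ` (B \<union> C))" using BC(6) f.span_image by metis
  also have "\<dots> = vs2.span (f ` C)"
  proof
    have "f ` B \<subseteq> {0}" using BC(5) vs1.span_superset[of B] by auto
    then have "f ` (B \<union> C) \<subseteq> insert 0 (f ` C)" by auto
    then show "vs2.span (f ` (B \<union> C)) \<subseteq> vs2.span (f ` C)"
      using vs2.span_mono vs2.span_insert_0 by metis
  next
    show "vs2.span (f ` C) \<subseteq> vs2.span (f ` (B \<union> C))" by (rule vs2.span_mono) auto
  qed
  finally have sp: "f ` V = vs2.span (f ` C)" .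
  show "vs2.fin_dim (f ` V)" using sp BC(3) unfolding vs2.fin_dim_def by blast
  show "vs2.subspace (f ` V)" using sp by simp
  have zero: "x = 0" if "x \<in> vs1.span C" "f x = 0" for x
  proof -
    have "x \<in> vs1.span B"
      using that BC(5,6) vs1.span_mono[of C "B \<union> C"] by auto
    moreover have "vs1.span B \<inter> vs1.span C = {0}"
    proof (rule ccontr)
      assume "vs1.span B \<inter> vs1.span C \<noteq> {0}"
      then obtain y where y: "y \<in> vs1.span B" "y \<in> vs1.span C" "y \<noteq> 0"
        using vs1.span_zero by blast
      have r1: "vs1.representation (B \<union> C) y = vs1.representation B y"
        using vs1.representation_extend[OF BC(4) y(1)] by simp
      have r2: "vs1.representation (B \<union> C) y = vs1.representation C y"
        using vs1.representation_extend[OF BC(4) y(2)] by simp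
      have "vs1.representation B y b = 0" for b
        using vs1.representation_ne_zero[of B y b] vs1.representation_ne_zero[of C y b] r1 r2 BC(1)
        by auto
      then have "(\<Sum>b | vs1.representation B y b \<noteq> 0. s1 (vs1.representation B y b) b) = 0" by simp
      moreover have "vs1.independent B" using BC(4) vs1.independent_mono by blast
      ultimately show False using vs1.sum_nonzero_representation_eq[of B y] y by simp
    qed
    ultimately show ?thesis using that by blast
  qed
  have iC: "vs1.independent C" using BC(4) vs1.independent_mono by blast
  have inj: "inj_on f (vs1.span C)"
    using f.inj_on_iff_eq_0[OF vs1.subspace_span] zero by blast
  have "vs2.independent (f ` C)" using f.independent_injective_image[OF iC inj] .
  then have "vs2.dim (f ` V) = card (f ` C)" using sp vs2.dim_span_eq_card_independent[of "f ` C"] by argo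
  also have "\<dots> = card C" by (meson card_image inj inj_on_subset vs1.span_superset)
  finally show "vs1.dim V = vs1.dim ?K + vs2.dim (f ` V)" using BC(7,8) by simp
qed

end

context linspace
begin

text \<open>A linear map \<open>g\<close> with kernel exactly \<open>U\<close> exists, by extension of a basis. It has the same image on \<open>U + W\<close>
and on \<open>W\<close>, with kernels \<open>U\<close> and \<open>U \<inter> W\<close>; compare ranks.\<close>

lemma dim_sums_Int_fin_dim:
  assumes U: "subspace U" "fin_dim U" and W: "subspace W" "fin_dim W"
  shows "dim {x + y |x y. x \<in> U \<and> y \<in> W} + dim (U \<inter> W) = dim U + dim W"
proof -
  have lp: "linspace_pair scale scale" by (intro linspace_pair.intro linspace_axioms)
  have vp: "vector_space_pair scale scale"
    by (intro vector_space_pair.intro vector_space_axioms)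
  let ?S = "{x + y |x y. x \<in> U \<and> y \<in> W}"
  obtain B where B: "B \<subseteq> U" "independent B" "finite B" "span B = U" "card B = dim U"
    by (rule fin_dim_basis[OF U(2,1)])
  obtain D where D: "B \<subseteq> D" "D \<subseteq> UNIV" "independent D" "UNIV \<subseteq> span D"
    by (rule maximal_independent_subset_extend[OF subset_UNIV B(2)])
  define g where "g = vector_space_pair.construct scale scale D (\<lambda>b. if b \<in> B then 0 else b)"
  have g: "Vector_Spaces.linear scale scale g" unfolding g_def by (rule vector_space_pair.linear_construct[OF vp D(3)])
  note g_add = vector_space_pair.linear_add[OF vp g]
    and g_scale = vector_space_pair.linear_scale[OF vp g]
    and g_zero = vector_space_pair.linear_0[OF vp g]
  have gb: "g b = (if b \<in> B then 0 else b)" if "b \<in> D" for b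
    unfolding g_def using vector_space_pair.construct_basis[OF vp D(3) that] .
  \<comment> \<open>\<open>g\<close> is a projection along \<open>U\<close>, so \<open>x - g x\<close> always lies in \<open>U\<close>\<close>
  have g0: "g x = 0 \<longleftrightarrow> x \<in> U" for x
  proof
    assume "x \<in> U"
    then have "x \<in> span B" using B(4) by simp
    then show "g x = 0"
    proof (induction rule: span_induct_alt)
      case base show ?case by (rule g_zero)
    next
      case (step c b y)
      have "g b = 0" using gb[of b] step(1) D(1) by auto
      then show ?case using step(2) by (simp add: g_add g_scale)
    qed
  next
    have "x - g x \<in> U" 
    proof -
      have "x \<in> span D" using D by blast
      then show ?thesis
      proof (induction rule: span_induct_alt)
        case base show ?case using subspace_0[OF U(1)] g_zero by simp
      next
        case (step c b y)
        have "b - g b \<in> U" using gb[OF step(1)] B(1) subspace_0[OF U(1)] by auto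
        then have "scale c (b - g b) + (y - g y) \<in> U"
          using step(2) subspace_add[OF U(1)] subspace_scale[OF U(1)] by blast
        moreover have "scale c (b - g b) + (y - g y) = (scale c b + y) - g (scale c b + y)"
          by (simp add: g_add g_scale scale_right_diff_distrib)
        ultimately show ?case by simp
      qed
    qed
    moreover assume "g x = 0"
    ultimately show "x \<in> U" by simp
  qed
  have S: "subspace ?S" using subspace_sums[OF U(1) W(1)] .
  have fS: "fin_dim ?S" using fin_dim_sums[OF U(2) W(2)] .
  have kS: "{x \<in> ?S. g x = 0} = U"
  proof -
    have "x \<in> ?S" if "x \<in> U" for x using that subspace_0[OF W(1)] by force
    then show ?thesis using g0 by blast
  qed
  have kW: "{x \<in> W. g x = 0} = U \<inter> W" using g0 by blast
  have eq: "g ` ?S = g ` W"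
  proof
    show "g ` ?S \<subseteq> g ` W" using g0[THEN iffD2] by (auto simp: g_add)
    show "g ` W \<subseteq> g ` ?S" 
    proof
      fix z assume "z \<in> g ` W"
      then obtain y where "y \<in> W" "z = g y" by blast
      moreover have "0 + y \<in> ?S" using subspace_0[OF U(1)] \<open>y \<in> W\<close> by blast
      then have "g (0 + y) \<in> g ` ?S" by (rule imageI)
      ultimately show "z \<in> g ` ?S" by simp
    qed
  qed
  have "dim ?S = dim U + dim (g ` W)"
    using linspace_pair.rank_nullity(1)[OF lp g S fS] unfolding kS eq .
  moreover have "dim W = dim (U \<inter> W) + dim (g ` W)"
    using linspace_pair.rank_nullity(1)[OF lp g W] unfolding kW .
  ultimately show ?thesis by linarith
qed

end

section \<open>Substitution into polynomials in three variables\<close>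

definition lin_ext :: "(mono3 \<Rightarrow> complex \<Rightarrow> 'a::comm_monoid_add) \<Rightarrow> poly3 \<Rightarrow> 'a" where
  "lin_ext F p = (\<Sum>m\<in>Poly_Mapping.keys p. F m (Poly_Mapping.lookup p m))"

lemma lin_ext_add:
  assumes "\<And>m. F m 0 = 0" "\<And>m a b. F m (a + b) = F m a + F m b"
  shows "lin_ext F (p + q) = lin_ext F p + lin_ext F q"
  unfolding lin_ext_def by (rule Poly_Mapping.setsum_keys_plus_distrib) (use assms in auto)

lemma lin_ext_single:
  assumes "\<And>m. F m 0 = 0"
  shows "lin_ext F (Poly_Mapping.single m c) = F m c"
  unfolding lin_ext_def by (cases "c = 0") (auto simp: assms)

lemma poly3_expand: "p = (\<Sum>m\<in>Poly_Mapping.keys p. Poly_Mapping.single m (Poly_Mapping.lookup p m))"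
  by (rule poly_mapping_eqI)
    (auto simp: lookup_sum lookup_single when_def sum.delta' in_keys_iff)

lemma poly3_induct [case_names single add]:
  assumes "\<And>m c. P (Poly_Mapping.single m c)" "\<And>p q. P p \<Longrightarrow> P q \<Longrightarrow> P (p + q)"
  shows "P (p::poly3)"
proof -
  have P0: "P 0" using assms(1)[of 0 0] by simp
  have "P (\<Sum>m\<in>S. Poly_Mapping.single m (Poly_Mapping.lookup p m))" if "finite S" for S
    using that by (induction S rule: finite_induct) (auto intro: assms P0)
  then show ?thesis by (subst poly3_expand) auto
qed

text \<open>All ring homomorphisms out of the polynomial ring that occur below, such as evaluation, restriction to a
line or the grading, are substitutions of ring elements for the variables over a ring homomorphism of coefficients. Their
common properties are proved here once.\<close>

locale subst_hom =
  fixes \<phi> :: "complex \<Rightarrow> 'a::comm_ring_1" and X :: "3 \<Rightarrow> 'a"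
  assumes hom_0: "\<phi> 0 = 0" and hom_1: "\<phi> 1 = 1"
    and hom_add: "\<phi> (a + b) = \<phi> a + \<phi> b" and hom_mult: "\<phi> (a * b) = \<phi> a * \<phi> b"
begin

definition sub :: "poly3 \<Rightarrow> 'a" where
  "sub = lin_ext (\<lambda>m c. \<phi> c * (\<Prod>i\<in>UNIV. X i ^ Poly_Mapping.lookup m i))"

lemma sub_add: "sub (p + q) = sub p + sub q"
  unfolding sub_def by (rule lin_ext_add) (auto simp: hom_0 hom_add algebra_simps)

lemma sub_single: "sub (Poly_Mapping.single m c) = \<phi> c * (\<Prod>i\<in>UNIV. X i ^ Poly_Mapping.lookup m i)"
  unfolding sub_def by (rule lin_ext_single) (simp add: hom_0)

lemma sub_mult: "sub (p * q) = sub p * sub q"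
proof (induction p rule: poly3_induct)
  case (single m c)
  show ?case
  proof (induction q rule: poly3_induct)
    case (single m' c')
    show ?case
      by (simp add: mult_single sub_single hom_mult lookup_add power_add prod.distrib)
  next
    case (add p q)
    then show ?case by (simp add: sub_add algebra_simps)
  qed
next
  case (add p q)
  then show ?case by (simp add: sub_add algebra_simps)
qed

lemma sub_const: "sub (const_poly c) = \<phi> c"
  by (simp add: const_poly_def sub_single)

lemma sub_0 [simp]: "sub 0 = 0"
  by (simp add: sub_def lin_ext_def)

lemma sub_1 [simp]: "sub 1 = 1"
  using sub_const[of 1] by (simp add: const_poly_def hom_1)

lemma sub_minus: "sub (- p) = - sub p"
  by (metis add.right_inverse neg_eq_iff_add_eq_0 sub_0 sub_add)

lemma sub_diff: "sub (p - q) = sub p - sub q"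
  using sub_add[of p "- q"] by (simp add: sub_minus)

lemma sub_sum: "sub (sum f S) = (\<Sum>x\<in>S. sub (f x))"
  by (induction S rule: infinite_finite_induct) (auto simp: sub_add)

lemma sub_prod: "sub (prod f S) = (\<Prod>x\<in>S. sub (f x))"
  by (induction S rule: infinite_finite_induct) (auto simp: sub_mult)

lemma sub_power: "sub (p ^ n) = sub p ^ n"
  by (induction n) (auto simp: sub_mult)

end

definition Xv :: "3 \<Rightarrow> poly3" where
  "Xv i = Poly_Mapping.single (Poly_Mapping.single i 1) 1"

lemma (in subst_hom) sub_X: "sub (Xv i) = X i"
proof -
  have "(\<Prod>j\<in>UNIV. X j ^ Poly_Mapping.lookup (Poly_Mapping.single i (1::nat)) j) = (\<Prod>j\<in>UNIV. if j = i then X j else 1)"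
    by (intro prod.cong) (auto simp: lookup_single when_def)
  then show ?thesis by (simp add: Xv_def sub_single hom_1)
qed

lemma const_poly_0 [simp]: "const_poly 0 = 0" and const_poly_1 [simp]: "const_poly 1 = 1"
  and const_poly_add: "const_poly (a + b) = const_poly a + const_poly b"
  and const_poly_mult: "const_poly (a * b) = const_poly a * const_poly b"
  by (simp_all add: const_poly_def single_add mult_single)

lemma const_poly_eq_0 [simp]: "const_poly a = 0 \<longleftrightarrow> a = 0"
  unfolding const_poly_def by (metis inj_single injD single_zero)

lemma monomial_eq: "Poly_Mapping.single m c = const_poly c * (\<Prod>i\<in>UNIV. Xv i ^ Poly_Mapping.lookup m i)"
proof -
  have pw: "Xv i ^ n = Poly_Mapping.single (Poly_Mapping.single i n) 1" for i n
    by (induction n) (simp_all add: Xv_def mult_single flip: single_add)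
  have "(\<Prod>i\<in>S. Xv i ^ Poly_Mapping.lookup m i) = Poly_Mapping.single (\<Sum>i\<in>S. Poly_Mapping.single i (Poly_Mapping.lookup m i)) 1"
    if "finite S" for S using that
    by (induction S rule: finite_induct) (simp_all add: pw mult_single)
  moreover have "(\<Sum>i\<in>UNIV. Poly_Mapping.single i (Poly_Mapping.lookup m i)) = m"
    by (rule poly_mapping_eqI) (simp add: lookup_sum lookup_single when_def)
  ultimately show ?thesis by (simp add: const_poly_def mult_single)
qed

lemma (in subst_hom) sub_unique:
  assumes "\<And>p q. F (p + q) = F p + F q" "\<And>p q. F (p * q) = F p * F q"
    "\<And>c. F (const_poly c) = \<phi> c" "\<And>i. F (Xv i) = X i"
  shows "F p = sub p"
proof (induction p rule: poly3_induct)
  case (single m c)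
  have F1: "F 1 = 1" using assms(3)[of 1] by (simp add: hom_1)
  have pw: "F (q ^ n) = F q ^ n" for q n by (induction n) (simp_all add: F1 assms)
  have "F (\<Prod>i\<in>S. q i) = (\<Prod>i\<in>S. F (q i))" if "finite S" for S and q :: "3 \<Rightarrow> poly3"
    using that by (induction S rule: finite_induct) (simp_all add: F1 assms)
  then show ?case by (simp add: sub_single monomial_eq assms pw sub_mult sub_const sub_prod sub_power sub_X)
qed (simp add: assms sub_add)

section \<open>The grading\<close>

text \<open>Multiplying each variable by a new indeterminate turns the grading into the grading of univariate
polynomials: the coefficients of the image of \<open>p\<close> are the homogeneous components of \<open>p\<close>. Facts about
degrees of products are thereby inherited from univariate polynomials over a domain.\<close>

global_interpretation gr: subst_hom "\<lambda>c. [:const_poly c:]" "\<lambda>i. monom (Xv i) 1"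
  defines gr = gr.sub
  by unfold_locales (simp_all add: const_poly_add const_poly_mult one_pCons)

lemma prod_monom: "finite S \<Longrightarrow> (\<Prod>i\<in>S. monom (a i) (n i)) = monom (\<Prod>i\<in>S. a i) (\<Sum>i\<in>S. n i)"
  by (induction S rule: finite_induct) (auto simp: mult_monom monom_0 one_pCons)

lemma gr_single: "gr (Poly_Mapping.single m c) = monom (Poly_Mapping.single m c) (mono_degree m)"
proof -
  have "gr (Poly_Mapping.single m c) = monom (const_poly c) 0 * (\<Prod>i\<in>UNIV. monom (Xv i ^ Poly_Mapping.lookup m i) (Poly_Mapping.lookup m i))"
    by (simp add: gr.sub_single monom_power monom_0)
  then show ?thesis by (simp add: prod_monom mult_monom monomial_eq mono_degree_def)
qed

definition hcomp :: "nat \<Rightarrow> poly3 \<Rightarrow> poly3" where "hcomp k p = coeff (gr p) k"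

lemma hcomp_add: "hcomp k (p + q) = hcomp k p + hcomp k q"
  by (simp add: hcomp_def gr.sub_add)

lemma hcomp_sum: "hcomp k (sum f S) = (\<Sum>x\<in>S. hcomp k (f x))"
  by (simp add: hcomp_def gr.sub_sum coeff_sum)

lemma hcomp_0 [simp]: "hcomp k 0 = 0" by (simp add: hcomp_def)

lemma lookup_hcomp: "Poly_Mapping.lookup (hcomp k p) m = (if mono_degree m = k then Poly_Mapping.lookup p m else 0)"
proof (induction p rule: poly3_induct)
  case (single m' c)
  then show ?case by (auto simp: hcomp_def gr_single lookup_single when_def)
qed (auto simp: hcomp_add lookup_add)

lemma homogeneous_alt: "homogeneous k p \<longleftrightarrow> (\<forall>m. mono_degree m \<noteq> k \<longrightarrow> Poly_Mapping.lookup p m = 0)"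
  by (auto simp: homogeneous_def in_keys_iff)

lemma homogeneous_iff_gr: "homogeneous k p \<longleftrightarrow> gr p = monom p k"
proof
  assume h: "homogeneous k p"
  have "hcomp j p = (if j = k then p else 0)" for j
    using h by (intro poly_mapping_eqI) (auto simp: lookup_hcomp homogeneous_alt)
  then show "gr p = monom p k" by (intro poly_eqI) (auto simp: hcomp_def)
next
  assume g: "gr p = monom p k"
  then have "hcomp j p = (if j = k then p else 0)" for j by (simp add: hcomp_def)
  then show "homogeneous k p" unfolding homogeneous_alt
    by (metis lookup_hcomp lookup_zero)
qed

lemma hcomp_homogeneous: "homogeneous k p \<Longrightarrow> hcomp j p = (if j = k then p else 0)"
  by (simp add: homogeneous_iff_gr hcomp_def)

lemma homogeneous_hcomp: "homogeneous k (hcomp k p)"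
  by (simp add: homogeneous_alt lookup_hcomp)

lemma hcomp_mult: "homogeneous k p \<Longrightarrow> hcomp j (p * q) = (if k \<le> j then p * hcomp (j - k) q else 0)"
  by (auto simp: homogeneous_iff_gr hcomp_def gr.sub_mult coeff_monom_mult)

lemma sum_hcomp: "(\<Sum>j\<le>degree (gr p). hcomp j p) = p"
proof -
  have "Poly_Mapping.lookup (\<Sum>j\<le>degree (gr p). hcomp j p) m = Poly_Mapping.lookup p m" for m
  proof -
    have "Poly_Mapping.lookup (\<Sum>j\<le>degree (gr p). hcomp j p) m = (\<Sum>j\<le>degree (gr p). if mono_degree m = j then Poly_Mapping.lookup p m else 0)"
      by (simp add: lookup_sum lookup_hcomp)
    also have "\<dots> = (if mono_degree m \<le> degree (gr p) then Poly_Mapping.lookup p m else 0)"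
      by (simp add: sum.delta')
    also have "\<dots> = Poly_Mapping.lookup p m"
    proof -
      have "Poly_Mapping.lookup p m = Poly_Mapping.lookup (hcomp (mono_degree m) p) m"
        by (simp add: lookup_hcomp)
      then show ?thesis by (auto simp: hcomp_def coeff_eq_0)
    qed
    finally show ?thesis .
  qed
  then show ?thesis by (rule poly_mapping_eqI)
qed

lemma homogeneous_0 [simp]: "homogeneous k 0" by (simp add: homogeneous_def)

lemma homogeneous_add: "homogeneous k p \<Longrightarrow> homogeneous k q \<Longrightarrow> homogeneous k (p + q)"
  by (simp add: homogeneous_alt lookup_add)

lemma homogeneous_diff: "homogeneous k p \<Longrightarrow> homogeneous k q \<Longrightarrow> homogeneous k (p - q)"
  by (simp add: homogeneous_alt lookup_minus)

lemma homogeneous_sum: "(\<And>x. x \<in> S \<Longrightarrow> homogeneous k (f x)) \<Longrightarrow> homogeneous k (sum f S)"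
  by (induction S rule: infinite_finite_induct) (auto intro: homogeneous_add)

lemma homogeneous_mult: "homogeneous j p \<Longrightarrow> homogeneous k q \<Longrightarrow> homogeneous (j + k) (p * q)"
  by (simp add: homogeneous_iff_gr gr.sub_mult mult_monom)

lemma homogeneous_const [simp]: "homogeneous 0 (const_poly c)"
  by (simp add: homogeneous_iff_gr gr.sub_const monom_0)

lemma homogeneous_Xv [simp]: "homogeneous (Suc 0) (Xv i)"
  by (simp add: homogeneous_iff_gr gr.sub_X)

lemma homogeneous_cmult: "homogeneous k p \<Longrightarrow> homogeneous k (const_poly c * p)"
  using homogeneous_mult[of 0 "const_poly c" k p] by simp

lemma homogeneous_power: "homogeneous (Suc 0) p \<Longrightarrow> homogeneous n (p ^ n)"
proof (induction n)
  case 0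
  then show ?case using homogeneous_const[of 1] by simp
next
  case (Suc n)
  then show ?case using homogeneous_mult[of "Suc 0" p n "p ^ n"] by simp
qed

lemma homogeneous_prod:
  "finite S \<Longrightarrow> (\<And>x. x \<in> S \<Longrightarrow> homogeneous (Suc 0) (f x)) \<Longrightarrow> homogeneous (card S) (\<Prod>x\<in>S. f x)"
proof (induction S rule: finite_induct)
  case empty
  then show ?case using homogeneous_const[of 1] by simp
next
  case (insert x F)
  then show ?case using homogeneous_mult[of "Suc 0" "f x" "card F" "prod f F"] by simp
qed

lemma homogeneous_factor:
  assumes "homogeneous j p" "p \<noteq> 0" "homogeneous (j + k) (p * q)"
  shows "homogeneous k q"
proof -
  have "monom p j * gr q = monom p j * monom q k"
    using assms by (simp add: homogeneous_iff_gr gr.sub_mult mult_monom)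
  then show ?thesis using assms(2) by (simp add: homogeneous_iff_gr)
qed

lemma homogeneous_0_const: "homogeneous 0 p \<Longrightarrow> \<exists>c. p = const_poly c"
proof -
  assume h: "homogeneous 0 p"
  have m0: "mono_degree m = 0 \<longleftrightarrow> m = 0" for m
  proof
    assume "mono_degree m = 0"
    then show "m = 0" by (intro poly_mapping_eqI) (simp add: mono_degree_def)
  qed (simp add: mono_degree_def)
  then have "p = const_poly (Poly_Mapping.lookup p 0)"
    using h by (intro poly_mapping_eqI) (auto simp: homogeneous_alt const_poly_def lookup_single when_def m0)
  then show ?thesis ..
qed

lemma homogeneous_Suc_decomp:
  assumes "homogeneous (Suc k) p"
  shows "\<exists>q. (\<forall>i. homogeneous k (q i)) \<and> p = (\<Sum>i\<in>UNIV. Xv i * q i)"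
proof -
  define Q where "Q = {p. \<exists>q. (\<forall>i. homogeneous k (q i)) \<and> p = (\<Sum>i\<in>UNIV. Xv i * q i)}"
  have Q0: "0 \<in> Q" unfolding Q_def by (auto intro!: exI[of _ "\<lambda>_. 0"])
  have Qadd: "p + q \<in> Q" if pq: "p \<in> Q" "q \<in> Q" for p q
  proof -
    obtain a b where "\<forall>i. homogeneous k (a i)" "p = (\<Sum>i\<in>UNIV. Xv i * a i)"
      "\<forall>i. homogeneous k (b i)" "q = (\<Sum>i\<in>UNIV. Xv i * b i)" using pq unfolding Q_def by auto
    then show ?thesis unfolding Q_def
      by (auto intro!: exI[of _ "\<lambda>i. a i + b i"] homogeneous_add simp: distrib_left sum.distrib)
  qed
  have Qs: "Poly_Mapping.single m c \<in> Q" if "mono_degree m = Suc k" for m c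
  proof -
    have "\<exists>i. Poly_Mapping.lookup m i \<noteq> 0"
    proof (rule ccontr)
      assume "\<nexists>i. Poly_Mapping.lookup m i \<noteq> 0"
      then show False using that by (simp add: mono_degree_def)
    qed
    then obtain i where i: "Poly_Mapping.lookup m i \<noteq> 0" by blast
    define m' where "m' = m - Poly_Mapping.single i 1"
    have m: "m = Poly_Mapping.single i 1 + m'"
      using i by (intro poly_mapping_eqI) (auto simp: m'_def lookup_add lookup_minus lookup_single when_def)
    have "mono_degree m = Suc (mono_degree m')"
      unfolding mono_degree_def by (subst m) (simp add: lookup_add sum.distrib lookup_single when_def)
    then have h: "homogeneous k (Poly_Mapping.single m' c)"
      using that by (auto simp: homogeneous_alt lookup_single when_def)
    have "Poly_Mapping.single m c = Xv i * Poly_Mapping.single m' c"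
      by (subst m) (simp add: Xv_def mult_single)
    also have "\<dots> = (\<Sum>j\<in>UNIV. Xv j * (if j = i then Poly_Mapping.single m' c else 0))"
      by (simp add: if_distrib cong: if_cong)
    finally show ?thesis unfolding Q_def using h by (auto intro!: exI[of _ "\<lambda>j. if j = i then Poly_Mapping.single m' c else 0"])
  qed
  have "(\<Sum>m\<in>S. Poly_Mapping.single m (Poly_Mapping.lookup p m)) \<in> Q" if "finite S" "S \<subseteq> Poly_Mapping.keys p" for S
    using that assms by (induction S rule: finite_induct) (auto intro!: Q0 Qadd Qs simp: homogeneous_def)
  from this[OF finite_keys order_refl] have "p \<in> Q" by (subst poly3_expand)
  then show ?thesis unfolding Q_def by blast
qed

section \<open>Linear forms, restriction to a line and partial derivatives\<close>

global_interpretation ev: subst_hom "\<lambda>c. c" "\<lambda>i. v $ i" for v :: "complex^3"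
  defines ev = ev.sub
  by unfold_locales auto

lemma eval_poly_ev: "eval_poly p v = ev v p"
  by (simp add: ev.sub_def lin_ext_def eval_poly_def)

text \<open>A vector \<open>a\<close> stands for the linear form \<open>a\<^sub>1 x + a\<^sub>2 y + a\<^sub>3 z\<close>, and hence for a line. The bilinear
pairing \<open>dot\<close> evaluates this form at a point; it is not the hermitian inner product.\<close>

definition dot :: "complex^3 \<Rightarrow> complex^3 \<Rightarrow> complex" where
  "dot a v = (\<Sum>i\<in>UNIV. a $ i * v $ i)"

definition lf :: "complex^3 \<Rightarrow> poly3" where
  "lf a = (\<Sum>i\<in>UNIV. const_poly (a $ i) * Xv i)"

text \<open>For a derivation \<open>\<theta>\<close> with coefficients \<open>\<theta>\<^sub>1, \<theta>\<^sub>2, \<theta>\<^sub>3\<close> this is \<open>\<theta>(\<ell>)\<close> for the linear form \<open>\<ell>\<close> given by \<open>a\<close>.\<close>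

definition app :: "complex^3 \<Rightarrow> poly3^3 \<Rightarrow> poly3" where
  "app a \<theta> = (\<Sum>i\<in>UNIV. const_poly (a $ i) * \<theta> $ i)"

definition line_coords :: "complex^3 \<Rightarrow> complex^3 \<Rightarrow> 3 \<Rightarrow> complex poly" where
  "line_coords u w i = [:u $ i, w $ i:]"

text \<open>Restriction to the line spanned by \<open>u\<close> and \<open>w\<close>, in the affine parameter \<open>t\<close> of the point \<open>u + t w\<close>.
A form of degree \<open>k\<close> becomes a polynomial of degree at most \<open>k\<close>.\<close>

global_interpretation res: subst_hom "\<lambda>c. [:c:]" "line_coords u w" for u w :: "complex^3"
  defines res = res.sub
  by unfold_locales simp_all

lemma poly_res: "poly (res u w p) t = eval_poly p (u + t *s w)"
proof -
  have "poly (res u w p) t = ev (u + t *s w) p"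
    by (rule ev.sub_unique[where F = "\<lambda>p. poly (res u w p) t"]) (simp_all add: res.sub_add res.sub_mult res.sub_const res.sub_X line_coords_def)
  then show ?thesis by (simp add: eval_poly_ev)
qed

lemma degree_res:
  assumes "homogeneous k p" shows "degree (res u w p) \<le> k"
  using assms
proof (induction k arbitrary: p)
  case 0
  then obtain c where "p = const_poly c" using homogeneous_0_const by blast
  then show ?case by (simp add: res.sub_const)
next
  case (Suc k)
  obtain q where q: "\<And>i. homogeneous k (q i)" "p = (\<Sum>i\<in>UNIV. Xv i * q i)"
    using homogeneous_Suc_decomp[OF Suc.prems] by blast
  have "degree (res u w (Xv i) * res u w (q i)) \<le> Suc k" for i
  proof -
    have "degree (res u w (Xv i)) \<le> 1" by (simp add: res.sub_X line_coords_def)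
    then show ?thesis using Suc.IH[OF q(1)[of i]] degree_mult_le[of "res u w (Xv i)" "res u w (q i)"]
      by linarith
  qed
  then show ?case unfolding q(2) by (auto simp: res.sub_sum res.sub_mult intro!: degree_sum_le)
qed

lemma res_lf: "res u w (lf a) = [:dot a u, dot a w:]"
proof -
  have "res u w (lf a) = (\<Sum>i\<in>UNIV. [:a $ i * u $ i, a $ i * w $ i:])"
    by (simp add: lf_def res.sub_sum res.sub_mult res.sub_const res.sub_X line_coords_def mult.commute)
  also have "\<dots> = [:dot a u, dot a w:]" by (simp add: dot_def sum_3)
  finally show ?thesis .
qed

lemma eval_lf: "eval_poly (lf a) v = dot a v"
  by (simp add: eval_poly_ev lf_def dot_def ev.sub_sum ev.sub_mult ev.sub_const ev.sub_X)

lemma homogeneous_lf [simp]: "homogeneous (Suc 0) (lf a)"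
  unfolding lf_def by (intro homogeneous_sum homogeneous_cmult homogeneous_Xv)

lemma linear_form_lf:
  assumes "homogeneous (Suc 0) p" shows "\<exists>a. p = lf a"
proof -
  obtain q where q: "\<And>i. homogeneous 0 (q i)" "p = (\<Sum>i\<in>UNIV. Xv i * q i)"
    using homogeneous_Suc_decomp[OF assms] by blast
  obtain c where "\<And>i. q i = const_poly (c i)" using homogeneous_0_const[OF q(1)] by metis
  then have "p = lf (\<chi> i. c i)" using q(2) by (simp add: lf_def mult.commute)
  then show ?thesis ..
qed

lemma partial_lin_ext: "partial i p = lin_ext (\<lambda>m c. Poly_Mapping.single (m - Poly_Mapping.single i 1)
       (of_nat (Poly_Mapping.lookup m i) * c)) p"
  by (simp add: partial_def lin_ext_def)

lemma partial_add: "partial i (p + q) = partial i p + partial i q"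
  unfolding partial_lin_ext by (rule lin_ext_add) (auto simp: distrib_left single_add)

lemma partial_single: "partial i (Poly_Mapping.single m c) =
    Poly_Mapping.single (m - Poly_Mapping.single i 1) (of_nat (Poly_Mapping.lookup m i) * c)"
  unfolding partial_lin_ext by (rule lin_ext_single) simp

lemma single_minus_add:
  fixes m m' :: mono3
  assumes "Poly_Mapping.lookup m i \<noteq> 0"
  shows "m - Poly_Mapping.single i 1 + m' = m + m' - Poly_Mapping.single i 1"
  using assms by (intro poly_mapping_eqI) (auto simp: lookup_add lookup_minus lookup_single when_def)

lemma partial_mult: "partial i (p * q) = partial i p * q + p * partial i q"
proof (induction p rule: poly3_induct)
  case (single m c)
  show ?case
  proof (induction q rule: poly3_induct)
    case (single m' c')
    have 1: "partial i (Poly_Mapping.single m c) * Poly_Mapping.single m' c' =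
       Poly_Mapping.single (m + m' - Poly_Mapping.single i 1) (of_nat (Poly_Mapping.lookup m i) * (c * c'))"
      by (cases "Poly_Mapping.lookup m i = 0") (simp_all add: partial_single mult_single single_minus_add[unfolded One_nat_def] mult.assoc)
    have 2: "Poly_Mapping.single m c * partial i (Poly_Mapping.single m' c') =
       Poly_Mapping.single (m + m' - Poly_Mapping.single i 1) (of_nat (Poly_Mapping.lookup m' i) * (c * c'))"
      using single_minus_add[unfolded One_nat_def, of m' i m]
      by (cases "Poly_Mapping.lookup m' i = 0") (simp_all add: partial_single mult_single add.commute mult.left_commute)
    show ?case unfolding 1 2
      by (simp add: mult_single partial_single lookup_add algebra_simps flip: single_add)
  next
    case (add p q)
    then show ?case by (simp add: partial_add algebra_simps)
  qed
next
  case (add p q)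
  then show ?case by (simp add: partial_add algebra_simps)
qed

lemma partial_const: "partial i (const_poly c) = 0"
  by (simp add: const_poly_def partial_single)

lemma partial_Xv: "partial i (Xv j) = (if i = j then 1 else 0)"
  by (simp add: Xv_def partial_single lookup_single)

lemma homogeneous_partial:
  assumes "homogeneous (Suc k) p" shows "homogeneous k (partial i p)"
proof -
  have "homogeneous k (Poly_Mapping.single (m - Poly_Mapping.single i 1) (of_nat (Poly_Mapping.lookup m i) * c))"
    if "mono_degree m = Suc k" for m c
  proof (cases "Poly_Mapping.lookup m i = 0")
    case False
    then have "mono_degree m = Suc (mono_degree (m - Poly_Mapping.single i 1))"
      unfolding mono_degree_def using single_minus_add[of m i "Poly_Mapping.single i 1"]
    proof -
      assume "Poly_Mapping.lookup m i \<noteq> 0"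
      then have "m = (m - Poly_Mapping.single i 1) + Poly_Mapping.single i 1"
        by (intro poly_mapping_eqI) (auto simp: lookup_add lookup_minus lookup_single when_def)
      then have "(\<Sum>j\<in>UNIV. Poly_Mapping.lookup m j) = (\<Sum>j\<in>UNIV. Poly_Mapping.lookup ((m - Poly_Mapping.single i 1) + Poly_Mapping.single i 1) j)"
        by simp
      then show "(\<Sum>j\<in>UNIV. Poly_Mapping.lookup m j) = Suc (\<Sum>j\<in>UNIV. Poly_Mapping.lookup (m - Poly_Mapping.single i 1) j)"
        unfolding lookup_add sum.distrib by (simp add: lookup_single when_def)
    qed
    with that show ?thesis by (auto simp: homogeneous_alt lookup_single when_def)
  qed simp
  then show ?thesis unfolding partial_def
    using assms by (intro homogeneous_sum) (auto simp: homogeneous_def)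
qed

section \<open>Common factors\<close>

text \<open>The polynomial ring is identified with \<open>\<complex>[x][y][z]\<close>, which is known to be factorial; this is how greatest
common divisors become available.\<close>

definition tower_var :: "3 \<Rightarrow> complex poly poly poly" where
  "tower_var i = (if i = 1 then [:[:[:0, 1:]:]:] else if i = 2 then [:[:0, 1:]:] else [:0, 1:])"

global_interpretation tower: subst_hom "\<lambda>c. [:[:[:c:]:]:]" tower_var
  defines tower = tower.sub
  by unfold_locales (simp_all add: pCons_one)

lemma prod_three: "prod f (UNIV :: 3 set) = f 1 * f 2 * f 3"
  unfolding UNIV_3 by (simp add: ac_simps)

lemma tower_single: "tower (Poly_Mapping.single m c) =
  monom (monom (monom c (Poly_Mapping.lookup m 1)) (Poly_Mapping.lookup m 2)) (Poly_Mapping.lookup m 3)"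
proof -
  have "[:[:[:0, 1::complex:]:]:] ^ n = [:[:monom 1 n:]:]" for n
    by (induction n) (simp_all add: monom_Suc pCons_one monom_0)
  moreover have "[:[:0, 1::complex poly:]:] ^ n = [:monom 1 n:]" for n
    by (induction n) (simp_all add: monom_Suc pCons_one monom_0)
  moreover have "[:0, 1::complex poly poly:] ^ n = monom 1 n" for n
    by (induction n) (simp_all add: monom_Suc pCons_one monom_0)
  ultimately show ?thesis
    by (simp add: tower.sub_single prod_three tower_var_def smult_monom)
qed

lemma coeff_tower: "coeff (coeff (coeff (tower p) (Poly_Mapping.lookup m 3)) (Poly_Mapping.lookup m 2)) (Poly_Mapping.lookup m 1)
  = Poly_Mapping.lookup p m"
proof (induction p rule: poly3_induct)
  case (single m' c)
  have "m' = m \<longleftrightarrow> Poly_Mapping.lookup m' 1 = Poly_Mapping.lookup m 1 \<and> Poly_Mapping.lookup m' 2 = Poly_Mapping.lookup m 2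
    \<and> Poly_Mapping.lookup m' 3 = Poly_Mapping.lookup m 3"
  proof (intro iffI poly_mapping_eqI)
    fix i assume "Poly_Mapping.lookup m' 1 = Poly_Mapping.lookup m 1 \<and> Poly_Mapping.lookup m' 2 = Poly_Mapping.lookup m 2
      \<and> Poly_Mapping.lookup m' 3 = Poly_Mapping.lookup m 3"
    then show "Poly_Mapping.lookup m' i = Poly_Mapping.lookup m i" using exhaust_3[of i] by auto
  qed simp
  then show ?case by (simp add: tower_single lookup_single when_def)
qed (simp add: tower.sub_add lookup_add)

lemma tower_eq_0: "tower p = 0 \<Longrightarrow> p = 0"
  by (rule poly_mapping_eqI) (simp flip: coeff_tower)

lemma tower_inj: "tower p = tower q \<Longrightarrow> p = q"
  using tower_eq_0[of "p - q"] by (simp add: tower.sub_diff)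

lemma tower_surj: "\<exists>p. tower p = q"
proof -
  have 1: "\<exists>p. tower p = [:[:a:]:]" for a
  proof (induction a)
    case 0 then show ?case by (auto intro!: exI[of _ 0])
  next
    case (pCons c a)
    then obtain p where "tower p = [:[:a:]:]" by blast
    then have "tower (const_poly c + Xv 1 * p) = [:[:pCons c a:]:]"
      by (simp add: tower.sub_add tower.sub_mult tower.sub_const tower.sub_X tower_var_def)
    then show ?case by blast
  qed
  have 2: "\<exists>p. tower p = [:b:]" for b
  proof (induction b)
    case 0 then show ?case by (auto intro!: exI[of _ 0])
  next
    case (pCons a b)
    obtain p where "tower p = [:[:a:]:]" using 1 by blast
    moreover obtain p' where "tower p' = [:b:]" using pCons by blast
    ultimately have "tower (p + Xv 2 * p') = [:pCons a b:]"
      by (simp add: tower.sub_add tower.sub_mult tower.sub_X tower_var_def)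
    then show ?case by blast
  qed
  show ?thesis
  proof (induction q)
    case 0 then show ?case by (auto intro!: exI[of _ 0])
  next
    case (pCons a b)
    obtain p where "tower p = [:a:]" using 2 by blast
    moreover obtain p' where "tower p' = b" using pCons by blast
    ultimately have "tower (p + Xv 3 * p') = pCons a b"
      by (simp add: tower.sub_add tower.sub_mult tower.sub_X tower_var_def)
    then show ?case by blast
  qed
qed

lemma tower_dvd: "tower p dvd tower q \<Longrightarrow> p dvd q"
  by (metis dvdE dvdI tower.sub_mult tower_inj tower_surj)

text \<open>Existence of a greatest common divisor \<open>g\<close>, with the coprimality of the cofactors stated in the form in
which it is used: a relation \<open>b' c = a' d\<close> forces \<open>a'\<close> to divide \<open>c\<close>.\<close>

lemma common_factor:
  fixes a b :: poly3
  assumes "a \<noteq> 0"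
  obtains g a' b' where "a = g * a'" "b = g * b'" "\<And>c d. b' * c = a' * d \<Longrightarrow> a' dvd c"
proof -
  define G where "G = gcd (tower a) (tower b)"
  have G0: "G \<noteq> 0" using assms tower_eq_0 unfolding G_def by auto
  obtain A' B' where AB: "tower a = A' * G" "tower b = B' * G" "coprime A' B'"
    using gcd_coprime_exists[of "tower a" "tower b"] G0 unfolding G_def by blast
  obtain g a' b' where t: "tower g = G" "tower a' = A'" "tower b' = B'" using tower_surj by metis
  have "a = g * a'" "b = g * b'"
    by (rule tower_inj, simp add: tower.sub_mult AB t mult.commute)+
  moreover have "a' dvd c" if "b' * c = a' * d" for c d
  proof (rule tower_dvd)
    have "A' dvd B' * tower c" using that t by (metis dvdI tower.sub_mult)
    then show "tower a' dvd tower c" using AB(3) t by (simp add: coprime_dvd_mult_right_iff)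
  qed
  ultimately show ?thesis using that by blast
qed

lemma ev_tower: "ev v p = poly (poly (poly (tower p) [:[:v $ 3:]:]) [:v $ 2:]) (v $ 1)"
proof -
  have "(\<lambda>p. poly (poly (poly (tower p) [:[:v $ 3:]:]) [:v $ 2:]) (v $ 1)) p = ev v p"
    by (rule ev.sub_unique[where F = "\<lambda>p. poly (poly (poly (tower p) [:[:v $ 3:]:]) [:v $ 2:]) (v $ 1)"])
       (use exhaust_3 in \<open>auto simp: tower.sub_add tower.sub_mult tower.sub_const tower.sub_X tower_var_def\<close>)
  then show ?thesis by simp
qed

lemma poly_const_all_0:
  fixes p :: "'a::{idom, ring_char_0} poly poly"
  assumes "\<And>c. poly p [:c:] = 0" shows "p = 0"
proof (rule ccontr)
  assume "p \<noteq> 0"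
  then have "finite {x. poly p x = 0}" by (rule poly_roots_finite)
  moreover have "range (\<lambda>c::'a. [:c:]) \<subseteq> {x. poly p x = 0}" using assms by auto
  ultimately have "finite (range (\<lambda>c::'a. [:c:]))" by (rule finite_subset[rotated])
  then have "finite (UNIV :: 'a set)" by (rule finite_imageD) (simp add: inj_on_def)
  then show False using infinite_UNIV_char_0 by blast
qed

text \<open>A polynomial over an infinite field that vanishes as a function is zero: peel off one variable at a time.\<close>

lemma ev_all_0:
  assumes "\<And>v. ev v p = 0" shows "p = 0"
proof -
  have "poly (poly (poly (tower p) [:[:z:]:]) [:y:]) x = 0" for x y z
    using assms[of "vector [x, y, z]"] by (simp add: ev_tower)
  then have "poly (poly (tower p) [:[:z:]:]) [:y:] = 0" for y z
    using poly_all_0_iff_0 by blast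
  then have "poly (tower p) [:[:z:]:] = 0" for z using poly_const_all_0 by blast
  then have *: "poly (tower p) [:[:z:]:] = 0" for z .
  have "tower p = 0"
  proof (rule ccontr)
    assume "tower p \<noteq> 0"
    then have "finite {x. poly (tower p) x = 0}" by (rule poly_roots_finite)
    moreover have "range (\<lambda>c. [:[:c:]:]) \<subseteq> {x. poly (tower p) x = 0}" using * by auto
    ultimately have "finite (range (\<lambda>c::complex. [:[:c:]:]))" by (rule finite_subset[rotated])
    then have "finite (UNIV :: complex set)" by (rule finite_imageD) (simp add: inj_on_def)
    then show False using infinite_UNIV_char_0 by blast
  qed
  then show ?thesis by (rule tower_eq_0)
qed

section \<open>Coordinates adapted to a line\<close>

lemma dot_add: "dot a (x + y) = dot a x + dot a y"
  and dot_scale: "dot a (c *s x) = c * dot a x"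
  and dot_scale_left: "dot (c *s a) x = c * dot a x"
  and dot_zero [simp]: "dot a 0 = 0" "dot 0 x = 0"
  by (simp_all add: dot_def sum_3 algebra_simps)

lemma dot_axis: "dot a (axis i 1) = a $ i"
proof -
  have "dot a (axis i 1) = (\<Sum>j\<in>UNIV. if j = i then a $ j else 0)"
    unfolding dot_def by (rule sum.cong) (auto simp: axis_def)
  then show ?thesis by simp
qed

lemma app_add: "app a (x + y) = app a x + app a y"
  and app_smult: "app a (q *s x) = q * app a x"
  and app_diff: "app a (x - y) = app a x - app a y"
  and app_zero [simp]: "app a 0 = 0"
  by (simp_all add: app_def sum_3 algebra_simps)

lemma app_sum: "app a (sum f S) = (\<Sum>x\<in>S. app a (f x))"
  by (induction S rule: infinite_finite_induct) (auto simp: app_add)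

text \<open>A point as a derivation with constant coefficients.\<close>

definition cvec :: "complex^3 \<Rightarrow> poly3^3" where "cvec x = (\<chi> i. const_poly (x $ i))"

lemma app_cvec: "app a (cvec x) = const_poly (dot a x)"
  by (simp add: app_def cvec_def dot_def sum_3 const_poly_add const_poly_mult)

definition Euler :: "poly3^3" where "Euler = (\<chi> i. Xv i)"

lemma app_Euler: "app a Euler = lf a"
  by (simp add: app_def Euler_def lf_def)

lemma homogeneous_app: "homogeneous_triple k \<theta> \<Longrightarrow> homogeneous k (app a \<theta>)"
  unfolding app_def homogeneous_triple_def by (intro homogeneous_sum homogeneous_cmult) auto

lemma homogeneous_triple_add: "homogeneous_triple k x \<Longrightarrow> homogeneous_triple k y \<Longrightarrow> homogeneous_triple k (x + y)"
  and homogeneous_triple_diff: "homogeneous_triple k x \<Longrightarrow> homogeneous_triple k y \<Longrightarrow> homogeneous_triple k (x - y)"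
  and homogeneous_triple_0 [simp]: "homogeneous_triple k 0"
  by (auto simp: homogeneous_triple_def homogeneous_add homogeneous_diff)

lemma homogeneous_triple_smult:
  "homogeneous j q \<Longrightarrow> homogeneous_triple k x \<Longrightarrow> homogeneous_triple (j + k) (q *s x)"
  by (auto simp: homogeneous_triple_def homogeneous_mult)

lemma homogeneous_triple_cmult:
  "homogeneous_triple k x \<Longrightarrow> homogeneous_triple k (const_poly c *s x)"
  using homogeneous_triple_smult[of 0 "const_poly c" k x] by simp

lemma homogeneous_triple_cvec [simp]: "homogeneous_triple 0 (cvec x)"
  by (simp add: homogeneous_triple_def cvec_def)

lemma homogeneous_triple_Euler [simp]: "homogeneous_triple (Suc 0) Euler"
  by (simp add: homogeneous_triple_def Euler_def)

lemma lf_eq_iff: "lf a = lf b \<longleftrightarrow> a = b"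
proof
  assume "lf a = lf b"
  then have "dot a v = dot b v" for v by (metis eval_lf)
  then show "a = b" by (metis dot_axis vec_eq_iff)
qed simp

lemma lf_eq_0_iff: "lf a = 0 \<longleftrightarrow> a = 0"
proof -
  have "lf 0 = 0" by (simp add: lf_def)
  then show ?thesis using lf_eq_iff by metis
qed

lemma lf_scale: "lf (c *s a) = const_poly c * lf a"
  by (simp add: lf_def const_poly_mult sum_distrib_left mult.assoc)

text \<open>Coordinates adapted to the line \<open>a = 0\<close>: the linear forms \<open>a, l, m\<close> and the vectors \<open>v, u, w\<close> are dual bases.
The line is spanned by \<open>u\<close> and \<open>w\<close>, and on the point \<open>u + t w\<close> the forms \<open>l\<close> and \<open>m\<close> take the
values \<open>1\<close> and \<open>t\<close>.\<close>

locale frame =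
  fixes a v l m u w :: "complex^3"
  assumes expand: "x = dot a x *s v + dot l x *s u + dot m x *s w"
    and dual [simp]: "dot a v = 1" "dot a u = 0" "dot a w = 0" "dot l v = 0" "dot l u = 1" "dot l w = 0"
      "dot m v = 0" "dot m u = 0" "dot m w = 1"
begin

lemma delta: "a $ j * v $ i + l $ j * u $ i + m $ j * w $ i = (if i = j then 1 else 0)"
proof -
  have "(axis j 1 :: complex^3) $ i = (dot a (axis j 1) *s v + dot l (axis j 1) *s u + dot m (axis j 1) *s w) $ i"
    using expand[of "axis j 1"] by simp
  moreover have "(axis j 1 :: complex^3) $ i = (if i = j then 1 else 0)" by (simp add: axis_def)
  ultimately show ?thesis by (simp add: dot_axis)
qed

lemma expand_component:
  fixes z :: "3 \<Rightarrow> poly3"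
  shows "z i = const_poly (v $ i) * (\<Sum>j\<in>UNIV. const_poly (a $ j) * z j)
     + const_poly (u $ i) * (\<Sum>j\<in>UNIV. const_poly (l $ j) * z j)
     + const_poly (w $ i) * (\<Sum>j\<in>UNIV. const_poly (m $ j) * z j)"
proof -
  have "const_poly (v $ i) * (\<Sum>j\<in>UNIV. const_poly (a $ j) * z j)
     + const_poly (u $ i) * (\<Sum>j\<in>UNIV. const_poly (l $ j) * z j)
     + const_poly (w $ i) * (\<Sum>j\<in>UNIV. const_poly (m $ j) * z j)
    = (\<Sum>j\<in>UNIV. const_poly (a $ j * v $ i + l $ j * u $ i + m $ j * w $ i) * z j)"
    by (simp add: const_poly_add const_poly_mult sum_distrib_left algebra_simps sum.distrib)
  also have "\<dots> = (\<Sum>j\<in>UNIV. if i = j then z j else 0)"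
    unfolding delta by (rule sum.cong) auto
  finally show ?thesis by simp
qed

lemma Xv_expand: "Xv i = const_poly (v $ i) * lf a + const_poly (u $ i) * lf l + const_poly (w $ i) * lf m"
  unfolding lf_def by (rule expand_component)

lemma triple_expand: "\<theta> $ i = const_poly (v $ i) * app a \<theta> + const_poly (u $ i) * app l \<theta> + const_poly (w $ i) * app m \<theta>"
  unfolding app_def by (rule expand_component)

lemma covector_expand: "b = dot b v *s a + dot b u *s l + dot b w *s m"
proof -
  have "b $ j = (dot b v *s a + dot b u *s l + dot b w *s m) $ j" for j
  proof -
    have "b $ j = dot b (axis j 1)" by (simp add: dot_axis)
    also have "\<dots> = dot b (dot a (axis j 1) *s v + dot l (axis j 1) *s u + dot m (axis j 1) *s w)"
      using expand[of "axis j 1"] by simp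
    finally show ?thesis by (simp add: dot_add dot_scale dot_axis mult.commute)
  qed
  then show ?thesis by (simp add: vec_eq_iff)
qed

lemma app_expand: "app b \<theta> = const_poly (dot b v) * app a \<theta> + const_poly (dot b u) * app l \<theta> + const_poly (dot b w) * app m \<theta>"
proof -
  have "app (dot b v *s a + dot b u *s l + dot b w *s m) \<theta> = const_poly (dot b v) * app a \<theta> + const_poly (dot b u) * app l \<theta> + const_poly (dot b w) * app m \<theta>"
    by (simp add: app_def sum_3 const_poly_add const_poly_mult algebra_simps)
  then show ?thesis by (simp flip: covector_expand)
qed

abbreviation R :: "poly3 \<Rightarrow> complex poly" where "R \<equiv> res u w"

lemma R_lf [simp]: "R (lf a) = 0" "R (lf l) = 1" "R (lf m) = [:0, 1:]"
  by (simp_all add: res_lf pCons_one)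

text \<open>The form of degree \<open>k\<close> in \<open>l\<close> and \<open>m\<close> that restricts to a given polynomial on the line.\<close>

definition lift :: "nat \<Rightarrow> complex poly \<Rightarrow> poly3" where
  "lift k g = (\<Sum>j\<le>k. const_poly (coeff g j) * lf l ^ (k - j) * lf m ^ j)"

lemma homogeneous_lift: "homogeneous k (lift k g)"
  unfolding lift_def
proof (rule homogeneous_sum)
  fix j assume "j \<in> {..k}"
  then have "k = 0 + (k - j) + j" by simp
  moreover have "homogeneous (0 + (k - j) + j) (const_poly (coeff g j) * lf l ^ (k - j) * lf m ^ j)"
    by (intro homogeneous_mult homogeneous_const homogeneous_power homogeneous_lf)
  ultimately show "homogeneous k (const_poly (coeff g j) * lf l ^ (k - j) * lf m ^ j)" by simp
qed

lemma R_lift: assumes "degree g \<le> k" shows "R (lift k g) = g"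
proof -
  have "R (lift k g) = (\<Sum>j\<le>k. [:coeff g j:] * [:0, 1:] ^ j)"
    unfolding lift_def by (simp add: res.sub_sum res.sub_mult res.sub_const res.sub_power)
  also have "\<dots> = (\<Sum>j\<le>k. monom (coeff g j) j)"
    by (intro sum.cong refl) (simp add: monom_altdef)
  also have "\<dots> = g" by (rule poly_as_sum_of_monoms'[OF assms])
  finally show ?thesis .
qed

lemma lift_add: "lift k (g + h) = lift k g + lift k h"
  by (simp add: lift_def const_poly_add sum.distrib distrib_right)

lemma lift_smult: "lift k (smult c g) = const_poly c * lift k g"
  by (simp add: lift_def const_poly_mult sum_distrib_left mult.assoc)

lemma lift_Suc: "degree g \<le> k \<Longrightarrow> lift (Suc k) g = lf l * lift k g"
  by (simp add: lift_def sum_distrib_left coeff_eq_0 Suc_diff_le mult.assoc mult.left_commute)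

lemma lift_pCons: "lift (Suc k) (pCons 0 g) = lf m * lift k g"
proof -
  have "lift (Suc k) (pCons 0 g) = (\<Sum>j\<le>k. const_poly (coeff g j) * lf l ^ (k - j) * lf m ^ Suc j)"
    unfolding lift_def by (subst sum.atMost_Suc_shift) simp
  then show ?thesis by (simp add: lift_def sum_distrib_left mult.assoc mult.left_commute)
qed

text \<open>Modulo \<open>a\<close> every form is a form in \<open>l\<close> and \<open>m\<close> alone, and as such it is determined by its restriction
to the line. In particular only the multiples of \<open>a\<close> vanish on the line.\<close>

lemma decompose:
  assumes "homogeneous k p"
  shows "\<exists>q. p = lf a * q + lift k (R p)"
  using assms
proof (induction k arbitrary: p)
  case 0
  then obtain c where "p = const_poly c" using homogeneous_0_const by blast
  then show ?case by (intro exI[of _ 0]) (simp add: lift_def res.sub_const)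
next
  case (Suc k)
  obtain z where z: "\<And>i. homogeneous k (z i)" "p = (\<Sum>i\<in>UNIV. Xv i * z i)"
    using homogeneous_Suc_decomp[OF Suc.prems] by blast
  obtain q where q: "\<And>i. z i = lf a * q i + lift k (R (z i))" using Suc.IH[OF z(1)] by metis
  have one: "\<exists>q. Xv i * z i = lf a * q + lift (Suc k) (R (Xv i * z i))" for i
  proof -
    have d: "degree (R (z i)) \<le> k" using degree_res[OF z(1)] .
    have "R (Xv i) = [:u $ i, w $ i:]" by (simp add: res.sub_X line_coords_def)
    then have "R (Xv i * z i) = smult (u $ i) (R (z i)) + smult (w $ i) (pCons 0 (R (z i)))"
      by (simp add: res.sub_mult)
    then have "lift (Suc k) (R (Xv i * z i)) = (const_poly (u $ i) * lf l + const_poly (w $ i) * lf m) * lift k (R (z i))"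
      using d by (simp add: lift_add lift_smult lift_Suc lift_pCons algebra_simps del: smult_pCons)
    moreover have "Xv i * z i = lf a * (const_poly (v $ i) * z i) + (const_poly (u $ i) * lf l + const_poly (w $ i) * lf m) * z i"
      by (subst Xv_expand) (simp add: algebra_simps)
    moreover have "\<dots> = lf a * (const_poly (v $ i) * z i + (const_poly (u $ i) * lf l + const_poly (w $ i) * lf m) * q i)
       + (const_poly (u $ i) * lf l + const_poly (w $ i) * lf m) * lift k (R (z i))"
      by (subst (2) q) (simp add: algebra_simps)
    ultimately show ?thesis by metis
  qed
  then obtain q' where q': "\<And>i. Xv i * z i = lf a * q' i + lift (Suc k) (R (Xv i * z i))" by metis
  have "p = (\<Sum>i\<in>UNIV. lf a * q' i + lift (Suc k) (R (Xv i * z i)))"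
    unfolding z(2) using q' by simp
  also have "\<dots> = lf a * (\<Sum>i\<in>UNIV. q' i) + lift (Suc k) (R p)"
    unfolding z(2) by (simp add: sum_3 res.sub_add lift_add algebra_simps)
  finally show ?case by blast
qed

lemma dvd_iff_R: assumes "homogeneous k p" shows "lf a dvd p \<longleftrightarrow> R p = 0"
proof
  assume "lf a dvd p" then show "R p = 0" by (auto simp: res.sub_mult)
next
  assume "R p = 0"
  with decompose[OF assms] obtain q where "p = lf a * q" by (auto simp: lift_def)
  then show "lf a dvd p" by simp
qed

end

lemma frame_exists:
  assumes "a \<noteq> 0"
  shows "\<exists>v l m u w. frame a v l m u w"
proof -
  obtain i where i: "a $ i \<noteq> 0" using assms by (auto simp: vec_eq_iff)
  have neq: "(1::3) \<noteq> 2" "(1::3) \<noteq> 3" "(2::3) \<noteq> 3" by simp_all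
  have sets: "(UNIV::3 set) = {2, 1, 3}" "(UNIV::3 set) = {3, 1, 2}" by (metis UNIV_3 insert_commute)+
  have "\<exists>j k. i \<noteq> j \<and> i \<noteq> k \<and> j \<noteq> k \<and> UNIV = {i, j, k}"
    using exhaust_3[of i] neq neq[symmetric] UNIV_3 sets by metis
  then obtain j k where jk: "i \<noteq> j" "i \<noteq> k" "j \<noteq> k" "UNIV = {i, j, k}" by blast
  have dt: "dot b x = b $ i * x $ i + b $ j * x $ j + b $ k * x $ k" for b x
    unfolding dot_def jk(4) using jk(1-3) by (simp add: algebra_simps)
  have all: "(\<forall>n. Q n) \<longleftrightarrow> Q i \<and> Q j \<and> Q k" for Q :: "3 \<Rightarrow> bool"
  proof -
    have "n = i \<or> n = j \<or> n = k" for n using jk(4) UNIV_I[of n] by blast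
    then show ?thesis by metis
  qed
  let ?v = "(\<chi> n. if n = i then 1 / a $ i else 0) :: complex^3"
  let ?u = "(\<chi> n. if n = j then 1 else if n = i then - a $ j / a $ i else 0) :: complex^3"
  let ?w = "(\<chi> n. if n = k then 1 else if n = i then - a $ k / a $ i else 0) :: complex^3"
  let ?l = "(\<chi> n. if n = j then 1 else 0) :: complex^3"
  let ?m = "(\<chi> n. if n = k then 1 else 0) :: complex^3"
  have "frame a ?v ?l ?m ?u ?w"
    by unfold_locales (use i jk(1-3) in \<open>auto simp: dt vec_eq_iff all field_simps\<close>)
  then show ?thesis by blast
qed

section \<open>Univariate interpolation\<close>

lemma prod_linear_dvd:
  fixes g :: "complex poly"
  assumes "finite S" "\<And>s. s \<in> S \<Longrightarrow> poly g s = 0"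
  shows "(\<Prod>s\<in>S. [:- s, 1:]) dvd g"
  using assms
proof (induction S arbitrary: g rule: finite_induct)
  case (insert x F)
  obtain h where h: "g = [:- x, 1:] * h" using insert.prems[of x] by (auto simp: poly_eq_0_iff_dvd)
  have "poly h s = 0" if "s \<in> F" for s
    using insert.prems[of s] that insert.hyps h by auto
  then have "(\<Prod>s\<in>F. [:- s, 1:]) dvd h" using insert.IH by blast
  then have "[:- x, 1:] * (\<Prod>s\<in>F. [:- s, 1:]) dvd [:- x, 1:] * h" by (rule mult_dvd_mono[OF dvd_refl])
  then show ?case using insert.hyps h by simp
qed simp

lemma degree_prod_linear: "finite S \<Longrightarrow> degree (\<Prod>s\<in>S. [:- f s, 1::complex:]) = card S"
  by (subst degree_prod_eq_sum_degree) simp_all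

lemma prod_linear_neq_0: "(\<Prod>s\<in>S. [:- f s, 1::complex:]) \<noteq> 0"
  by (cases "finite S") simp_all

lemma lead_coeff_prod_linear: "lead_coeff (\<Prod>s\<in>S. [:- f s, 1::complex:]) = 1"
  by (cases "finite S") (simp_all add: lead_coeff_prod)

text \<open>Interpolation with degree bounds: the products of all but one of the linear factors generate all polynomials
from the degree \<open>card S - 1\<close> on. Adding a point \<open>x\<close>, a constant multiple of the product over the old points corrects
the value at \<open>x\<close>, and the remainder is divisible by \<open>t - x\<close>.\<close>

lemma lagrange_span:
  fixes g :: "complex poly"
  assumes "finite S" "S \<noteq> {}" "degree g + 1 \<le> card S + e"
  shows "\<exists>q. (\<forall>s\<in>S. degree (q s) \<le> e) \<and> g = (\<Sum>s\<in>S. q s * (\<Prod>s'\<in>S - {s}. [:- s', 1:]))"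
  using assms
proof (induction S arbitrary: g rule: finite_ne_induct)
  case (singleton x)
  then show ?case by (intro exI[of _ "\<lambda>_. g"]) simp
next
  case (insert x F)
  define Q where "Q = (\<Prod>s\<in>F. [:- s, 1::complex:])"
  have Qx: "poly Q x \<noteq> 0" using insert.hyps by (auto simp: Q_def poly_prod)
  \<comment> \<open>the constant that makes \<open>g - c Q\<close> vanish at the new point\<close>
  define c where "c = poly g x / poly Q x"
  have "poly (g - smult c Q) x = 0" using Qx by (simp add: c_def)
  then obtain h where h: "g - smult c Q = [:- x, 1:] * h" unfolding poly_eq_0_iff_dvd by blast
  have dQ: "degree Q = card F" unfolding Q_def using degree_prod_linear[OF insert.hyps(1), of "\<lambda>s. s"] .
  have "degree h + 1 \<le> card F + e"
  proof (cases "h = 0")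
    case True
    have "card F > 0" using insert.hyps by (simp add: card_gt_0_iff)
    with True show ?thesis by simp
  next
    case False
    then have "degree h + 1 = degree (g - smult c Q)" unfolding h by (subst degree_mult_eq) auto
    also have "\<dots> \<le> card F + e"
      using insert.prems insert.hyps dQ by (intro degree_diff_le) auto
    finally show ?thesis .
  qed
  then obtain q where q: "\<And>s. s \<in> F \<Longrightarrow> degree (q s) \<le> e" "h = (\<Sum>s\<in>F. q s * (\<Prod>s'\<in>F - {s}. [:- s', 1:]))"
    using insert.IH by blast
  have "[:- x, 1:] * h = (\<Sum>s\<in>F. q s * (\<Prod>s'\<in>insert x F - {s}. [:- s', 1:]))"
    unfolding q(2) sum_distrib_left
  proof (rule sum.cong[OF refl])
    fix s assume "s \<in> F"
    then have "insert x F - {s} = insert x (F - {s})" using insert.hyps by auto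
    then show "[:- x, 1:] * (q s * (\<Prod>s'\<in>F - {s}. [:- s', 1:])) = q s * (\<Prod>s'\<in>insert x F - {s}. [:- s', 1:])"
      using insert.hyps by (simp add: mult.left_commute del: mult_pCons_left)
  qed
  moreover have "g = smult c Q + [:- x, 1:] * h" using h by (simp add: algebra_simps)
  moreover have "insert x F - {x} = F" using insert.hyps by auto
  ultimately have "g = (\<Sum>s\<in>insert x F. (if s = x then [:c:] else q s) * (\<Prod>s'\<in>insert x F - {s}. [:- s', 1:]))"
    using insert.hyps by (simp add: Q_def) (intro sum.cong, auto)
  moreover have "\<forall>s\<in>insert x F. degree (if s = x then [:c:] else q s) \<le> e" using q(1) by auto
  ultimately show ?case by (intro exI[of _ "\<lambda>s. if s = x then [:c:] else q s"]) blast
qed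

text \<open>The leading coefficient in Lagrange's formula. Read as a sum of residues of \<open>H / \<Prod>(t - s)\<close>, this is the residue
theorem that underlies the index formula of Camacho and Sad.\<close>

lemma lagrange_lead_coeff:
  fixes H :: "complex poly"
  assumes "finite S" "card S = Suc k" "degree H \<le> k"
  shows "coeff H k = (\<Sum>s\<in>S. poly H s / poly (\<Prod>s'\<in>S - {s}. [:- s', 1:]) s)"
proof -
  define N where "N s = (\<Prod>s'\<in>S - {s}. [:- s', 1::complex:])" for s
  define L where "L = (\<Sum>s\<in>S. smult (poly H s / poly (N s) s) (N s))"
  have cS: "card (S - {s}) = k" if "s \<in> S" for s using assms that by simp
  have dN: "degree (N s) = k" if "s \<in> S" for s
    unfolding N_def using degree_prod_linear[of "S - {s}" "\<lambda>s. s"] assms cS[OF that] by simp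
  have Ns: "poly (N s) s \<noteq> 0" if "s \<in> S" for s using assms by (auto simp: N_def poly_prod)
  have Nt: "poly (N s) t = 0" if "s \<in> S" "t \<in> S" "s \<noteq> t" for s t
    using that assms by (auto simp: N_def poly_prod)
  have PL: "poly L t = poly H t" if "t \<in> S" for t
  proof -
    have "poly L t = (\<Sum>s\<in>S. if s = t then poly H t else 0)"
      unfolding L_def poly_sum by (rule sum.cong) (use Ns Nt that in auto)
    then show ?thesis using that assms by simp
  qed
  have "degree (H - L) \<le> k"
    using assms(3) dN unfolding L_def by (intro degree_diff_le degree_sum_le) (use assms in auto)
  moreover have "(\<Prod>s\<in>S. [:- s, 1:]) dvd H - L" using assms PL by (intro prod_linear_dvd) auto
  moreover have "degree (\<Prod>s\<in>S. [:- s, 1::complex:]) = Suc k"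
    using degree_prod_linear[OF assms(1), of "\<lambda>s. s"] assms by simp
  ultimately have "H - L = 0"
    using dvd_imp_degree_le[of "\<Prod>s\<in>S. [:- s, 1:]" "H - L"] by force
  then have "coeff H k = coeff L k" by simp
  also have "\<dots> = (\<Sum>s\<in>S. poly H s / poly (N s) s * coeff (N s) k)"
    by (simp add: L_def coeff_sum)
  also have "\<dots> = (\<Sum>s\<in>S. poly H s / poly (N s) s)"
  proof (rule sum.cong[OF refl])
    fix s assume "s \<in> S"
    then have "coeff (N s) k = 1"
      using lead_coeff_prod_linear[of "\<lambda>s. s" "S - {s}"] dN unfolding N_def by simp
    then show "poly H s / poly (N s) s * coeff (N s) k = poly H s / poly (N s) s" by simp
  qed
  finally show ?thesis unfolding N_def .
qed

section \<open>Arrangements with at most triple points\<close>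

text \<open>An arrangement of lines without points of multiplicity above three, given by one coefficient vector for each line.\<close>

definition arr :: "(complex^3) set \<Rightarrow> bool" where
  "arr A \<longleftrightarrow> finite A \<and> 0 \<notin> A \<and> (\<forall>a\<in>A. \<forall>b\<in>A. a \<noteq> b \<longrightarrow> (\<forall>c. a \<noteq> c *s b)) \<and>
     (\<forall>x. x \<noteq> 0 \<longrightarrow> card {a \<in> A. dot a x = 0} \<le> 3)"

text \<open>Since no four lines are concurrent, triple points correspond to concurrent triples of lines.\<close>

definition triples :: "(complex^3) set \<Rightarrow> (complex^3) set set" where
  "triples A = {X. X \<subseteq> A \<and> card X = 3 \<and> (\<exists>x. x \<noteq> 0 \<and> (\<forall>a\<in>X. dot a x = 0))}"

lemma arr_subset: assumes "arr A" "B \<subseteq> A" shows "arr B"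
proof -
  have fA: "finite A" using assms by (simp add: arr_def)
  have "card {a \<in> B. dot a x = 0} \<le> 3" if "x \<noteq> 0" for x
  proof -
    have "card {a \<in> B. dot a x = 0} \<le> card {a \<in> A. dot a x = 0}"
      by (rule card_mono) (use fA assms in auto)
    then show ?thesis using assms that unfolding arr_def by (meson order_trans)
  qed
  moreover have "finite B" using fA assms finite_subset by blast
  ultimately show ?thesis using assms unfolding arr_def by blast
qed

lemma finite_triples: "finite A \<Longrightarrow> finite (triples A)"
  unfolding triples_def by (rule finite_subset[of _ "Pow A"]) auto

text \<open>A line \<open>a\<close> added to an arrangement \<open>A\<close>. The point \<open>w\<close>, which is the point at infinity of the parameter, is chosen off all the
lines of \<open>A\<close>, so that every line of \<open>A\<close> meets \<open>a\<close> at a finite parameter \<open>par\<close>.\<close>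

locale arr_frame = frame +
  fixes A :: "(complex^3) set"
  assumes arr: "arr (insert a A)" and a_notin: "a \<notin> A"
    and generic: "b \<in> A \<Longrightarrow> dot b w \<noteq> 0"
begin

lemma finA: "finite A" using arr by (simp add: arr_def)

definition par :: "complex^3 \<Rightarrow> complex" where "par b = - dot b u / dot b w"

definition fiber :: "complex \<Rightarrow> (complex^3) set" where "fiber s = {b \<in> A. par b = s}"

definition points :: "complex set" where "points = par ` A"

text \<open>The parameters of the double points of \<open>A\<close> on the line \<open>a\<close>. They become triple points once \<open>a\<close> is added.\<close>

definition doubles :: "complex set" where "doubles = {s \<in> points. card (fiber s) = 2}"

abbreviation pt :: "complex \<Rightarrow> complex^3" where "pt s \<equiv> u + s *s w"

lemma pt_neq_0: "pt s \<noteq> 0"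
proof
  assume "pt s = 0"
  then have "dot l (pt s) = 0" by simp
  then show False by (simp add: dot_add dot_scale)
qed

lemma dot_u: "b \<in> A \<Longrightarrow> dot b u = - par b * dot b w"
  using generic[of b] by (simp add: par_def)

lemma dot_pt: "b \<in> A \<Longrightarrow> dot b (pt s) = dot b w * (s - par b)"
  by (simp add: dot_add dot_scale dot_u algebra_simps)

lemma dot_pt_0: "b \<in> A \<Longrightarrow> dot b (pt s) = 0 \<longleftrightarrow> par b = s"
  using generic by (auto simp: dot_pt)

lemma dot_a_pt [simp]: "dot a (pt s) = 0" by (simp add: dot_add dot_scale)

lemma R_lf_A: "b \<in> A \<Longrightarrow> R (lf b) = smult (dot b w) [:- par b, 1:]"
  by (simp add: res_lf dot_u)

lemma on_line_point:
  assumes "dot a x = 0" "dot b x = 0" "b \<in> A"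
  shows "x = dot l x *s pt (par b)"
proof -
  have x: "x = dot l x *s u + dot m x *s w" using expand[of x] assms(1) by simp
  then have "dot b (dot l x *s u + dot m x *s w) = 0" using assms(2) by simp
  then have "dot b w * (dot m x - par b * dot l x) = 0"
    by (simp add: dot_add dot_scale dot_u[OF assms(3)] algebra_simps)
  then have "dot m x = par b * dot l x" using generic[OF assms(3)] by simp
  then have "dot l x *s pt (par b) = dot l x *s u + dot m x *s w"
    by (simp add: vec_eq_iff algebra_simps)
  then show ?thesis using x by simp
qed

lemma finite_points: "finite points" using finA by (simp add: points_def)
lemma finite_doubles: "finite doubles" using finite_points by (simp add: doubles_def)
lemma finite_fiber: "finite (fiber s)" using finA by (simp add: fiber_def)

lemma fiber_le: "card (fiber s) \<le> 2"
proof -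
  have "insert a (fiber s) \<subseteq> {b \<in> insert a A. dot b (pt s) = 0}" using dot_pt_0 by (auto simp: fiber_def)
  then have "card (insert a (fiber s)) \<le> card {b \<in> insert a A. dot b (pt s) = 0}"
    using finA by (intro card_mono) auto
  also have "\<dots> \<le> 3" using arr pt_neq_0 by (simp add: arr_def)
  finally show ?thesis using finite_fiber a_notin by (simp add: fiber_def)
qed

lemma fiber_pos: "s \<in> points \<Longrightarrow> card (fiber s) > 0"
  using finite_fiber by (auto simp: points_def fiber_def card_gt_0_iff)

lemma card_fiber: "s \<in> points \<Longrightarrow> card (fiber s) = (if s \<in> doubles then 2 else 1)"
  using fiber_pos[of s] fiber_le[of s] by (auto simp: doubles_def)

lemma card_A: "card A = card points + card doubles"
proof -
  have "card A = (\<Sum>s\<in>points. card (fiber s))"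
    unfolding points_def fiber_def
    using sum.image_gen[OF finA, of "\<lambda>_. 1::nat" par] by simp
  also have "\<dots> = (\<Sum>s\<in>points. 1 + (if s \<in> doubles then 1 else 0))"
    by (rule sum.cong) (auto simp: card_fiber)
  also have "\<dots> = card points + card (points \<inter> doubles)"
    unfolding sum.distrib using finite_points by (simp add: sum.If_cases)
  also have "points \<inter> doubles = doubles" by (auto simp: doubles_def)
  finally show ?thesis .
qed

text \<open>A triple that contains \<open>a\<close> consists of \<open>a\<close> and the lines of \<open>A\<close> through a double point on \<open>a\<close>.\<close>

lemma card_doubles: "card {X \<in> triples (insert a A). a \<in> X} = card doubles"
proof -
  have inj: "inj_on (\<lambda>s. insert a (fiber s)) doubles"
  proof (rule inj_onI)
    fix s t assume "s \<in> doubles" "t \<in> doubles" "insert a (fiber s) = insert a (fiber t)"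
    then have "fiber s = fiber t" using a_notin by (auto simp: fiber_def)
    moreover have "fiber s \<noteq> {}" using \<open>s \<in> doubles\<close> by (auto simp: doubles_def)
    ultimately show "s = t" by (auto simp: fiber_def)
  qed
  have "(\<lambda>s. insert a (fiber s)) ` doubles = {X \<in> triples (insert a A). a \<in> X}"
  proof (intro equalityI subsetI)
    fix X assume "X \<in> (\<lambda>s. insert a (fiber s)) ` doubles"
    then obtain s where s: "s \<in> doubles" "X = insert a (fiber s)" by blast
    have "card X = 3" using s finite_fiber a_notin by (simp add: doubles_def fiber_def)
    moreover have "\<forall>b\<in>X. dot b (pt s) = 0" using s dot_pt_0 by (auto simp: fiber_def)
    ultimately show "X \<in> {X \<in> triples (insert a A). a \<in> X}"
      unfolding triples_def using s pt_neq_0[of s] by (auto simp: fiber_def)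
  next
    fix X assume X: "X \<in> {X \<in> triples (insert a A). a \<in> X}"
    then obtain x where x: "x \<noteq> 0" "\<forall>b\<in>X. dot b x = 0" "card X = 3" "X \<subseteq> insert a A" "a \<in> X"
      unfolding triples_def by blast
    have cX: "card (X - {a}) = 2" using x by simp
    then obtain b where b: "b \<in> X - {a}" by (metis card.empty ex_in_conv zero_neq_numeral)
    then have bA: "b \<in> A" using x by blast
    have "c \<in> fiber (par b)" if "c \<in> X - {a}" for c
    proof -
      have cA: "c \<in> A" using that x by blast
      have 1: "x = dot l x *s pt (par b)" using on_line_point[of x b] x b bA by auto
      have 2: "x = dot l x *s pt (par c)" using on_line_point[of x c] x that cA by auto
      have "dot l x \<noteq> 0" using 1 x(1) by (metis vector_smult_lzero)
      have "dot m x = dot l x * par b" by (subst 1) (simp add: dot_add dot_scale)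
      moreover have "dot m x = dot l x * par c" by (subst 2) (simp add: dot_add dot_scale)
      ultimately show ?thesis using \<open>dot l x \<noteq> 0\<close> cA by (simp add: fiber_def)
    qed
    then have sub: "X - {a} \<subseteq> fiber (par b)" by blast
    then have "X - {a} = fiber (par b)"
      using card_subset_eq[OF finite_fiber sub] card_mono[OF finite_fiber sub] fiber_le[of "par b"] cX by simp
    moreover from this have "par b \<in> doubles" using cX bA by (auto simp: doubles_def points_def)
    ultimately show "X \<in> (\<lambda>s. insert a (fiber s)) ` doubles" using x(5) by (intro image_eqI[of _ _ "par b"]) auto
  qed
  then show ?thesis using card_image[OF inj] by simp
qed

lemma card_triples_insert: "card (triples (insert a A)) = card (triples A) + card doubles"
proof -
  have "triples (insert a A) = triples A \<union> {X \<in> triples (insert a A). a \<in> X}"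
    unfolding triples_def by auto
  moreover have "triples A \<inter> {X \<in> triples (insert a A). a \<in> X} = {}"
    using a_notin unfolding triples_def by auto
  ultimately show ?thesis
    using finite_triples[of "insert a A"] finite_triples[of A] finA card_doubles
    by (metis (no_types, lifting) card_Un_disjoint finite_Un finite_insert)
qed

end

text \<open>Replacing \<open>w\<close> by \<open>w + c u\<close> only changes the parameter on the line. Every line of \<open>A\<close> rules out at most one
value of \<open>c\<close>.\<close>

lemma arr_frame_exists:
  assumes "arr (insert a A)" "a \<notin> A"
  shows "\<exists>v l m u w. arr_frame a v l m u w A"
proof -
  have "a \<noteq> 0" using assms by (auto simp: arr_def)
  then obtain v l m u w where "frame a v l m u w" using frame_exists by blast
  then interpret f: frame a v l m u w .
  have fA: "finite A" using assms by (simp add: arr_def)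
  \<comment> \<open>the values of \<open>c\<close> for which \<open>w + c u\<close> lies on a line of \<open>A\<close>\<close>
  define bad where "bad = (\<lambda>b. - dot b w / dot b u) ` A"
  have "finite bad" using fA by (simp add: bad_def)
  from ex_new_if_finite[OF infinite_UNIV_char_0 this] have "\<exists>c. c \<notin> bad" .
  then obtain c where c: "c \<notin> bad" by blast
  have gen: "dot b (w + c *s u) \<noteq> 0" if "b \<in> A" for b
  proof
    assume z: "dot b (w + c *s u) = 0"
    show False
    proof (cases "dot b u = 0")
      case True
      with z have "dot b w = 0" by (simp add: dot_add dot_scale)
      with True have "b = dot b v *s a" using f.covector_expand[of b] by simp
      then show False using assms that unfolding arr_def by (metis insertCI)
    next
      case False
      with z have "c = - dot b w / dot b u" by (simp add: dot_add dot_scale field_simps add_eq_0_iff2)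
      then show False using c that by (auto simp: bad_def)
    qed
  qed
  have "arr_frame a v (l - c *s m) m u (w + c *s u) A"
  proof unfold_locales
    fix x
    have "(dot a x *s v + dot (l - c *s m) x *s u + dot m x *s (w + c *s u)) $ i
       = (dot a x *s v + dot l x *s u + dot m x *s w) $ i" for i
    proof -
      have d: "dot (l - c *s m) x = dot l x - c * dot m x" by (simp add: dot_def sum_3 algebra_simps)
      show ?thesis unfolding d by (simp add: algebra_simps)
    qed
    then show "x = dot a x *s v + dot (l - c *s m) x *s u + dot m x *s (w + c *s u)"
      using f.expand[of x] by (simp add: vec_eq_iff)
  next
    have dl: "dot (l - c *s m) x = dot l x - c * dot m x" for x by (simp add: dot_def sum_3 algebra_simps)
    show "dot (l - c *s m) v = 0" "dot (l - c *s m) u = 1" "dot (l - c *s m) (w + c *s u) = 0"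
      by (simp_all add: dl dot_add dot_scale)
  qed (use assms gen in \<open>auto simp: dot_add dot_scale\<close>)
  then show ?thesis by blast
qed

section \<open>Logarithmic derivations and their restriction to a line\<close>

text \<open>The value at a point of a derivation, seen as a vector field.\<close>

definition evv :: "complex^3 \<Rightarrow> poly3^3 \<Rightarrow> complex^3" where
  "evv x \<theta> = (\<chi> i. ev x (\<theta> $ i))"

lemma dot_evv: "dot a (evv x \<theta>) = ev x (app a \<theta>)"
  by (simp add: dot_def evv_def app_def ev.sub_sum ev.sub_mult ev.sub_const)

lemma poly_res_ev: "poly (res u w p) s = ev (u + s *s w) p"
  by (simp add: poly_res eval_poly_ev)

lemma lf_prime:
  assumes "b \<noteq> 0" "homogeneous j p" "homogeneous k q" "lf b dvd p * q"
  shows "lf b dvd p \<or> lf b dvd q"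
proof -
  obtain v l m u w where "frame b v l m u w" using frame_exists[OF assms(1)] by blast
  then interpret frame b v l m u w .
  show ?thesis
    using assms dvd_iff_R[OF assms(2)] dvd_iff_R[OF assms(3)] dvd_iff_R[OF homogeneous_mult[OF assms(2,3)]]
    by (simp add: res.sub_mult)
qed

lemma lf_dvd_lf:
  assumes "b \<noteq> 0" "lf b dvd lf a" shows "\<exists>c. a = c *s b"
proof -
  obtain q where q: "lf a = lf b * q" using assms(2) by blast
  have "homogeneous 0 q"
    using homogeneous_factor[of "Suc 0" "lf b" 0 q] assms(1) q[symmetric] by (simp add: lf_eq_0_iff)
  then obtain c where "q = const_poly c" using homogeneous_0_const by blast
  then have "lf a = lf (c *s b)" using q by (simp add: lf_scale mult.commute)
  then show ?thesis using lf_eq_iff by blast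
qed

text \<open>The logarithmic derivations of degree \<open>k\<close>: the vector fields that are tangent to all the lines.\<close>

definition D :: "nat \<Rightarrow> (complex^3) set \<Rightarrow> (poly3^3) set" where
  "D k A = {\<theta>. homogeneous_triple k \<theta> \<and> (\<forall>a\<in>A. lf a dvd app a \<theta>)}"

lemma D_mono: "A \<subseteq> B \<Longrightarrow> D k B \<subseteq> D k A"
  by (auto simp: D_def)

lemma D_add: "x \<in> D k A \<Longrightarrow> y \<in> D k A \<Longrightarrow> x + y \<in> D k A"
  and D_diff: "x \<in> D k A \<Longrightarrow> y \<in> D k A \<Longrightarrow> x - y \<in> D k A"
  and D_0: "0 \<in> D k A"
  by (auto simp: D_def homogeneous_triple_add homogeneous_triple_diff app_add app_diff)

lemma D_smult: "homogeneous j q \<Longrightarrow> x \<in> D k A \<Longrightarrow> q *s x \<in> D (j + k) A"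
  by (auto simp: D_def homogeneous_triple_smult app_smult)

lemma D_cmult: "x \<in> D k A \<Longrightarrow> const_poly c *s x \<in> D k A"
  using D_smult[of 0 "const_poly c" x k A] by simp

lemma D_sum: "(\<And>x. x \<in> S \<Longrightarrow> f x \<in> D k A) \<Longrightarrow> sum f S \<in> D k A"
  by (induction S rule: infinite_finite_induct) (auto intro: D_add D_0)

lemma D_Euler: "homogeneous k q \<Longrightarrow> q *s Euler \<in> D (Suc k) A"
  using homogeneous_triple_smult[of k q "Suc 0" Euler] by (auto simp: D_def app_smult app_Euler)

lemma quotient_exists:
  assumes "arr A" "\<theta> \<in> D (Suc k) A" "a \<in> A"
  shows "\<exists>h. app a \<theta> = lf a * h \<and> homogeneous k h"
proof -
  obtain h where h: "app a \<theta> = lf a * h" using assms(2,3) by (auto simp: D_def)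
  have "homogeneous (Suc k) (app a \<theta>)" using assms(2) by (intro homogeneous_app) (simp add: D_def)
  moreover have "lf a \<noteq> 0" using assms(1,3) by (auto simp: lf_eq_0_iff arr_def)
  ultimately have "homogeneous k h" using homogeneous_factor[of "Suc 0" "lf a" k h] h by simp
  with h show ?thesis by blast
qed

context arr_frame
begin

lemma D_insert: "D k (insert a A) = {\<theta> \<in> D k A. R (app a \<theta>) = 0}"
  using dvd_iff_R homogeneous_app unfolding D_def by blast

lemma R_app_degree: "\<theta> \<in> D k A' \<Longrightarrow> degree (R (app b \<theta>)) \<le> k"
  unfolding D_def by (intro degree_res homogeneous_app) auto

lemma R_app_lf:
  assumes "\<theta> \<in> D k A" "b \<in> A" shows "poly (R (app b \<theta>)) (par b) = 0"
proof -
  obtain h where "app b \<theta> = lf b * h" using assms by (auto simp: D_def)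
  then show ?thesis by (simp add: res.sub_mult R_lf_A[OF assms(2)])
qed

text \<open>At a double point of \<open>A\<close> a logarithmic vector field is tangent to two distinct lines, hence proportional to the point
itself. So it is tangent there to every further line through that point.\<close>

lemma R_app_doubles:
  assumes "\<theta> \<in> D k A" "s \<in> doubles"
  shows "poly (R (app a \<theta>)) s = 0"
proof (rule ccontr)
  define y where "y = evv (pt s) \<theta>"
  assume "poly (R (app a \<theta>)) s \<noteq> 0"
  then have ay: "dot a y \<noteq> 0" by (simp add: y_def dot_evv poly_res_ev)
  have "card (fiber s) = 2" using assms(2) by (simp add: doubles_def)
  then obtain b c where bc: "fiber s = {b, c}" "b \<noteq> c" by (auto simp: card_2_iff)
  have *: "d \<in> A" "dot d v * dot a y = - dot d w * (dot m y - s * dot l y)" if "d \<in> {b, c}" for d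
  proof -
    have d: "d \<in> A" "par d = s" using that bc by (auto simp: fiber_def)
    show "d \<in> A" by fact
    have "dot d y = 0"
      using R_app_lf[OF assms(1) d(1)] d(2) by (simp add: y_def dot_evv poly_res_ev)
    moreover have "dot d y = dot d (dot a y *s v + dot l y *s u + dot m y *s w)"
      using expand[of y] by simp
    ultimately have "dot a y * dot d v + dot d w * (dot m y - s * dot l y) = 0"
      using d(2) by (simp add: dot_add dot_scale dot_u[OF d(1)] algebra_simps)
    then show "dot d v * dot a y = - dot d w * (dot m y - s * dot l y)"
      by (simp add: algebra_simps add_eq_0_iff2)
  qed
  define K where "K = (dot m y - s * dot l y) / dot a y"
  have v: "dot d v = - dot d w * K" if "d \<in> {b, c}" for d
    using *(2)[OF that] ay by (simp add: K_def field_simps)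
  have form: "d = dot d w *s ((- K) *s a + (- s) *s l + m)" if "d \<in> {b, c}" for d
  proof -
    have "par d = s" using that bc by (auto simp: fiber_def)
    then have "dot d u = - s * dot d w" using dot_u[OF *(1)[OF that]] by simp
    then have "d = (- dot d w * K) *s a + (- s * dot d w) *s l + dot d w *s m"
      using covector_expand[of d] v[OF that] by simp
    then show ?thesis by (simp add: vec_eq_iff algebra_simps)
  qed
  have "dot c w \<noteq> 0" using generic *(1) by blast
  then have "b = (dot b w / dot c w) *s c"
    by (subst form[of b], simp, subst (2) form[of c], simp) (simp add: vec_eq_iff)
  moreover have "b \<in> insert a A" "c \<in> insert a A" using *(1) by auto
  ultimately show False using arr bc(2) unfolding arr_def by blast
qed

lemma meeting_point:
  assumes "b \<in> A" "c \<in> A" "par b \<noteq> par c"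
  shows "\<exists>x. dot a x = 1 \<and> dot b x = 0 \<and> dot c x = 0"
proof -
  define \<beta> where "\<beta> = - dot b v / dot b w"
  define \<gamma> where "\<gamma> = - dot c v / dot c w"
  define y where "y = (\<beta> - \<gamma>) / (par c - par b)"
  define z where "z = \<beta> + par b * y"
  have z': "z = \<gamma> + par c * y"
    using assms(3) by (simp add: z_def y_def field_simps)
  have "dot d (v + y *s u + z *s w) = dot d v + dot d w * (z - par d * y)" if "d \<in> A" for d
    using dot_u[OF that] by (simp add: dot_add dot_scale algebra_simps)
  moreover have "dot b v + dot b w * (z - par b * y) = 0"
    using generic[OF assms(1)] by (simp add: z_def \<beta>_def)
  moreover have "dot c v + dot c w * (z - par c * y) = 0"
    using generic[OF assms(2)] by (simp add: z' \<gamma>_def)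
  moreover have "dot a (v + y *s u + z *s w) = 1" by (simp add: dot_add dot_scale)
  ultimately show ?thesis using assms(1,2) by metis
qed

lemma prod_lines: "(\<Prod>b\<in>A. [:- par b, 1:]) = (\<Prod>s\<in>points. [:- s, 1:]) * (\<Prod>s\<in>doubles. [:- s, 1:])"
proof -
  have "(\<Prod>b\<in>A. [:- par b, 1:]) = (\<Prod>s\<in>points. \<Prod>b\<in>fiber s. [:- par b, 1:])"
    unfolding points_def fiber_def using prod.image_gen[OF finA] .
  also have "\<dots> = (\<Prod>s\<in>points. [:- s, 1:] * (if s \<in> doubles then [:- s, 1:] else 1))"
  proof (rule prod.cong[OF refl])
    fix s assume s: "s \<in> points"
    have "(\<Prod>b\<in>fiber s. [:- par b, 1:]) = (\<Prod>b\<in>fiber s. [:- s, 1:])"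
      by (rule prod.cong) (auto simp: fiber_def)
    also have "\<dots> = [:- s, 1:] ^ card (fiber s)" by simp
    finally show "(\<Prod>b\<in>fiber s. [:- par b, 1:]) = [:- s, 1:] * (if s \<in> doubles then [:- s, 1:] else 1)"
      using card_fiber[OF s] by (simp add: power2_eq_square)
  qed
  also have "\<dots> = (\<Prod>s\<in>points. [:- s, 1:]) * (\<Prod>s\<in>points. if s \<in> doubles then [:- s, 1:] else 1)"
    by (rule prod.distrib)
  also have "(\<Prod>s\<in>points. if s \<in> doubles then [:- s, 1::complex:] else 1) = (\<Prod>s\<in>points \<inter> doubles. [:- s, 1:])"
    using prod.inter_restrict[OF finite_points, of "\<lambda>s. [:- s, 1::complex:]" doubles] by simp
  also have "points \<inter> doubles = doubles" by (auto simp: doubles_def)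
  finally show ?thesis .
qed

text \<open>The vanishing at double points is the only obstruction in high degree. For two lines \<open>b, c\<close> of \<open>A\<close> that
meet in a point \<open>x\<close> off the line \<open>a\<close>, the product of the other linear forms times the constant field \<open>x\<close> is
logarithmic: it is tangent to \<open>b\<close> and \<open>c\<close> because \<open>x\<close> lies on both. It restricts to the product of
all but two of the linear factors on the line. With \<open>b\<close> fixed and one \<open>c\<close> for each further point,
Lagrange interpolation shows that these restrictions generate.\<close>

lemma surj_restriction:
  assumes pts: "card points \<ge> 2" and k: "card A \<le> k + 2"
    and g: "degree g \<le> k" "\<And>s. s \<in> doubles \<Longrightarrow> poly g s = 0"
  shows "\<exists>\<eta>\<in>D k A. R (app a \<eta>) = g"
proof -
  obtain b where b: "b \<in> A" using pts by (fastforce simp: points_def)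
  define S where "S = points - {par b}"
  have bp: "par b \<in> points" using b by (auto simp: points_def)
  have fS: "finite S" "card S = card points - 1" using finite_points bp by (auto simp: S_def)
  have "card S \<noteq> 0" using fS pts by simp
  then have "S \<noteq> {}" by auto
  define T where "T = (\<Prod>s\<in>doubles. [:- s, 1::complex:])"
  have T0: "T \<noteq> 0" unfolding T_def by (rule prod_linear_neq_0)
  have dT: "degree T = card doubles" unfolding T_def by (rule degree_prod_linear[OF finite_doubles])
  have "T dvd g" unfolding T_def using prod_linear_dvd[OF finite_doubles] g(2) by blast
  then obtain g' where g': "g = T * g'" by blast
  \<comment> \<open>the degree left for the coefficients, since the special derivations have degree \<open>card A - 2\<close>\<close>
  define e where "e = k + 2 - card A"
  have "degree g' + 1 \<le> card S + e"
  proof (cases "g' = 0")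
    case True
    then show ?thesis using fS pts by simp
  next
    case False
    then have "degree g = card doubles + degree g'" using T0 dT g' by (simp add: degree_mult_eq)
    then show ?thesis using g(1) fS pts k card_A by (simp add: e_def)
  qed
  then obtain q where q: "\<And>s. s \<in> S \<Longrightarrow> degree (q s) \<le> e"
    "g' = (\<Sum>s\<in>S. q s * (\<Prod>s'\<in>S - {s}. [:- s', 1:]))"
    using lagrange_span[OF fS(1) \<open>S \<noteq> {}\<close>] by blast
  have one: "\<exists>\<eta>\<in>D k A. R (app a \<eta>) = T * (q s * (\<Prod>s'\<in>S - {s}. [:- s', 1:]))" if s: "s \<in> S" for s
  proof -
    obtain c where c: "c \<in> A" "par c = s" using s by (auto simp: S_def points_def)
    have bc: "par b \<noteq> par c" "b \<noteq> c" using s c by (auto simp: S_def)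
    obtain x where x: "dot a x = 1" "dot b x = 0" "dot c x = 0" using meeting_point[OF b c(1) bc(1)] by blast
    define F where "F = A - {b, c}"
    have fF: "finite F" using finA by (simp add: F_def)
    have cF: "card F = card A - 2" unfolding F_def using b c(1) bc(2) finA by (simp add: card_Diff_subset)
    have cA: "card A \<ge> 2" using card_A pts by simp
    define \<kappa> where "\<kappa> = (\<Prod>d\<in>F. dot d w)"
    have k0: "\<kappa> \<noteq> 0" using generic fF by (auto simp: \<kappa>_def F_def)
    define \<eta>0 where "\<eta>0 = (\<Prod>d\<in>F. lf d) *s cvec x"
    have h0: "homogeneous_triple (card F) \<eta>0"
      unfolding \<eta>0_def using homogeneous_triple_smult[OF homogeneous_prod[OF fF] homogeneous_triple_cvec, of lf x]
      by simp
    have "lf d dvd app d \<eta>0" if "d \<in> A" for d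
    proof (cases "d \<in> F")
      case True
      then show ?thesis unfolding \<eta>0_def app_smult using fF by (intro dvd_mult2 dvd_prodI) auto
    next
      case False
      then have "d = b \<or> d = c" using that by (auto simp: F_def)
      then show ?thesis using x by (auto simp: \<eta>0_def app_smult app_cvec)
    qed
    then have D0: "\<eta>0 \<in> D (card F) A" using h0 by (simp add: D_def)
    have R0: "R (app a \<eta>0) = smult \<kappa> (\<Prod>d\<in>F. [:- par d, 1:])"
    proof -
      have "R (app a \<eta>0) = (\<Prod>d\<in>F. R (lf d))"
        by (simp add: \<eta>0_def app_smult app_cvec x res.sub_mult res.sub_prod)
      also have "\<dots> = (\<Prod>d\<in>F. smult (dot d w) [:- par d, 1:])"
        by (rule prod.cong) (auto simp: F_def R_lf_A)
      finally show ?thesis unfolding \<kappa>_def prod_smult .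
    qed
    have TP: "(\<Prod>d\<in>F. [:- par d, 1:]) = T * (\<Prod>s'\<in>S - {s}. [:- s', 1:])"
    proof -
      have AF: "A = insert b (insert c F)" "b \<notin> insert c F" "c \<notin> F" using b c(1) bc(2) by (auto simp: F_def)
      then have 1: "(\<Prod>d\<in>A. [:- par d, 1:]) = [:- par b, 1:] * ([:- par c, 1:] * (\<Prod>d\<in>F. [:- par d, 1:]))"
        by (subst AF(1)) (simp only: prod.insert finite_insert fF AF(2,3) not_False_eq_True)
      have PF: "points = insert (par b) (insert s (S - {s}))" "par b \<notin> insert s (S - {s})" "s \<notin> S - {s}"
        using bp s by (auto simp: S_def)
      then have "(\<Prod>s\<in>points. [:- s, 1::complex:]) = [:- par b, 1:] * ([:- s, 1:] * (\<Prod>s'\<in>S - {s}. [:- s', 1:]))"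
        by (subst PF(1)) (simp only: prod.insert finite_insert finite_Diff fS(1) PF(2,3) not_False_eq_True)
      with 1 prod_lines c(2) have "([:- par b, 1:] * [:- s, 1:]) * (\<Prod>d\<in>F. [:- par d, 1:])
         = ([:- par b, 1:] * [:- s, 1:]) * (T * (\<Prod>s'\<in>S - {s}. [:- s', 1:]))"
        unfolding T_def by (simp only: mult.assoc mult.left_commute mult.commute)
      then show ?thesis by (subst (asm) mult_left_cancel) auto
    qed
    define \<eta> where "\<eta> = lift e (smult (1 / \<kappa>) (q s)) *s \<eta>0"
    have "e + card F = k" using cF k cA by (simp add: e_def)
    then have "\<eta> \<in> D k A" unfolding \<eta>_def using D_smult[OF homogeneous_lift D0] by metis
    moreover have "R (app a \<eta>) = T * (q s * (\<Prod>s'\<in>S - {s}. [:- s', 1:]))"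
    proof -
      have "R (app a \<eta>) = smult (1 / \<kappa>) (q s) * smult \<kappa> (T * (\<Prod>s'\<in>S - {s}. [:- s', 1:]))"
        using q(1)[OF s] k0 by (simp add: \<eta>_def app_smult res.sub_mult R_lift R0 TP)
      then show ?thesis using k0 by (simp add: mult.left_commute)
    qed
    ultimately show ?thesis by blast
  qed
  then obtain \<eta> where \<eta>: "\<And>s. s \<in> S \<Longrightarrow> \<eta> s \<in> D k A"
    "\<And>s. s \<in> S \<Longrightarrow> R (app a (\<eta> s)) = T * (q s * (\<Prod>s'\<in>S - {s}. [:- s', 1:]))" by metis
  have "R (app a (\<Sum>s\<in>S. \<eta> s)) = g"
    unfolding g' q(2) by (simp add: app_sum res.sub_sum \<eta>(2) sum_distrib_left)
  moreover have "(\<Sum>s\<in>S. \<eta> s) \<in> D k A" using \<eta>(1) by (rule D_sum)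
  ultimately show ?thesis by blast
qed

end

section \<open>Generation in low degree and deletion of a line\<close>

text \<open>The products \<open>S\<^sub>1 M\<close> of linear forms with a subspace \<open>M\<close>.\<close>

definition S1 :: "(poly3^3) set \<Rightarrow> (poly3^3) set" where
  "S1 M = {\<Sum>i\<in>UNIV. Xv i *s \<psi> i |\<psi>. \<forall>i. \<psi> i \<in> M}"

lemma S1_I: "(\<And>i. f i \<in> M) \<Longrightarrow> x = (\<Sum>i\<in>UNIV. Xv i *s f i) \<Longrightarrow> x \<in> S1 M"
  unfolding S1_def by blast

lemma S1_add:
  assumes "\<And>x y. x \<in> M \<Longrightarrow> y \<in> M \<Longrightarrow> x + y \<in> M" "x \<in> S1 M" "y \<in> S1 M"
  shows "x + y \<in> S1 M"
proof -
  obtain f where f: "x = (\<Sum>i\<in>UNIV. Xv i *s f i)" "\<forall>i. f i \<in> M"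
    using assms(2) unfolding S1_def by blast
  obtain g where g: "y = (\<Sum>i\<in>UNIV. Xv i *s g i)" "\<forall>i. g i \<in> M"
    using assms(3) unfolding S1_def by blast
  have "x + y = (\<Sum>i\<in>UNIV. Xv i *s (f i + g i))"
    by (simp add: f g vec.scale_right_distrib sum.distrib vector_add_ldistrib)
  moreover have "f i + g i \<in> M" for i using f g assms(1) by blast
  ultimately show ?thesis by (rule S1_I[rotated])
qed

lemma S1_lf:
  assumes "\<And>c x. x \<in> M \<Longrightarrow> const_poly c *s x \<in> M" "x \<in> M"
  shows "lf b *s x \<in> S1 M"
proof -
  have "lf b *s x = (\<Sum>i\<in>UNIV. Xv i *s (const_poly (b $ i) *s x))"
    by (simp add: lf_def sum_3 vec_eq_iff algebra_simps)
  moreover have "const_poly (b $ i) *s x \<in> M" for i using assms by blast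
  ultimately show ?thesis by (rule S1_I[rotated])
qed

lemma (in frame) S1_frame:
  assumes "x \<in> S1 M" "\<And>x y. x \<in> M \<Longrightarrow> y \<in> M \<Longrightarrow> x + y \<in> M" "\<And>c x. x \<in> M \<Longrightarrow> const_poly c *s x \<in> M"
  shows "\<exists>y\<in>M. \<exists>z\<in>M. \<exists>t\<in>M. x = lf a *s y + lf l *s z + lf m *s t"
proof -
  obtain f where f: "x = (\<Sum>i\<in>UNIV. Xv i *s f i)" "\<forall>i. f i \<in> M" using assms(1) unfolding S1_def by blast
  define h where "h c = const_poly (c $ 1) *s f 1 + const_poly (c $ 2) *s f 2 + const_poly (c $ 3) *s f 3" for c :: "complex^3"
  have "h c \<in> M" for c unfolding h_def using f assms(2,3) by blast
  moreover have "x = lf a *s h v + lf l *s h u + lf m *s h w"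
    unfolding f(1) h_def by (subst Xv_expand) (simp add: sum_3 vec_eq_iff algebra_simps)
  ultimately show ?thesis by blast
qed

definition nonconcurrent :: "(complex^3) set \<Rightarrow> bool" where
  "nonconcurrent A \<longleftrightarrow> (\<forall>x. (\<forall>a\<in>A. dot a x = 0) \<longrightarrow> x = 0)"

context arr_frame
begin

text \<open>The contraction of the vector field with the radial field along the line \<open>a\<close>. If the field is tangent to the line, the
roots of this polynomial are the singularities on the line of the foliation that the field defines.\<close>

definition tangency :: "poly3^3 \<Rightarrow> complex poly" where
  "tangency \<theta> = R (app m \<theta>) - [:0, 1:] * R (app l \<theta>)"

lemma degree_tangency: assumes "\<theta> \<in> D k A'" shows "degree (tangency \<theta>) \<le> Suc k"
proof -
  have "degree ([:0, 1:] * R (app l \<theta>)) \<le> Suc k"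
    using R_app_degree[OF assms, of l] by (simp add: degree_pCons_le order_trans)
  then show ?thesis unfolding tangency_def using R_app_degree[OF assms, of m]
    by (intro degree_diff_le) auto
qed

lemma R_app_on_line:
  assumes "\<theta> \<in> D k (insert a A)" "b \<in> A"
  shows "R (app b \<theta>) = smult (dot b w) (R (app m \<theta>) - smult (par b) (R (app l \<theta>)))"
proof -
  have 0: "R (app a \<theta>) = 0" using assms D_insert by blast
  have "R (app b \<theta>) = smult (dot b u) (R (app l \<theta>)) + smult (dot b w) (R (app m \<theta>))"
    by (subst app_expand) (simp add: res.sub_add res.sub_mult res.sub_const 0)
  then show ?thesis using dot_u[OF assms(2)]
    by (simp add: smult_diff_right algebra_simps)
qed

lemma tangency_points:
  assumes "\<theta> \<in> D k (insert a A)" "s \<in> points"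
  shows "poly (tangency \<theta>) s = 0"
proof -
  obtain b where b: "b \<in> A" "s = par b" using assms(2) by (auto simp: points_def)
  have "\<theta> \<in> D k A" using assms(1) D_mono[of A "insert a A"] by blast
  then have "poly (R (app b \<theta>)) s = 0" using R_app_lf b by simp
  then show ?thesis using generic[OF b(1)] b(2)
    by (simp add: R_app_on_line[OF assms(1) b(1)] tangency_def)
qed

lemma tangency_0_if_many_points:
  assumes "\<theta> \<in> D k (insert a A)" "card points > Suc k"
  shows "tangency \<theta> = 0"
proof (rule ccontr)
  assume "tangency \<theta> \<noteq> 0"
  moreover have "(\<Prod>s\<in>points. [:- s, 1:]) dvd tangency \<theta>"
    using prod_linear_dvd[OF finite_points] tangency_points[OF assms(1)] by blast
  ultimately have "card points \<le> degree (tangency \<theta>)"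
    using dvd_imp_degree_le[of "\<Prod>s\<in>points. [:- s, 1:]" "tangency \<theta>"]
      degree_prod_linear[OF finite_points, of "\<lambda>s. s"] by simp
  then show False using degree_tangency[OF assms(1)] assms(2) by simp
qed

text \<open>If the field is radial along the line \<open>a\<close>, a multiple of the Euler field can be subtracted so that it
vanishes there. The quotient by the linear form \<open>a\<close> is logarithmic for the arrangement without \<open>a\<close>, in one degree less.\<close>

lemma deletion:
  assumes \<theta>: "\<theta> \<in> D (Suc k) (insert a A)" and B: "tangency \<theta> = 0"
    and triv: "\<And>\<psi>. \<psi> \<in> D k A \<Longrightarrow> \<exists>q. \<psi> = q *s Euler"
  shows "\<exists>q. \<theta> = q *s Euler"
proof -
  define \<alpha> where "\<alpha> = R (app l \<theta>)"
  have \<beta>: "R (app m \<theta>) = pCons 0 \<alpha>" using B by (simp add: tangency_def \<alpha>_def)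
  have "degree (pCons 0 \<alpha>) \<le> Suc k" using R_app_degree[OF \<theta>, of m] \<beta> by simp
  then have d\<alpha>: "degree \<alpha> \<le> k" by (cases "\<alpha> = 0") simp_all
  \<comment> \<open>the coefficient of the Euler field that agrees with the given field along the line\<close>
  define q where "q = lift k \<alpha>"
  have hq: "homogeneous k q" and Rq: "R q = \<alpha>" using homogeneous_lift R_lift[OF d\<alpha>] by (simp_all add: q_def)
  define \<theta>' where "\<theta>' = \<theta> - q *s Euler"
  have D': "\<theta>' \<in> D (Suc k) (insert a A)" unfolding \<theta>'_def using D_diff[OF \<theta> D_Euler[OF hq]] .
  then have h': "homogeneous_triple (Suc k) \<theta>'" by (simp add: D_def)
  have R': "R (app c \<theta>') = 0" if "c \<in> {a, l, m}" for c
  proof -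
    have "R (app a \<theta>) = 0" using \<theta> D_insert by blast
    then show ?thesis using that
      by (auto simp: \<theta>'_def app_diff app_smult app_Euler res.sub_diff res.sub_mult Rq \<beta> \<alpha>_def)
  qed
  have "lf a dvd app c \<theta>'" if "c \<in> {a, l, m}" for c
    using R'[OF that] dvd_iff_R[OF homogeneous_app[OF h']] by blast
  then have "lf a dvd \<theta>' $ i" for i
    by (subst triple_expand) (intro dvd_add dvd_mult, auto)
  then have "\<forall>i. \<exists>k. \<theta>' $ i = lf a * k" by (auto simp: dvd_def)
  then obtain f where f: "\<And>i. \<theta>' $ i = lf a * f i" by metis
  define \<psi> where "\<psi> = (\<chi> i. f i)"
  have e: "\<theta>' = lf a *s \<psi>" using f by (simp add: \<psi>_def vec_eq_iff)
  have a0: "a \<noteq> 0" using arr by (auto simp: arr_def)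
  have "homogeneous k (f i)" for i
    using homogeneous_factor[of "Suc 0" "lf a" k "f i"] h' f a0 by (simp add: homogeneous_triple_def lf_eq_0_iff)
  then have h\<psi>: "homogeneous_triple k \<psi>" by (simp add: homogeneous_triple_def \<psi>_def)
  have "lf b dvd app b \<psi>" if b: "b \<in> A" for b
  proof -
    have "lf b dvd lf a * app b \<psi>" using D' b by (simp add: D_def e app_smult)
    moreover have b0: "b \<noteq> 0" using arr b by (auto simp: arr_def)
    moreover have "\<not> lf b dvd lf a"
      using lf_dvd_lf[OF b0] arr b a_notin unfolding arr_def by (metis insertCI)
    ultimately show ?thesis using lf_prime[OF b0 homogeneous_lf homogeneous_app[OF h\<psi>]] by blast
  qed
  then have "\<psi> \<in> D k A" using h\<psi> by (simp add: D_def)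
  then obtain q' where "\<psi> = q' *s Euler" using triv by blast
  then have "\<theta> = (q + lf a * q') *s Euler" using e by (simp add: \<theta>'_def vec_eq_iff algebra_simps)
  then show ?thesis ..
qed

lemma card_points_ge_2:
  assumes "nonconcurrent A"
  shows "card points \<ge> 2"
proof (rule ccontr)
  assume "\<not> card points \<ge> 2"
  then have "card points = 0 \<or> card points = 1" by auto
  then obtain s where "points \<subseteq> {s}" using finite_points by (auto simp: card_1_singleton_iff)
  then have "\<forall>b\<in>A. dot b (pt s) = 0" using dot_pt_0 by (auto simp: points_def)
  then show False using assms pt_neq_0 unfolding nonconcurrent_def by blast
qed

text \<open>Write \<open>\<theta> = a x + l y + m z\<close> with \<open>x, y, z\<close> logarithmic for \<open>A\<close>. Tangency to the new line says that the restrictions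
\<open>g\<^sub>1, g\<^sub>2\<close> of \<open>y(a)\<close>, \<open>z(a)\<close> satisfy \<open>g\<^sub>1 + t g\<^sub>2 = 0\<close>. A derivation \<open>\<eta>\<close> of one degree less whose restriction is
\<open>g\<^sub>2\<close> turns \<open>y, z\<close> into \<open>y + m \<eta>\<close>, \<open>z - l \<eta>\<close>, both tangent to the new line, without changing \<open>\<theta>\<close>.\<close>

lemma generation_step:
  assumes pts: "card points \<ge> 2" and k: "card A \<le> k + 1" "1 \<le> k"
    and gen0: "D k A \<subseteq> S1 (D (k - 1) A)" and gen: "D (Suc k) A \<subseteq> S1 (D k A)"
  shows "D (Suc k) (insert a A) \<subseteq> S1 (D k (insert a A))"
proof
  fix \<theta> assume \<theta>: "\<theta> \<in> D (Suc k) (insert a A)"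
  let ?M = "D k (insert a A)"
  have "\<theta> \<in> D (Suc k) A" using \<theta> D_mono[of A "insert a A"] by blast
  then have "\<theta> \<in> S1 (D k A)" using gen by blast
  then obtain x y z where x: "x \<in> D k A" and y: "y \<in> D k A" and z: "z \<in> D k A"
    and e: "\<theta> = lf a *s x + lf l *s y + lf m *s z"
    using S1_frame[OF _ D_add D_cmult] by metis
  have "R (app a \<theta>) = 0" using \<theta> D_insert by blast
  then have R0: "R (app a y) + pCons 0 (R (app a z)) = 0"
    by (simp add: e app_add app_smult res.sub_add res.sub_mult)
  have "degree (pCons 0 (R (app a z))) \<le> k"
  proof -
    have "pCons 0 (R (app a z)) = - R (app a y)" using R0 by (simp add: add_eq_0_iff)
    then show ?thesis using R_app_degree[OF y, of a] by simp
  qed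
  then have "degree (R (app a z)) \<le> k - 1" by (cases "R (app a z) = 0") simp_all
  then obtain \<eta> where \<eta>: "\<eta> \<in> D (k - 1) A" "R (app a \<eta>) = R (app a z)"
    using surj_restriction[OF pts, of "k - 1" "R (app a z)"] R_app_doubles[OF z] k by auto
  have kk: "Suc 0 + (k - 1) = k" using k by simp
  have l\<eta>: "lf c *s \<eta> \<in> D k A" for c using D_smult[OF homogeneous_lf \<eta>(1)] unfolding kk .
  have zM: "z - lf l *s \<eta> \<in> ?M"
    using D_diff[OF z l\<eta>] unfolding D_insert by (simp add: app_diff app_smult res.sub_diff res.sub_mult \<eta>)
  have yM: "y + lf m *s \<eta> \<in> ?M"
    using D_add[OF y l\<eta>] R0 unfolding D_insert by (simp add: app_add app_smult res.sub_add res.sub_mult \<eta>)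
  have xM: "lf a *s x \<in> S1 ?M"
  proof -
    have "x \<in> S1 (D (k - 1) A)" using x gen0 by blast
    then obtain f where f: "x = (\<Sum>i\<in>UNIV. Xv i *s f i)" "\<forall>i. f i \<in> D (k - 1) A" unfolding S1_def by blast
    have "lf a *s x = (\<Sum>i\<in>UNIV. Xv i *s (lf a *s f i))"
      unfolding f(1) by (simp add: sum_3 vec_eq_iff algebra_simps)
    moreover have "lf a *s f i \<in> ?M" for i
    proof -
      have "lf a *s f i \<in> D k A" using D_smult[OF homogeneous_lf, of "f i" "k - 1" A a] f(2) unfolding kk by blast
      then show ?thesis unfolding D_insert by (simp add: app_smult res.sub_mult)
    qed
    ultimately show ?thesis by (rule S1_I[rotated])
  qed
  have "lf a *s x + lf l *s (y + lf m *s \<eta>) + lf m *s (z - lf l *s \<eta>) \<in> S1 ?M"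
    by (rule S1_add[OF D_add S1_add[OF D_add xM S1_lf[OF D_cmult yM]] S1_lf[OF D_cmult zM]])
  also have "lf a *s x + lf l *s (y + lf m *s \<eta>) + lf m *s (z - lf l *s \<eta>) = \<theta>"
    unfolding e by (simp add: vec_eq_iff algebra_simps)
  finally show "\<theta> \<in> S1 ?M" .
qed

end

text \<open>The matrix with rows \<open>a, l, m\<close> is invertible; the columns of its inverse form the dual basis.\<close>

lemma frame_of_nonconcurrent:
  assumes "nonconcurrent {a, l, m}"
  shows "\<exists>v u w. frame a v l m u w"
proof -
  define M :: "complex^3^3" where "M = vector [a, l, m]"
  have Mx: "(M *v x) $ 1 = dot a x" "(M *v x) $ 2 = dot l x" "(M *v x) $ 3 = dot m x" for x
    by (simp_all add: M_def matrix_vector_mult_def dot_def)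
  have "M *v x = 0 \<Longrightarrow> x = 0" for x
    using assms Mx[of x] unfolding nonconcurrent_def by auto
  then obtain N where N: "N ** M = mat 1" using matrix_left_invertible_ker by blast
  then have N': "M ** N = mat 1" using matrix_left_right_inverse by blast
  define v where "v = column 1 N"
  define u where "u = column 2 N"
  define w where "w = column 3 N"
  have col: "M *v column j N = axis j 1" for j
  proof -
    have "M *v column j N = column j (M ** N)"
      by (simp add: vec_eq_iff column_def matrix_vector_mult_def matrix_matrix_mult_def)
    then show ?thesis by (simp add: N' column_def mat_def axis_def vec_eq_iff)
  qed
  have "frame a v l m u w"
  proof
    fix x
    have "x = N *v (M *v x)" by (simp add: matrix_vector_mul_assoc N)
    also have "\<dots> = dot a x *s v + dot l x *s u + dot m x *s w"
      unfolding matrix_mult_sum[of N] by (simp add: sum_3 Mx v_def u_def w_def)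
    finally show "x = dot a x *s v + dot l x *s u + dot m x *s w" .
  qed (simp_all add: v_def u_def w_def col axis_def flip: Mx)
  then show ?thesis by blast
qed

context frame
begin

text \<open>For three lines that are not concurrent, the logarithmic derivations form a free module with basis
\<open>x \<partial>\<^sub>x, y \<partial>\<^sub>y, z \<partial>\<^sub>z\<close> in suitable coordinates (lemma \<open>D_frame\<close>).\<close>

definition basis_vec :: "poly3 \<Rightarrow> poly3 \<Rightarrow> poly3 \<Rightarrow> poly3^3" where
  "basis_vec p q r = (lf a * p) *s cvec v + (lf l * q) *s cvec u + (lf m * r) *s cvec w"

lemma app_basis_vec:
  "app a (basis_vec p q r) = lf a * p" "app l (basis_vec p q r) = lf l * q" "app m (basis_vec p q r) = lf m * r"
  by (simp_all add: basis_vec_def app_add app_smult app_cvec)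

lemma triple_eqI: "app a x = app a y \<Longrightarrow> app l x = app l y \<Longrightarrow> app m x = app m y \<Longrightarrow> x = y"
  by (simp add: vec_eq_iff triple_expand)

lemma covectors_neq_0: "a \<noteq> 0" "l \<noteq> 0" "m \<noteq> 0"
  using dual by (metis dot_zero(2) zero_neq_one)+

lemma D_frame: "D (Suc k) {a, l, m} = {basis_vec p q r |p q r. homogeneous k p \<and> homogeneous k q \<and> homogeneous k r}"
proof (intro equalityI subsetI)
  fix \<theta> assume "\<theta> \<in> D (Suc k) {a, l, m}"
  then have h: "homogeneous_triple (Suc k) \<theta>" and d: "lf a dvd app a \<theta>" "lf l dvd app l \<theta>" "lf m dvd app m \<theta>"
    by (auto simp: D_def)
  obtain p q r where pqr: "app a \<theta> = lf a * p" "app l \<theta> = lf l * q" "app m \<theta> = lf m * r"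
    using d by (meson dvdE)
  have "homogeneous k p" "homogeneous k q" "homogeneous k r"
    using homogeneous_factor[of "Suc 0" "lf a" k p] homogeneous_factor[of "Suc 0" "lf l" k q]
      homogeneous_factor[of "Suc 0" "lf m" k r] homogeneous_app[OF h] covectors_neq_0
    by (simp_all add: lf_eq_0_iff flip: pqr)
  moreover have "\<theta> = basis_vec p q r" by (rule triple_eqI) (simp_all add: app_basis_vec pqr)
  ultimately show "\<theta> \<in> {basis_vec p q r |p q r. homogeneous k p \<and> homogeneous k q \<and> homogeneous k r}" by blast
next
  fix \<theta> assume "\<theta> \<in> {basis_vec p q r |p q r. homogeneous k p \<and> homogeneous k q \<and> homogeneous k r}"
  then obtain p q r where e: "\<theta> = basis_vec p q r" and h: "homogeneous k p" "homogeneous k q" "homogeneous k r" by blast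
  have "homogeneous_triple (Suc k) ((lf c * p) *s cvec x)" if "homogeneous k p" for p c x
    using homogeneous_triple_smult[OF homogeneous_mult[OF homogeneous_lf that] homogeneous_triple_cvec] by simp
  then have "homogeneous_triple (Suc k) \<theta>" unfolding e basis_vec_def
    using h by (intro homogeneous_triple_add) auto
  then show "\<theta> \<in> D (Suc k) {a, l, m}" by (simp add: D_def e app_basis_vec)
qed

lemma generation_base:
  assumes "k \<ge> 1"
  shows "D (Suc k) {a, l, m} \<subseteq> S1 (D k {a, l, m})"
proof
  obtain j where j: "k = Suc j" using assms by (cases k) auto
  fix \<theta> assume "\<theta> \<in> D (Suc k) {a, l, m}"
  then obtain p q r where e: "\<theta> = basis_vec p q r" and h: "homogeneous k p" "homogeneous k q" "homogeneous k r"
    unfolding D_frame by blast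
  obtain p' where p': "\<And>i. homogeneous j (p' i)" "p = (\<Sum>i\<in>UNIV. Xv i * p' i)"
    using homogeneous_Suc_decomp h(1) j by blast
  obtain q' where q': "\<And>i. homogeneous j (q' i)" "q = (\<Sum>i\<in>UNIV. Xv i * q' i)"
    using homogeneous_Suc_decomp h(2) j by blast
  obtain r' where r': "\<And>i. homogeneous j (r' i)" "r = (\<Sum>i\<in>UNIV. Xv i * r' i)"
    using homogeneous_Suc_decomp h(3) j by blast
  have "\<theta> = (\<Sum>i\<in>UNIV. Xv i *s basis_vec (p' i) (q' i) (r' i))"
    unfolding e p'(2) q'(2) r'(2) by (simp add: basis_vec_def sum_3 vec_eq_iff algebra_simps)
  moreover have "basis_vec (p' i) (q' i) (r' i) \<in> D k {a, l, m}" for i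
    unfolding j D_frame using p'(1) q'(1) r'(1) by blast
  ultimately show "\<theta> \<in> S1 (D k {a, l, m})" by (rule S1_I[rotated])
qed

end

lemma nonconcurrent_mono: "nonconcurrent B \<Longrightarrow> B \<subseteq> A \<Longrightarrow> nonconcurrent A"
  unfolding nonconcurrent_def by blast

lemma nonconcurrent_card:
  assumes "nonconcurrent {a, l, m}" shows "card {a, l, m} = 3"
proof -
  obtain v u w where "frame a v l m u w" using frame_of_nonconcurrent[OF assms] by blast
  then interpret frame a v l m u w .
  have "a \<noteq> l" "a \<noteq> m" "l \<noteq> m" using dual by (metis zero_neq_one)+
  then show ?thesis by simp
qed

text \<open>Adding a line raises the degree bound for generators by one; the three initial lines need degree one.\<close>

lemma generation:
  assumes "nonconcurrent {a, l, m}" "finite F" "F \<inter> {a, l, m} = {}" "arr (F \<union> {a, l, m})" "k \<ge> card F + 1"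
  shows "D (Suc k) (F \<union> {a, l, m}) \<subseteq> S1 (D k (F \<union> {a, l, m}))"
  using assms(2-5)
proof (induction F arbitrary: k rule: finite_induct)
  case empty
  obtain v u w where "frame a v l m u w" using frame_of_nonconcurrent[OF assms(1)] by blast
  then show ?case using frame.generation_base empty by simp
next
  case (insert b F)
  let ?A = "F \<union> {a, l, m}"
  have arr: "arr (insert b ?A)" using insert.prems(2) by (simp only: Un_insert_left)
  have b: "b \<notin> ?A" using insert by auto
  have arrA: "arr ?A" using arr_subset[OF arr] by blast
  obtain v l' m' u w where "arr_frame b v l' m' u w ?A" using arr_frame_exists[OF arr b] by blast
  then interpret arr_frame b v l' m' u w ?A .
  have "nonconcurrent ?A" using nonconcurrent_mono[OF assms(1)] by blast
  then have pts: "card points \<ge> 2" by (rule card_points_ge_2)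
  have "card ?A \<le> card F + 3" using card_Un_le[of F "{a, l, m}"] nonconcurrent_card[OF assms(1)] by simp
  obtain j where j: "k = Suc j" "j \<ge> card F + 1" using insert by (cases k) auto
  have "D (Suc k) ?A \<subseteq> S1 (D k ?A)" "D k ?A \<subseteq> S1 (D (k - 1) ?A)"
    using insert.IH[of k] insert.IH[of j] insert.prems j arrA by auto
  then have "D (Suc k) (insert b ?A) \<subseteq> S1 (D k (insert b ?A))"
    using generation_step[OF pts, of k] \<open>card ?A \<le> card F + 3\<close> j by simp
  then show ?case by (simp only: Un_insert_left)
qed

section \<open>The Hilbert function of the logarithmic derivations\<close>

lemma sumsI: "x \<in> U \<Longrightarrow> y \<in> W \<Longrightarrow> x + y \<in> {x + y |x y. x \<in> U \<and> y \<in> W}"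
  by blast

context linspace_pair
begin

lemma dim_image_inj:
  assumes "Vector_Spaces.linear s1 s2 f" "vs1.subspace V" "vs1.fin_dim V" "\<And>x. x \<in> V \<Longrightarrow> f x = 0 \<Longrightarrow> x = 0"
  shows "vs2.dim (f ` V) = vs1.dim V"
proof -
  interpret f: Vector_Spaces.linear s1 s2 f by fact
  have "{x \<in> V. f x = 0} = {0}" using assms(2,4) vs1.subspace_0 f.zero by blast
  then show ?thesis using rank_nullity(1)[OF assms(1-3)] vs1.dim_trivial by simp
qed

end

abbreviation scale_vec :: "complex \<Rightarrow> poly3^3 \<Rightarrow> poly3^3" where "scale_vec \<equiv> \<lambda>c x. const_poly c *s x"
abbreviation scale_poly :: "complex \<Rightarrow> poly3 \<Rightarrow> poly3" where "scale_poly \<equiv> \<lambda>c p. const_poly c * p"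

global_interpretation cV: linspace scale_vec
  by unfold_locales (simp_all add: const_poly_add const_poly_mult vec_eq_iff algebra_simps)

global_interpretation cS: linspace scale_poly
  by unfold_locales (simp_all add: const_poly_add const_poly_mult algebra_simps)

global_interpretation cU: linspace "smult :: complex \<Rightarrow> complex poly \<Rightarrow> complex poly"
  by unfold_locales (simp_all add: smult_add_left smult_add_right)

global_interpretation cSV: linspace_pair scale_poly scale_vec ..
global_interpretation cVS: linspace_pair scale_vec scale_poly ..
global_interpretation cSS: linspace_pair scale_poly scale_poly ..
global_interpretation cSU: linspace_pair scale_poly "smult :: complex \<Rightarrow> complex poly \<Rightarrow> complex poly" ..
global_interpretation cVU: linspace_pair scale_vec "smult :: complex \<Rightarrow> complex poly \<Rightarrow> complex poly" ..
global_interpretation cUU: linspace_pair "smult :: complex \<Rightarrow> complex poly \<Rightarrow> complex poly" "smult :: complex \<Rightarrow> complex poly \<Rightarrow> complex poly" ..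
global_interpretation cVV: linspace_pair scale_vec scale_vec ..

lemma linear_mult: "Vector_Spaces.linear scale_poly scale_poly (\<lambda>p. q * p)"
  unfolding Vector_Spaces.linear_iff
  by (intro conjI allI cS.vector_space_axioms) (simp_all add: algebra_simps)

lemma linear_smult: "Vector_Spaces.linear scale_vec scale_vec (\<lambda>x. q *s x)"
  unfolding Vector_Spaces.linear_iff
  by (intro conjI allI cV.vector_space_axioms) (simp_all add: vec_eq_iff algebra_simps)

lemma linear_times_vec: "Vector_Spaces.linear scale_poly scale_vec (\<lambda>p. (q * p) *s y)"
  unfolding Vector_Spaces.linear_iff
  by (intro conjI allI cV.vector_space_axioms cS.vector_space_axioms) (simp_all add: vec_eq_iff algebra_simps)

lemma linear_res: "Vector_Spaces.linear scale_poly smult (res u w)"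
  unfolding Vector_Spaces.linear_iff
  by (intro conjI allI cU.vector_space_axioms cS.vector_space_axioms) (simp_all add: res.sub_add res.sub_mult res.sub_const)

lemma linear_res_app: "Vector_Spaces.linear scale_vec smult (\<lambda>x. res u w (app a x))"
  unfolding Vector_Spaces.linear_iff
  by (intro conjI allI cU.vector_space_axioms cV.vector_space_axioms) (simp_all add: app_add app_smult res.sub_add res.sub_mult res.sub_const)

lemma linear_umult: "Vector_Spaces.linear smult smult (\<lambda>g::complex poly. h * g)"
  unfolding Vector_Spaces.linear_iff
  by (intro conjI allI cU.vector_space_axioms) (simp_all add: algebra_simps)

lemma degree_le_space:
  fixes k :: nat
  defines "V \<equiv> {g::complex poly. degree g \<le> k}"
  shows "cU.subspace V" "cU.fin_dim V" "cU.dim V = Suc k"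
proof -
  define B where "B = (\<lambda>j. monom (1::complex) j) ` {..k}"
  have inj: "inj_on (\<lambda>j. monom (1::complex) j) {..k}" by (auto intro!: inj_onI simp: monom_eq_iff')
  have BV: "B \<subseteq> V" by (auto simp: B_def V_def degree_monom_eq)
  have VB: "V \<subseteq> cU.span B"
  proof
    fix g assume "g \<in> V"
    then have "g = (\<Sum>j\<le>k. smult (coeff g j) (monom 1 j))"
      using poly_as_sum_of_monoms'[of g k] by (simp add: V_def smult_monom)
    also have "\<dots> \<in> cU.span B"
      by (intro cU.span_sum cU.span_scale cU.span_base) (auto simp: B_def)
    finally show "g \<in> cU.span B" .
  qed
  have ind: "cU.independent B"
  proof (rule cU.independent_if_scalars_zero)
    show "finite B" by (simp add: B_def)
    fix f x assume s: "(\<Sum>x\<in>B. smult (f x) x) = 0" and "x \<in> B"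
    then obtain j where j: "j \<le> k" "x = monom 1 j" by (auto simp: B_def)
    have "(\<Sum>x\<in>B. smult (f x) x) = (\<Sum>i\<le>k. smult (f (monom 1 i)) (monom 1 i))"
      unfolding B_def by (subst sum.reindex[OF inj]) simp
    then have "coeff (\<Sum>i\<le>k. smult (f (monom 1 i)) (monom 1 i)) j = 0" using s by simp
    then show "f x = 0" using j by (simp add: coeff_sum if_distrib cong: if_cong)
  qed
  have "card B = Suc k" unfolding B_def by (simp add: card_image[OF inj])
  then show "cU.dim V = Suc k" using cU.dim_unique[OF BV VB ind] by simp
  show "cU.fin_dim V" unfolding cU.fin_dim_def using VB by (intro exI[of _ B]) (simp add: B_def)
  show "cU.subspace V" by (auto simp: cU.subspace_def V_def degree_add_le order_trans[OF degree_smult_le])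
qed

text \<open>Division by the product of the \<open>t - s\<close>.\<close>

lemma degree_le_vanishing_dim:
  assumes "finite S" "card S \<le> Suc k"
  shows "cU.dim {g::complex poly. degree g \<le> k \<and> (\<forall>s\<in>S. poly g s = 0)} + card S = Suc k"
proof -
  define P where "P = (\<Prod>s\<in>S. [:- s, 1::complex:])"
  have P0: "P \<noteq> 0" unfolding P_def by (rule prod_linear_neq_0)
  have dP: "degree P = card S" unfolding P_def by (rule degree_prod_linear[OF assms(1)])
  have PS: "poly P s = 0" if "s \<in> S" for s using that assms(1) by (auto simp: P_def poly_prod)
  let ?W = "{g::complex poly. degree g \<le> k \<and> (\<forall>s\<in>S. poly g s = 0)}"
  show ?thesis
  proof (cases "card S = Suc k")
    case True
    have "g = 0" if "g \<in> ?W" for g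
    proof (rule ccontr)
      assume "g \<noteq> 0"
      moreover have "P dvd g" using prod_linear_dvd[OF assms(1), of g] that unfolding P_def by blast
      ultimately have "degree P \<le> degree g" by (rule dvd_imp_degree_le[rotated])
      then show False using that dP True by simp
    qed
    then have "?W = {0}" by auto
    then show ?thesis using True cU.dim_trivial by simp
  next
    case False
    then have le: "card S \<le> k" using assms(2) by simp
    let ?V = "{g::complex poly. degree g \<le> k - card S}"
    have "(\<lambda>g. P * g) ` ?V = ?W"
    proof (intro equalityI subsetI)
      fix g assume "g \<in> (\<lambda>g. P * g) ` ?V"
      then show "g \<in> ?W" using le dP PS degree_mult_le[of P] by (force intro: order_trans)
    next
      fix g assume g: "g \<in> ?W"
      then have "P dvd g" using prod_linear_dvd[OF assms(1), of g] unfolding P_def by blast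
      then obtain h where h: "g = P * h" by blast
      have "degree h \<le> k - card S"
        using g P0 dP by (cases "h = 0") (auto simp: h degree_mult_eq)
      then show "g \<in> (\<lambda>g. P * g) ` ?V" using h by blast
    qed
    moreover have "cU.dim ((\<lambda>g. P * g) ` ?V) = cU.dim ?V"
      by (rule cUU.dim_image_inj[OF linear_umult degree_le_space(1,2)]) (use P0 in auto)
    ultimately show ?thesis using degree_le_space(3)[of "k - card S"] le by simp
  qed
qed

abbreviation HS :: "nat \<Rightarrow> poly3 set" where "HS k \<equiv> {p. homogeneous k p}"

lemma subspace_HS: "cS.subspace (HS k)"
  by (auto simp: cS.subspace_def homogeneous_add homogeneous_cmult)

lemma fin_dim_HS: "cS.fin_dim (HS k)"
proof (induction k)
  case 0
  have "p \<in> cS.span {1}" if "p \<in> HS 0" for p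
  proof -
    have "homogeneous 0 p" using that by simp
    from homogeneous_0_const[OF this] obtain c where "p = const_poly c * 1" by auto
    then show ?thesis using cS.span_scale[OF cS.span_base, of 1 "{1}" c] by simp
  qed
  then show ?case unfolding cS.fin_dim_def by (intro exI[of _ "{1}"]) auto
next
  case (Suc k)
  let ?I = "\<lambda>i. (\<lambda>p. Xv i * p) ` HS k"
  have f: "cS.fin_dim (?I i)" for i by (rule cSS.rank_nullity(2)[OF linear_mult subspace_HS Suc])
  have "HS (Suc k) \<subseteq> {x + y |x y. x \<in> {x + y |x y. x \<in> ?I 1 \<and> y \<in> ?I 2} \<and> y \<in> ?I 3}"
  proof
    fix p assume "p \<in> HS (Suc k)"
    then obtain q where "\<And>i. homogeneous k (q i)" "p = (\<Sum>i\<in>UNIV. Xv i * q i)"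
      using homogeneous_Suc_decomp by blast
    then show "p \<in> {x + y |x y. x \<in> {x + y |x y. x \<in> ?I 1 \<and> y \<in> ?I 2} \<and> y \<in> ?I 3}"
      by (auto simp: sum_3) blast
  qed
  then show ?case using cS.fin_dim_sums[OF cS.fin_dim_sums[OF f f] f] cS.fin_dim_subset by blast
qed

lemma dim_HS_0: "cS.dim (HS 0) = 1"
proof (rule cS.dim_unique[of "{1}"])
  show "HS 0 \<subseteq> cS.span {1}"
  proof
    fix p assume "p \<in> HS 0"
    then have "homogeneous 0 p" by simp
    from homogeneous_0_const[OF this] obtain c where "p = const_poly c * 1" by auto
    then show "p \<in> cS.span {1}" using cS.span_scale[OF cS.span_base, of 1 "{1}" c] by simp
  qed
qed (use homogeneous_const[of 1] in auto)

text \<open>Restriction to a line is onto, with kernel the multiples of the linear form.\<close>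

lemma dim_HS_Suc: "cS.dim (HS (Suc k)) = cS.dim (HS k) + k + 2"
proof -
  have "(axis 1 1 :: complex^3) \<noteq> 0" by simp
  then obtain a v l m u w where "frame a v l m u w" using frame_exists by blast
  then interpret frame a v l m u w .
  have "{p \<in> HS (Suc k). R p = 0} = (\<lambda>p. lf a * p) ` HS k"
  proof (intro equalityI subsetI)
    fix p assume p: "p \<in> {p \<in> HS (Suc k). R p = 0}"
    then obtain q where q: "p = lf a * q" using dvd_iff_R by blast
    have "a \<noteq> 0" using dual(1) by (metis dot_zero(2) zero_neq_one)
    then have "homogeneous k q" using homogeneous_factor[of "Suc 0" "lf a" k q] p q by (simp add: lf_eq_0_iff)
    then show "p \<in> (\<lambda>p. lf a * p) ` HS k" using q by blast
  next
    fix p assume "p \<in> (\<lambda>p. lf a * p) ` HS k"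
    then show "p \<in> {p \<in> HS (Suc k). R p = 0}"
      using homogeneous_mult[OF homogeneous_lf, of k _ a] by (auto simp: res.sub_mult)
  qed
  moreover have "R ` HS (Suc k) = {g. degree g \<le> Suc k}"
  proof (intro equalityI subsetI)
    fix g :: "complex poly" assume "g \<in> {g. degree g \<le> Suc k}"
    then show "g \<in> R ` HS (Suc k)"
      using homogeneous_lift R_lift by (intro image_eqI[of _ _ "lift (Suc k) g"]) auto
  qed (use degree_res in blast)
  moreover have "cS.dim ((\<lambda>p. lf a * p) ` HS k) = cS.dim (HS k)"
  proof (rule cSS.dim_image_inj[OF linear_mult subspace_HS fin_dim_HS])
    have "lf a \<noteq> 0" using dual(1) by (metis dot_zero(2) zero_neq_one lf_eq_0_iff)
    then show "lf a * x = 0 \<Longrightarrow> x = 0" for x by simp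
  qed
  ultimately show ?thesis
    using cSU.rank_nullity(1)[OF linear_res[of u w] subspace_HS[of "Suc k"] fin_dim_HS] degree_le_space(3)[of "Suc k"] by simp
qed

lemma dim_HS: "2 * cS.dim (HS k) = (k + 1) * (k + 2)"
  by (induction k) (simp_all add: dim_HS_0 dim_HS_Suc)

lemma fin_dim_homogeneous_triple: "cV.fin_dim {\<theta>. homogeneous_triple k \<theta>}"
proof -
  let ?I = "\<lambda>i. (\<lambda>p. (1 * p) *s axis i 1) ` HS k"
  have f: "cV.fin_dim (?I i)" for i by (rule cSV.rank_nullity(2)[OF linear_times_vec subspace_HS fin_dim_HS])
  have "{\<theta>. homogeneous_triple k \<theta>} \<subseteq> {x + y |x y. x \<in> {x + y |x y. x \<in> ?I 1 \<and> y \<in> ?I 2} \<and> y \<in> ?I 3}"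
  proof
    fix \<theta> assume "\<theta> \<in> {\<theta>. homogeneous_triple k \<theta>}"
    then have "\<theta> $ i \<in> HS k" for i by (simp add: homogeneous_triple_def)
    then have i: "(1 * \<theta> $ i) *s axis i 1 \<in> ?I i" for i by blast
    have "\<theta> = (1 * \<theta> $ 1) *s axis 1 1 + (1 * \<theta> $ 2) *s axis 2 1 + (1 * \<theta> $ 3) *s axis 3 1"
      by (simp add: vec_eq_iff axis_def forall_3)
    then show "\<theta> \<in> {x + y |x y. x \<in> {x + y |x y. x \<in> ?I 1 \<and> y \<in> ?I 2} \<and> y \<in> ?I 3}"
      by (subst \<open>\<theta> = _\<close>) (intro sumsI i)
  qed
  then show ?thesis using cV.fin_dim_sums[OF cV.fin_dim_sums[OF f f] f] cV.fin_dim_subset by blast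
qed

lemma fin_dim_D: "cV.fin_dim (D k A)"
  by (rule cV.fin_dim_subset[OF fin_dim_homogeneous_triple[of k]]) (auto simp: D_def)

lemma subspace_D: "cV.subspace (D k A)"
  by (simp add: cV.subspace_def D_0 D_add D_cmult)

text \<open>The derivations that stay logarithmic form the kernel of the map \<open>\<theta> \<mapsto> \<theta>(a)\<close> restricted to \<open>a\<close>, whose image is
known from \<open>surj_restriction\<close>.\<close>

lemma (in arr_frame) dim_D_insert:
  assumes "card points \<ge> 2" "card A \<le> k + 2"
  shows "cV.dim (D k A) + card doubles = cV.dim (D k (insert a A)) + Suc k"
proof -
  have "card doubles \<le> Suc k" using assms card_A by simp
  moreover have "(\<lambda>\<theta>. R (app a \<theta>)) ` D k A = {g. degree g \<le> k \<and> (\<forall>s\<in>doubles. poly g s = 0)}"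
  proof (intro equalityI subsetI)
    fix g assume "g \<in> {g. degree g \<le> k \<and> (\<forall>s\<in>doubles. poly g s = 0)}"
    then show "g \<in> (\<lambda>\<theta>. R (app a \<theta>)) ` D k A" using surj_restriction[OF assms, of g] by auto
  qed (use R_app_degree R_app_doubles in blast)
  ultimately show ?thesis
    using cVU.rank_nullity(1)[OF linear_res_app[of u w a] subspace_D[of k A] fin_dim_D]
      degree_le_vanishing_dim[OF finite_doubles, of k] by (simp add: D_insert)
qed

lemma (in frame) dim_D_frame: "cV.dim (D (Suc k) {a, l, m}) = 3 * cS.dim (HS k)"
proof -
  let ?I = "\<lambda>b x. (\<lambda>p. (lf b * p) *s cvec x) ` HS k"
  have f: "cV.fin_dim (?I b x)" and s: "cV.subspace (?I b x)" for b x
    by (rule cSV.rank_nullity(2,3)[OF linear_times_vec subspace_HS fin_dim_HS])+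
  have d: "cV.dim (?I b x) = cS.dim (HS k)" if "b \<noteq> 0" "c \<in> {a, l, m}" "dot c x = 1" for b c x
  proof (rule cSV.dim_image_inj[OF linear_times_vec subspace_HS fin_dim_HS])
    fix p assume "(lf b * p) *s cvec x = 0"
    then have "app c ((lf b * p) *s cvec x) = app c 0" by (rule arg_cong)
    then show "p = 0" using that by (simp add: app_smult app_cvec lf_eq_0_iff)
  qed
  let ?J = "{x + y |x y. x \<in> ?I a v \<and> y \<in> ?I l u}"
  have fJ: "cV.fin_dim ?J" and sJ: "cV.subspace ?J" using cV.fin_dim_sums[OF f f] cV.subspace_sums[OF s s] by blast+
  have "?I a v \<inter> ?I l u = {0}"
  proof -
    have "x = 0" if "x \<in> ?I a v" "x \<in> ?I l u" for x
    proof -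
      from that obtain p q where x: "x = (lf a * p) *s cvec v" "x = (lf l * q) *s cvec u" by blast
      have "app a x = 0" by (subst x(2)) (simp add: app_smult app_cvec)
      moreover have "app l x = 0" "app m x = 0" by (subst x(1), simp add: app_smult app_cvec)+
      ultimately show ?thesis by (intro triple_eqI) simp_all
    qed
    then show ?thesis using cV.subspace_0[OF s] by blast
  qed
  then have 1: "cV.dim ?J = 2 * cS.dim (HS k)"
    using cV.dim_sums_Int_fin_dim[OF s[of a v] f[of a v] s[of l u] f[of l u]] d[of a a v] d[of l l u] covectors_neq_0 cV.dim_trivial by simp
  have "?J \<inter> ?I m w = {0}"
  proof -
    have "x = 0" if "x \<in> ?J" "x \<in> ?I m w" for x
    proof -
      from that obtain p q r where x: "x = (lf a * p) *s cvec v + (lf l * q) *s cvec u" "x = (lf m * r) *s cvec w" by blast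
      have "app m x = 0" by (subst x(1)) (simp add: app_add app_smult app_cvec)
      moreover have "app a x = 0" "app l x = 0" by (subst x(2), simp add: app_smult app_cvec)+
      ultimately show ?thesis by (intro triple_eqI) simp_all
    qed
    then show ?thesis using cV.subspace_0[OF s] cV.subspace_0[OF sJ] by blast
  qed
  then have 2: "cV.dim {x + y |x y. x \<in> ?J \<and> y \<in> ?I m w} = 3 * cS.dim (HS k)"
    using cV.dim_sums_Int_fin_dim[OF sJ fJ s[of m w] f[of m w]] 1 d[of m m w] covectors_neq_0 cV.dim_trivial by simp
  have "D (Suc k) {a, l, m} = {x + y |x y. x \<in> ?J \<and> y \<in> ?I m w}"
    unfolding D_frame basis_vec_def by blast
  then show ?thesis using 2 by simp
qed

lemma triples_nonconcurrent:
  assumes "nonconcurrent {a, l, m}" shows "triples {a, l, m} = {}"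
proof -
  have "X = {a, l, m}" if "X \<subseteq> {a, l, m}" "card X = 3" for X
    using that nonconcurrent_card[OF assms] by (intro card_subset_eq) auto
  then show ?thesis using assms unfolding triples_def nonconcurrent_def by blast
qed

text \<open>Every line after the first three costs \<open>k + 2\<close> conditions in degree \<open>k + 1\<close>, less one for each triple point that it
creates.\<close>

lemma dim_D:
  assumes "nonconcurrent {a, l, m}" "finite F" "F \<inter> {a, l, m} = {}" "arr (F \<union> {a, l, m})" "card F \<le> Suc k"
  shows "cV.dim (D (Suc k) (F \<union> {a, l, m})) + card F * (k + 2) = 3 * cS.dim (HS k) + card (triples (F \<union> {a, l, m}))"
  using assms(2-5)
proof (induction F rule: finite_induct)
  case empty
  obtain v u w where "frame a v l m u w" using frame_of_nonconcurrent[OF assms(1)] by blast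
  then show ?case using frame.dim_D_frame triples_nonconcurrent[OF assms(1)] by simp
next
  case (insert b F)
  let ?A = "F \<union> {a, l, m}"
  have arr: "arr (insert b ?A)" using insert.prems(2) by (simp only: Un_insert_left)
  have b: "b \<notin> ?A" using insert by auto
  have arrA: "arr ?A" using arr_subset[OF arr] by blast
  obtain v l' m' u w where "arr_frame b v l' m' u w ?A" using arr_frame_exists[OF arr b] by blast
  then interpret arr_frame b v l' m' u w ?A .
  have "nonconcurrent ?A" using nonconcurrent_mono[OF assms(1)] by blast
  then have pts: "card points \<ge> 2" by (rule card_points_ge_2)
  have "card ?A \<le> card F + 3" using card_Un_le[of F "{a, l, m}"] nonconcurrent_card[OF assms(1)] by simp
  then have c: "card ?A \<le> Suc k + 2" using insert by simp
  have IH: "cV.dim (D (Suc k) ?A) + card F * (k + 2) = 3 * cS.dim (HS k) + card (triples ?A)"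
    using insert.IH insert.prems insert.hyps arrA by simp
  have "cV.dim (D (Suc k) (insert b ?A)) + card (insert b F) * (k + 2) = 3 * cS.dim (HS k) + card (triples (insert b ?A))"
    using IH dim_D_insert[OF pts c] card_triples_insert insert.hyps by simp
  then show ?case by (simp only: Un_insert_left)
qed

section \<open>Vanishing of derivations of low degree\<close>

text \<open>The degree of \<open>q\<close> is left open, since for \<open>k = 0\<close> the only possibility is \<open>q = 0\<close>.\<close>

definition only_Euler :: "nat \<Rightarrow> (complex^3) set \<Rightarrow> bool" where
  "only_Euler k A \<longleftrightarrow> (\<forall>\<theta>\<in>D k A. \<exists>q. \<theta> = q *s Euler)"

abbreviation triples_through :: "(complex^3) set \<Rightarrow> complex^3 \<Rightarrow> nat" where
  "triples_through A a \<equiv> card {X \<in> triples A. a \<in> X}"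

lemma sum_triples_through:
  assumes "finite A" shows "(\<Sum>a\<in>A. triples_through A a) = 3 * card (triples A)"
proof -
  have fT: "finite (triples A)" using finite_triples[OF assms] .
  have "(\<Sum>a\<in>A. triples_through A a) = (\<Sum>a\<in>A. \<Sum>X\<in>triples A. if a \<in> X then 1 else 0)"
    using fT by (simp add: sum.If_cases Int_def)
  also have "\<dots> = (\<Sum>X\<in>triples A. \<Sum>a\<in>A. if a \<in> X then 1 else 0)" by (rule sum.swap)
  also have "\<dots> = (\<Sum>X\<in>triples A. 3)"
  proof (rule sum.cong[OF refl])
    fix X assume "X \<in> triples A"
    then have "A \<inter> X = X" "card X = 3" by (auto simp: triples_def)
    then show "(\<Sum>a\<in>A. if a \<in> X then 1 else 0) = (3::nat)"
      using assms by (simp add: sum.If_cases)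
  qed
  finally show ?thesis by simp
qed

lemma ev_scale: "homogeneous k p \<Longrightarrow> ev (c *s x) p = c ^ k * ev x p"
proof (induction k arbitrary: p)
  case 0
  then obtain b where "p = const_poly b" using homogeneous_0_const by blast
  then show ?case by (simp add: ev.sub_const)
next
  case (Suc k)
  obtain q where q: "\<And>i. homogeneous k (q i)" "p = (\<Sum>i\<in>UNIV. Xv i * q i)"
    using homogeneous_Suc_decomp[OF Suc.prems] by blast
  show ?case unfolding q(2)
    by (simp add: sum_3 ev.sub_add ev.sub_mult ev.sub_X Suc.IH[OF q(1)] algebra_simps)
qed

lemma evv_scale: "homogeneous_triple k \<theta> \<Longrightarrow> evv (c *s x) \<theta> = c ^ k *s evv x \<theta>"
  by (simp add: evv_def vec_eq_iff homogeneous_triple_def ev_scale)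

text \<open>A constant vector field that is tangent to four or more lines would be a point common to all of them.\<close>

lemma only_Euler_0:
  assumes "arr A" "card A \<ge> 4" shows "only_Euler 0 A"
  unfolding only_Euler_def
proof
  fix \<theta> assume \<theta>: "\<theta> \<in> D 0 A"
  then have "\<forall>i. \<exists>c. \<theta> $ i = const_poly c"
    using homogeneous_0_const by (auto simp: D_def homogeneous_triple_def)
  then obtain c where c: "\<And>i. \<theta> $ i = const_poly (c i)" by metis
  define x where "x = (\<chi> i. c i)"
  have e: "\<theta> = cvec x" by (simp add: cvec_def x_def c vec_eq_iff)
  have "dot b x = 0" if b: "b \<in> A" for b
  proof -
    obtain h where "app b \<theta> = lf b * h" using \<theta> b by (auto simp: D_def)
    then have "ev 0 (const_poly (dot b x)) = ev 0 (lf b) * ev 0 h" by (simp add: e app_cvec flip: ev.sub_mult)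
    moreover have "ev 0 (lf b) = 0" using eval_lf[of b 0] by (simp add: eval_poly_ev)
    ultimately show ?thesis by (simp add: ev.sub_const)
  qed
  then have "{a \<in> A. dot a x = 0} = A" by blast
  then have "x = 0" using assms unfolding arr_def by force
  then have "\<theta> = 0 *s Euler" by (simp add: e cvec_def vec_eq_iff)
  then show "\<exists>q. \<theta> = q *s Euler" by blast
qed

lemma card_triples_mono: "finite A \<Longrightarrow> B \<subseteq> A \<Longrightarrow> card (triples B) \<le> card (triples A)"
  by (intro card_mono finite_triples) (auto simp: triples_def)

lemma arr_frame_at:
  assumes "arr A" "a \<in> A"
  obtains v l m u w where "arr_frame a v l m u w (A - {a})"
  using arr_frame_exists[of a "A - {a}"] assms by (auto simp: insert_absorb)

lemma triples_through_le:
  assumes "arr A" "a \<in> A"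
  shows "2 * triples_through A a < card A"
proof -
  obtain v l m u w where fr: "arr_frame a v l m u w (A - {a})" using arr_frame_at[OF assms] .
  then interpret arr_frame a v l m u w "A - {a}" .
  have iA: "insert a (A - {a}) = A" using assms(2) by blast
  have "card doubles \<le> card points" by (rule card_mono[OF finite_points]) (auto simp: doubles_def)
  moreover have "card doubles = triples_through A a" using card_doubles unfolding iA by simp
  moreover have "card A = Suc (card (A - {a}))"
    using card.remove[of A a] assms by (simp add: arr_def)
  ultimately show ?thesis using card_A by linarith
qed

lemma deletion_at:
  assumes fr: "arr_frame a v l m u w (A - {a})" and aA: "a \<in> A" and T: "only_Euler k (A - {a})"
    and \<theta>: "\<theta> \<in> D (Suc k) A" and B: "arr_frame.tangency l m u w \<theta> = 0"
  shows "\<exists>q. \<theta> = q *s Euler"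
proof -
  interpret arr_frame a v l m u w "A - {a}" by fact
  show ?thesis using deletion[of \<theta> k] \<theta> B T aA by (simp add: only_Euler_def insert_absorb)
qed

text \<open>The line \<open>a\<close> carries \<open>card A - 1 - triples_through A a\<close> points. If these are more than the \<open>k + 2\<close> singularities that a field of
degree \<open>k + 1\<close> may have on it, the field is radial along \<open>a\<close> and \<open>a\<close> can be deleted.\<close>

lemma only_Euler_step:
  assumes "arr A" "a \<in> A" "card A > Suc (Suc (Suc k)) + triples_through A a" "only_Euler k (A - {a})"
  shows "only_Euler (Suc k) A"
  unfolding only_Euler_def
proof
  fix \<theta> assume \<theta>: "\<theta> \<in> D (Suc k) A"
  obtain v l m u w where fr: "arr_frame a v l m u w (A - {a})" using arr_frame_at[OF assms(1,2)] .
  then interpret arr_frame a v l m u w "A - {a}" .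
  have iA: "insert a (A - {a}) = A" using assms(2) by blast
  have "card doubles = triples_through A a" using card_doubles unfolding iA by simp
  moreover have "card (A - {a}) = card A - 1" using assms(2) by simp
  ultimately have "card points > Suc (Suc k)" using card_A assms(3) by simp
  then have "tangency \<theta> = 0" using tangency_0_if_many_points[of \<theta> "Suc k", unfolded iA] \<theta> by simp
  then show "\<exists>q. \<theta> = q *s Euler" using deletion_at[OF fr assms(2,4) \<theta>] by blast
qed

text \<open>With at most three triple points some line contains at most one of them, and this line can be deleted.\<close>

lemma only_Euler_few_triples:
  assumes "arr A" "card A = k + 4" "card (triples A) \<le> 3"
  shows "only_Euler k A"
  using assms
proof (induction k arbitrary: A)
  case 0
  then show ?case using only_Euler_0 by simp
next
  case (Suc k)
  have fA: "finite A" using Suc.prems by (simp add: arr_def)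
  have "\<exists>a\<in>A. triples_through A a \<le> 1"
  proof (rule ccontr)
    assume "\<not> ?thesis"
    then have "(\<Sum>a\<in>A. 2) \<le> (\<Sum>a\<in>A. triples_through A a)" by (intro sum_mono) auto
    then show False using sum_triples_through[OF fA] Suc.prems by simp
  qed
  then obtain a where a: "a \<in> A" "triples_through A a \<le> 1" by blast
  have "card (triples (A - {a})) \<le> 3"
    using card_triples_mono[OF fA, of "A - {a}"] Suc.prems by auto
  then have "only_Euler k (A - {a})"
    using Suc.IH[of "A - {a}"] Suc.prems a arr_subset[of A "A - {a}"] by auto
  then show ?case using only_Euler_step[of A a k] Suc.prems a by simp
qed

section \<open>The Camacho-Sad sum along an invariant line\<close>

context arr_frame
begin

lemma evv_pt:
  assumes "\<theta> \<in> D k (insert a A)" "s \<in> points"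
  shows "evv (pt s) \<theta> = poly (R (app l \<theta>)) s *s pt s"
proof -
  let ?y = "evv (pt s) \<theta>"
  have "dot a ?y = 0" using assms(1) D_insert by (auto simp: dot_evv simp flip: poly_res_ev)
  moreover have "dot l ?y = poly (R (app l \<theta>)) s" by (simp add: dot_evv poly_res_ev)
  moreover have "dot m ?y = s * poly (R (app l \<theta>)) s"
    using tangency_points[OF assms] by (simp add: dot_evv poly_res_ev tangency_def)
  ultimately have "?y = poly (R (app l \<theta>)) s *s u + (s * poly (R (app l \<theta>)) s) *s w"
    using expand[of ?y] by simp
  then show ?thesis by (simp add: vec_eq_iff algebra_simps)
qed

lemma R_quotient:
  assumes "\<theta> \<in> D k (insert a A)" "b \<in> A" "app b \<theta> = lf b * h"
  shows "tangency \<theta> = [:- par b, 1:] * (R h - R (app l \<theta>))"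
proof -
  have "smult (dot b w) (R (app m \<theta>) - smult (par b) (R (app l \<theta>))) = smult (dot b w) ([:- par b, 1:] * R h)"
  proof -
    have "R (app b \<theta>) = smult (dot b w) ([:- par b, 1:] * R h)"
      by (simp only: assms(3) res.sub_mult R_lf_A[OF assms(2)] mult_smult_left)
    then show ?thesis using R_app_on_line[OF assms(1,2)] by simp
  qed
  then have "R (app m \<theta>) - smult (par b) (R (app l \<theta>)) = [:- par b, 1:] * R h"
    using generic[OF assms(2)] by (metis smult_cancel)
  then show ?thesis by (simp add: tangency_def algebra_simps)
qed

text \<open>For a line \<open>b\<close> put \<open>h b = \<theta>(b) / b\<close>. At a singularity on \<open>a\<close> the field is \<open>\<epsilon>\<close> times the radial field, where \<open>\<epsilon>\<close> is the value of
\<open>\<theta>(l)\<close>. The local eigenvalue of the foliation transverse to \<open>a\<close> is \<open>h a - \<epsilon>\<close>. If \<open>b\<close> is another line through the point, the eigenvalue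
along \<open>a\<close> is \<open>h b - \<epsilon>\<close>. Their quotient is the Camacho-Sad index, and the indices sum up to \<open>1\<close>,
provided that the \<open>k + 2\<close> points of the arrangement are all the singularities on the line. The proof applies
\<open>lagrange_lead_coeff\<close> to \<open>h a - \<theta>(l)\<close> and the polynomial \<open>tangency\<close>.\<close>

lemma camacho_sad:
  assumes \<theta>: "\<theta> \<in> D (Suc k) (insert a A)" and B0: "tangency \<theta> \<noteq> 0" and pts: "card points = Suc (Suc k)"
    and h: "\<And>b. b \<in> insert a A \<Longrightarrow> app b \<theta> = lf b * h b \<and> homogeneous k (h b)"
  shows "\<exists>N. (\<forall>b\<in>A. ev (pt (par b)) (h b) - poly (R (app l \<theta>)) (par b) = N (par b)) \<and>
     (\<forall>s\<in>points. N s \<noteq> 0) \<and>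
     (\<Sum>s\<in>points. (ev (pt s) (h a) - poly (R (app l \<theta>)) s) / N s) = 1"
proof -
  define \<alpha> where "\<alpha> = R (app l \<theta>)"
  define P where "P = (\<Prod>s\<in>points. [:- s, 1::complex:])"
  have dP: "degree P = Suc (Suc k)"
    unfolding P_def using degree_prod_linear[OF finite_points, of "\<lambda>s. s"] pts by simp
  have "P dvd tangency \<theta>" unfolding P_def using prod_linear_dvd[OF finite_points] tangency_points[OF \<theta>] by blast
  then obtain C where C: "tangency \<theta> = P * C" by blast
  have "degree P + degree C = degree (tangency \<theta>)" using B0 C by (simp add: degree_mult_eq)
  then have "degree C = 0" using degree_tangency[OF \<theta>] dP by simp
  then obtain c where c: "C = [:c:]" by (meson degree_eq_zeroE)
  have c0: "c \<noteq> 0" using B0 C c by auto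
  have BP: "tangency \<theta> = smult c P" using C c by simp
  have d\<alpha>: "degree \<alpha> \<le> Suc k" and d\<beta>: "degree (R (app m \<theta>)) \<le> Suc k"
    unfolding \<alpha>_def by (rule R_app_degree[OF \<theta>])+
  have "lead_coeff P = 1" unfolding P_def by (rule lead_coeff_prod_linear)
  then have "coeff (tangency \<theta>) (Suc (Suc k)) = c" using BP dP by simp
  moreover have "coeff (tangency \<theta>) (Suc (Suc k)) = - coeff \<alpha> (Suc k)"
    using d\<beta> by (simp add: tangency_def \<alpha>_def coeff_eq_0)
  \<comment> \<open>the leading coefficients of \<open>tangency\<close> and of \<open>H\<close> both come from \<open>- t \<theta>(l)\<close> and \<open>- \<theta>(l)\<close>: this makes the sum equal to \<open>1\<close>\<close>
  ultimately have c\<alpha>: "c = - coeff \<alpha> (Suc k)" by simp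
  define H where "H = R (h a) - \<alpha>"
  have dh: "degree (R (h a)) \<le> k" using degree_res h by blast
  then have dH: "degree H \<le> Suc k" using d\<alpha> unfolding H_def by (intro degree_diff_le) auto
  have cH: "coeff H (Suc k) = c" using dh by (simp add: H_def c\<alpha> coeff_eq_0)
  define N where "N s = c * poly (\<Prod>s'\<in>points - {s}. [:- s', 1:]) s" for s
  have "ev (pt (par b)) (h b) - poly \<alpha> (par b) = N (par b)" if b: "b \<in> A" for b
  proof -
    have bp: "par b \<in> points" using b by (simp add: points_def)
    have "tangency \<theta> = [:- par b, 1:] * (R (h b) - \<alpha>)" unfolding \<alpha>_def using R_quotient[OF \<theta> b] h b by blast
    moreover have "P = [:- par b, 1:] * (\<Prod>s'\<in>points - {par b}. [:- s', 1:])"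
      unfolding P_def by (rule prod.remove[OF finite_points bp])
    ultimately have "[:- par b, 1:] * (R (h b) - \<alpha>) = [:- par b, 1:] * smult c (\<Prod>s'\<in>points - {par b}. [:- s', 1:])"
      using BP by (metis mult_smult_right)
    then have "R (h b) - \<alpha> = smult c (\<Prod>s'\<in>points - {par b}. [:- s', 1:])" by (subst (asm) mult_left_cancel) auto
    then have "poly (R (h b) - \<alpha>) (par b) = N (par b)" by (simp add: N_def)
    then show ?thesis by (simp add: poly_res_ev)
  qed
  moreover have N0: "N s \<noteq> 0" if "s \<in> points" for s
    using c0 finite_points by (auto simp: N_def poly_prod)
  moreover have "(\<Sum>s\<in>points. (ev (pt s) (h a) - poly \<alpha> s) / N s) = 1"
  proof -
    have "c = (\<Sum>s\<in>points. poly H s / poly (\<Prod>s'\<in>points - {s}. [:- s', 1:]) s)"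
      using lagrange_lead_coeff[OF finite_points pts dH] cH by simp
    also have "\<dots> = (\<Sum>s\<in>points. c * (poly H s / N s))"
      by (rule sum.cong) (use c0 in \<open>auto simp: N_def\<close>)
    also have "\<dots> = c * (\<Sum>s\<in>points. poly H s / N s)" by (simp add: sum_distrib_left)
    finally have "(\<Sum>s\<in>points. poly H s / N s) = 1" using c0 by simp
    then show ?thesis by (simp add: H_def poly_res_ev)
  qed
  ultimately show ?thesis unfolding \<alpha>_def by blast
qed

end

text \<open>Along \<open>a\<close> the polynomial \<open>tangency\<close> equals \<open>(t - par b) (h b - \<theta>(l))\<close> for every other line \<open>b\<close>. For two lines through the same
point of \<open>a\<close> the first factors agree, hence so do the second ones.\<close>

lemma quotient_eq_at_triple_point:
  assumes A: "arr A" and \<theta>: "\<theta> \<in> D (Suc k) A" and abc: "a \<in> A" "b \<in> A" "c \<in> A" "a \<noteq> b" "a \<noteq> c"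
    and x0: "x \<noteq> 0" and x: "dot a x = 0" "dot b x = 0" "dot c x = 0"
    and h: "app b \<theta> = lf b * hb" "app c \<theta> = lf c * hc" "homogeneous k hb" "homogeneous k hc"
  shows "ev x hb = ev x hc"
proof -
  obtain v l m u w where fr: "arr_frame a v l m u w (A - {a})" using arr_frame_at[OF A abc(1)] .
  then interpret arr_frame a v l m u w "A - {a}" .
  have iA: "insert a (A - {a}) = A" using abc(1) by blast
  have bA: "b \<in> A - {a}" "c \<in> A - {a}" using abc by auto
  have xb: "x = dot l x *s pt (par b)" using on_line_point[OF x(1,2) bA(1)] .
  have xc: "x = dot l x *s pt (par c)" using on_line_point[OF x(1,3) bA(2)] .
  have "dot l x \<noteq> 0" using xb x0 by (metis vector_smult_lzero)
  moreover have "dot m x = dot l x * par b" by (subst xb) (simp add: dot_add dot_scale)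
  moreover have "dot m x = dot l x * par c" by (subst xc) (simp add: dot_add dot_scale)
  ultimately have pp: "par b = par c" by simp
  have "[:- par b, 1:] * (R hb - R (app l \<theta>)) = [:- par b, 1:] * (R hc - R (app l \<theta>))"
    using R_quotient[of \<theta> "Suc k" b hb, unfolded iA, OF \<theta> bA(1) h(1)]
      R_quotient[of \<theta> "Suc k" c hc, unfolded iA, OF \<theta> bA(2) h(2)] pp by metis
  then have "R hb - R (app l \<theta>) = R hc - R (app l \<theta>)" by (subst (asm) mult_left_cancel) auto
  then have "R hb = R hc" by simp
  then have "ev (pt (par b)) hb = ev (pt (par b)) hc" by (simp flip: poly_res_ev)
  then show ?thesis by (subst (1 2) xb) (simp only: ev_scale[OF h(3)] ev_scale[OF h(4)])
qed

text \<open>A field that survives although every line carries three triple points. At a triple point the index is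
\<open>1\<close>, so the remaining points must contribute \<open>- 2\<close>. For seven lines (\<open>k = 1\<close>) there are none. For eight lines
there is just one double point on each line, and the index there is \<open>- 2\<close>.\<close>

lemma camacho_sad_at_simple_point:
  assumes A: "arr A" and \<theta>: "\<theta> \<in> D (Suc k) A" and nt: "\<nexists>q. \<theta> = q *s Euler"
    and T: "\<And>a. a \<in> A \<Longrightarrow> only_Euler k (A - {a})"
    and h: "\<And>b. b \<in> A \<Longrightarrow> app b \<theta> = lf b * h b \<and> homogeneous k (h b)"
    and three: "\<And>a. a \<in> A \<Longrightarrow> triples_through A a = 3" and cA: "card A = k + 6" and k: "k = 1 \<or> k = 2"
    and a: "a \<in> A"
  shows "k = 2" 
    and "\<exists>b\<in>A. \<exists>x. b \<noteq> a \<and> x \<noteq> 0 \<and> dot a x = 0 \<and> dot b x = 0 \<and> (\<forall>c\<in>A. dot c x = 0 \<longrightarrow> c = a \<or> c = b)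
       \<and> (\<exists>\<epsilon>. evv x \<theta> = \<epsilon> *s x)"
    and "\<And>b x \<epsilon>. b \<in> A \<Longrightarrow> b \<noteq> a \<Longrightarrow> x \<noteq> 0 \<Longrightarrow> dot a x = 0 \<Longrightarrow> dot b x = 0 \<Longrightarrow>
      (\<And>c. c \<in> A \<Longrightarrow> dot c x = 0 \<Longrightarrow> c = a \<or> c = b) \<Longrightarrow> evv x \<theta> = \<epsilon> *s x \<Longrightarrow>
      ev x (h b) - \<epsilon> \<noteq> 0 \<and> ev x (h a) - \<epsilon> = - 2 * (ev x (h b) - \<epsilon>)"
proof -
  obtain v l m u w where fr: "arr_frame a v l m u w (A - {a})" using arr_frame_at[OF A a] .
  then interpret arr_frame a v l m u w "A - {a}" .
  have iA: "insert a (A - {a}) = A" using a by blast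
  have cd: "card doubles = 3" using card_doubles three[OF a] unfolding iA by simp
  have "card (A - {a}) = k + 5" using cA a by simp
  then have cp: "card points = Suc (Suc k)" using card_A cd by simp
  have B0: "tangency \<theta> \<noteq> 0" using deletion_at[OF fr a T[OF a] \<theta>] nt by blast
  have \<theta>': "\<theta> \<in> D (Suc k) (insert a (A - {a}))" using \<theta> unfolding iA .
  define \<alpha> where "\<alpha> = poly (R (app l \<theta>))"
  obtain N where N: "\<And>b. b \<in> A - {a} \<Longrightarrow> ev (pt (par b)) (h b) - \<alpha> (par b) = N (par b)"
    "\<And>s. s \<in> points \<Longrightarrow> N s \<noteq> 0"
    "(\<Sum>s\<in>points. (ev (pt s) (h a) - \<alpha> s) / N s) = 1"
    using camacho_sad[OF \<theta>' B0 cp, of h] h unfolding iA \<alpha>_def by blast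
  have sub: "doubles \<subseteq> points" by (auto simp: doubles_def)
  have dbl: "(ev (pt s) (h a) - \<alpha> s) / N s = 1" if s: "s \<in> doubles" for s
  proof -
    have "card (fiber s) = 2" using s by (simp add: doubles_def)
    then obtain b c where bc: "fiber s = {b, c}" "b \<noteq> c" by (auto simp: card_2_iff)
    then have b: "b \<in> A - {a}" "par b = s" and c: "c \<in> A - {a}" "par c = s" by (auto simp: fiber_def)
    have "ev (pt s) (h a) = ev (pt s) (h b)"
      using quotient_eq_at_triple_point[OF A \<theta>, of c a b "pt s" "h a" "h b"] b c bc(2) a h pt_neq_0
        dot_pt_0[OF b(1), of s] dot_pt_0[OF c(1), of s] by auto
    then show ?thesis using N(1)[OF b(1)] N(2)[of s] sub s b(2) by auto
  qed
  have "(\<Sum>s\<in>points. (ev (pt s) (h a) - \<alpha> s) / N s)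
     = (\<Sum>s\<in>points - doubles. (ev (pt s) (h a) - \<alpha> s) / N s) + (\<Sum>s\<in>doubles. (ev (pt s) (h a) - \<alpha> s) / N s)"
    by (rule sum.subset_diff[OF sub finite_points])
  moreover have "(\<Sum>s\<in>doubles. (ev (pt s) (h a) - \<alpha> s) / N s) = 3" using dbl cd by simp
  ultimately have "(\<Sum>s\<in>points - doubles. (ev (pt s) (h a) - \<alpha> s) / N s) = 1 - 3"
    using N(3) unfolding eq_diff_eq by argo
  then have rest: "(\<Sum>s\<in>points - doubles. (ev (pt s) (h a) - \<alpha> s) / N s) = - 2" by simp
  have cs: "card (points - doubles) = k - 1" using card_Diff_subset[OF finite_doubles sub] cp cd by simp
  show k2: "k = 2"
  proof (rule ccontr)
    assume "k \<noteq> 2"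
    then have "points - doubles = {}" using k cs finite_points by (metis card_eq_0_iff diff_self_eq_0 finite_Diff)
    then have "(\<Sum>s\<in>points - doubles. (ev (pt s) (h a) - \<alpha> s) / N s) = 0" by (simp only: sum.empty)
    with rest show False by simp
  qed
  then obtain s0 where s0: "points - doubles = {s0}" using cs by (auto simp: card_1_singleton_iff)
  then have s0p: "s0 \<in> points" "s0 \<notin> doubles" by auto
  have ratio: "(ev (pt s0) (h a) - \<alpha> s0) / N s0 = - 2" using rest unfolding s0 by simp
  obtain b0 where b0: "b0 \<in> A - {a}" "s0 = par b0" using s0p by (auto simp: points_def)
  have "card (fiber s0) = 1" using card_fiber[OF s0p(1)] s0p(2) by simp
  then obtain z where z: "fiber s0 = {z}" by (rule card_1_singletonE)
  moreover have "b0 \<in> fiber s0" using b0 by (simp add: fiber_def)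
  ultimately have f0: "fiber s0 = {b0}" by simp
  have ev0: "evv (pt s0) \<theta> = \<alpha> s0 *s pt s0" unfolding \<alpha>_def by (rule evv_pt[OF \<theta>' s0p(1)])
  have only: "c = a \<or> c = b0" if "c \<in> A" "dot c (pt s0) = 0" for c
    using that f0 dot_pt_0[of c s0] by (auto simp: fiber_def)
  show "\<exists>b\<in>A. \<exists>x. b \<noteq> a \<and> x \<noteq> 0 \<and> dot a x = 0 \<and> dot b x = 0 \<and> (\<forall>c\<in>A. dot c x = 0 \<longrightarrow> c = a \<or> c = b)
       \<and> (\<exists>\<epsilon>. evv x \<theta> = \<epsilon> *s x)"
    using b0 dot_pt_0[OF b0(1), of s0] pt_neq_0[of s0] only ev0
    by (intro bexI[of _ b0] exI[of _ "pt s0"]) auto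
  fix b x \<epsilon> assume b: "b \<in> A" "b \<noteq> a" and x: "x \<noteq> 0" "dot a x = 0" "dot b x = 0"
    and ob: "\<And>c. c \<in> A \<Longrightarrow> dot c x = 0 \<Longrightarrow> c = a \<or> c = b" and e: "evv x \<theta> = \<epsilon> *s x"
  have bA: "b \<in> A - {a}" using b by blast
  have xb: "x = dot l x *s pt (par b)" using on_line_point[OF x(2,3) bA] .
  \<comment> \<open>the given representative of the point is a multiple of the parametrised one; both sides scale by \<open>t ^ k\<close>\<close>
  define t where "t = dot l x"
  have t0: "t \<noteq> 0" using xb x(1) unfolding t_def by (metis vector_smult_lzero)
  have xt: "x = t *s pt (par b)" using xb by (simp add: t_def)
  have "fiber (par b) \<subseteq> {b}"
  proof
    fix c assume "c \<in> fiber (par b)"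
    then have c: "c \<in> A - {a}" "dot c (pt (par b)) = 0" using dot_pt_0 by (auto simp: fiber_def)
    then have "dot c x = 0" by (subst xt) (simp only: dot_scale, simp)
    then show "c \<in> {b}" using ob c by auto
  qed
  then have "card (fiber (par b)) \<le> 1" using card_mono[of "{b}" "fiber (par b)"] by simp
  then have "par b \<notin> doubles" by (auto simp: doubles_def)
  then have pb: "par b = s0" using s0 bA by (auto simp: points_def)
  have "t ^ Suc k *s evv (pt s0) \<theta> = \<epsilon> *s (t *s pt s0)"
    using evv_scale[of "Suc k" \<theta> t "pt s0"] \<theta> e xt pb by (simp add: D_def)
  then have "(t * (t ^ k * \<alpha> s0)) *s pt s0 = (t * \<epsilon>) *s pt s0"
    unfolding ev0 by (simp only: vector_smult_assoc power_Suc mult_ac)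
  then have "dot l ((t * (t ^ k * \<alpha> s0)) *s pt s0) = dot l ((t * \<epsilon>) *s pt s0)" by (rule arg_cong)
  moreover have "dot l (pt s0) = 1" by (simp add: dot_add dot_scale)
  ultimately have "t * (t ^ k * \<alpha> s0) = t * \<epsilon>" by (simp only: dot_scale mult_1_right)
  then have \<epsilon>: "\<epsilon> = t ^ k * \<alpha> s0" using t0 by simp
  have sc: "ev x (h c) = t ^ k * ev (pt s0) (h c)" if "c \<in> A" for c
    using h[OF that] pb by (subst xt) (simp only: ev_scale)
  have "ev x (h b) - \<epsilon> = t ^ k * N s0" using N(1)[OF bA] sc[OF b(1)] pb by (simp add: \<epsilon> algebra_simps)
  moreover have "ev x (h a) - \<epsilon> = t ^ k * (- 2 * N s0)"
  proof -
    have "ev (pt s0) (h a) - \<alpha> s0 = - 2 * N s0" using ratio N(2)[OF s0p(1)] by (simp only: divide_eq_eq) simp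
    then show ?thesis unfolding sc[OF a] \<epsilon> right_diff_distrib[symmetric] by simp
  qed
  ultimately show "ev x (h b) - \<epsilon> \<noteq> 0 \<and> ev x (h a) - \<epsilon> = - 2 * (ev x (h b) - \<epsilon>)"
    using t0 N(2)[OF s0p(1)] by simp
qed

text \<open>A line with fewer than three triple points can be deleted. Otherwise all lines carry exactly three, there are
seven or eight lines, and the indices are as described above. At the double point of two lines the two
indices are inverse to each other, whereas both would have to be \<open>- 2\<close>.\<close>

lemma only_Euler_low_degree:
  assumes "arr A" "card A = k + 5" "k \<le> 3"
  shows "only_Euler k A"
  using assms
proof (induction k arbitrary: A)
  case 0
  then show ?case using only_Euler_0 by simp
next
  case (Suc k)
  have fA: "finite A" using Suc.prems by (simp add: arr_def)
  have IH: "only_Euler k (A - {a})" if "a \<in> A" for a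
    using Suc.IH[of "A - {a}"] Suc.prems that arr_subset[of A "A - {a}"] by auto
  show ?case
  proof (cases "\<exists>a\<in>A. triples_through A a < 3")
    case True
    then obtain a where a: "a \<in> A" "triples_through A a < 3" by blast
    then show ?thesis using only_Euler_step[of A a k] Suc.prems IH by simp
  next
    case False
    have le: "2 * triples_through A a \<le> k + 5" if "a \<in> A" for a
      using triples_through_le[OF Suc.prems(1) that] Suc.prems(2) by simp
    have three: "triples_through A a = 3" if "a \<in> A" for a
      using le[OF that] False Suc.prems(3) that by force
    have "A \<noteq> {}" using Suc.prems by auto
    then obtain a where a: "a \<in> A" by blast
    have k: "k = 1 \<or> k = 2" using le[OF a] three[OF a] Suc.prems(3) by auto
    show ?thesis
      unfolding only_Euler_def
    proof (rule ballI, rule ccontr)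
      fix \<theta> assume \<theta>: "\<theta> \<in> D (Suc k) A" and nt: "\<nexists>q. \<theta> = q *s Euler"
      have "\<exists>h. app b \<theta> = lf b * h \<and> homogeneous k h" if "b \<in> A" for b
        using quotient_exists[OF Suc.prems(1) \<theta> that] .
      then obtain h where h: "\<And>b. b \<in> A \<Longrightarrow> app b \<theta> = lf b * h b \<and> homogeneous k (h b)" by metis
      have cA: "card A = k + 6" using Suc.prems by simp
      note cs = camacho_sad_at_simple_point[OF Suc.prems(1) \<theta> nt IH h three cA k]
      obtain b x \<epsilon> where bx: "b \<in> A" "b \<noteq> a" "x \<noteq> 0" "dot a x = 0" "dot b x = 0"
        "\<forall>c\<in>A. dot c x = 0 \<longrightarrow> c = a \<or> c = b" "evv x \<theta> = \<epsilon> *s x"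
        using cs(2)[OF _ _ _ a] by blast
      have 1: "ev x (h b) - \<epsilon> \<noteq> 0 \<and> ev x (h a) - \<epsilon> = - 2 * (ev x (h b) - \<epsilon>)"
        by (rule cs(3)[OF _ _ _ a bx(1-5) _ bx(7)]) (use bx(6) in auto)
      have 2: "ev x (h a) - \<epsilon> \<noteq> 0 \<and> ev x (h b) - \<epsilon> = - 2 * (ev x (h a) - \<epsilon>)"
        by (rule cs(3)[OF _ _ _ bx(1) a bx(2)[symmetric] bx(3,5,4) _ bx(7)]) (use bx(6) in auto)
      have "y = 0" if "y = - 2 * z" "z = - 2 * y" for y z :: complex
        using that by simp
      then show False using 1 2 by blast
    qed
  qed
qed

section \<open>Jacobian relations and logarithmic derivations\<close>

definition der :: "poly3^3 \<Rightarrow> poly3 \<Rightarrow> poly3" where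
  "der \<theta> p = (\<Sum>i\<in>UNIV. \<theta> $ i * partial i p)"

lemma AR_der: "AR f = {\<theta>. der \<theta> f = 0}"
  by (simp add: AR_def der_def sum_3)

lemma der_mult: "der \<theta> (p * q) = der \<theta> p * q + p * der \<theta> q"
  by (simp add: der_def sum_3 partial_mult algebra_simps)

lemma der_vec: "der (x + y) p = der x p + der y p" "der (q *s x) p = q * der x p" "der 0 p = 0"
  by (simp_all add: der_def sum_3 algebra_simps)

lemma der_lf: "der \<theta> (lf a) = app a \<theta>"
proof -
  have "partial i (\<Sum>j\<in>UNIV. const_poly (a $ j) * Xv j) = const_poly (a $ i)" for i
    using exhaust_3[of i] by (auto simp: sum_3 partial_add partial_mult partial_const partial_Xv)
  then show ?thesis by (simp add: der_def lf_def app_def mult.commute)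
qed

text \<open>The defining polynomial of the arrangement.\<close>

definition F :: "(complex^3) set \<Rightarrow> poly3" where "F A = (\<Prod>a\<in>A. lf a)"

lemma der_F: "finite A \<Longrightarrow> der \<theta> (F A) = (\<Sum>a\<in>A. app a \<theta> * F (A - {a}))"
proof (induction A rule: finite_induct)
  case empty
  have "partial i 1 = 0" for i using partial_const[of i 1] by simp
  then show ?case by (simp add: F_def der_def)
next
  case (insert b A)
  have "(\<Sum>a\<in>A. app a \<theta> * F (insert b A - {a})) = (\<Sum>a\<in>A. lf b * (app a \<theta> * F (A - {a})))"
  proof (rule sum.cong[OF refl])
    fix a assume a: "a \<in> A"
    then have "insert b A - {a} = insert b (A - {a})" using insert.hyps by auto
    then show "app a \<theta> * F (insert b A - {a}) = lf b * (app a \<theta> * F (A - {a}))"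
      using insert.hyps by (simp add: F_def mult.left_commute)
  qed
  moreover have "F (insert b A) = lf b * F A" using insert.hyps by (simp add: F_def)
  moreover have "insert b A - {b} = A" using insert.hyps by auto
  ultimately show ?case using insert by (simp add: der_mult der_lf sum_distrib_left)
qed

lemma F_neq_0: "arr A \<Longrightarrow> F A \<noteq> 0"
  by (auto simp: F_def arr_def lf_eq_0_iff)

lemma homogeneous_F: "finite A \<Longrightarrow> homogeneous (card A) (F A)"
  unfolding F_def by (rule homogeneous_prod) auto

lemma lf_not_dvd_F:
  assumes "arr (insert a B)" "a \<notin> B" shows "\<not> lf a dvd F B"
proof -
  have a0: "a \<noteq> 0" using assms by (auto simp: arr_def)
  have "finite B" using assms by (simp add: arr_def)
  then show ?thesis using assms
  proof (induction B rule: finite_induct)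
    case empty
    have "\<not> lf a dvd 1"
    proof
      assume "lf a dvd 1"
      then obtain q where "lf a * q = 1" by (metis dvdE)
      then have "ev 0 (lf a) * ev 0 q = 1" by (simp flip: ev.sub_mult)
      moreover have "ev 0 (lf a) = 0" using eval_lf[of a 0] by (simp add: eval_poly_ev)
      ultimately show False by simp
    qed
    then show ?case by (simp add: F_def)
  next
    case (insert b B)
    have "\<not> lf a dvd F B" using insert arr_subset[of "insert a (insert b B)" "insert a B"] by auto
    moreover have "\<not> lf a dvd lf b"
      using lf_dvd_lf[OF a0] insert.prems unfolding arr_def by (metis insertCI)
    moreover have "F (insert b B) = lf b * F B" using insert.hyps by (simp add: F_def)
    ultimately show ?case using lf_prime[OF a0 homogeneous_lf homogeneous_F[OF insert.hyps(1)]] by metis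
  qed
qed

text \<open>By the product rule \<open>\<theta>(f) = 0\<close> shows that \<open>a\<close> divides \<open>\<theta>(a)\<close> times the product of the other
linear forms, and \<open>a\<close> is prime.\<close>

lemma AR_subset_D:
  assumes "arr A" "\<theta> \<in> AR (F A)" "homogeneous_triple k \<theta>"
  shows "\<theta> \<in> D k A"
proof -
  have fA: "finite A" using assms(1) by (simp add: arr_def)
  have "lf a dvd app a \<theta>" if a: "a \<in> A" for a
  proof -
    have "app a \<theta> * F (A - {a}) + (\<Sum>b\<in>A - {a}. app b \<theta> * F (A - {b})) = 0"
      using assms(2) der_F[OF fA, of \<theta>] sum.remove[OF fA a, of "\<lambda>b. app b \<theta> * F (A - {b})"] by (simp add: AR_der)
    then have "app a \<theta> * F (A - {a}) = - (\<Sum>b\<in>A - {a}. app b \<theta> * F (A - {b}))"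
      by (simp only: eq_neg_iff_add_eq_0)
    moreover have "lf a dvd (\<Sum>b\<in>A - {a}. app b \<theta> * F (A - {b}))"
      using a fA by (intro dvd_sum dvd_mult) (auto simp: F_def)
    ultimately have "lf a dvd app a \<theta> * F (A - {a})" by simp
    moreover have "\<not> lf a dvd F (A - {a})" using assms(1) a by (intro lf_not_dvd_F) (auto simp: insert_absorb)
    moreover have "a \<noteq> 0" using assms(1) a by (auto simp: arr_def)
    ultimately show ?thesis
      using lf_prime[of a, OF _ homogeneous_app[OF assms(3)] homogeneous_F] fA by blast
  qed
  then show ?thesis using assms(3) by (simp add: D_def)
qed

lemma der_F_D:
  assumes "arr A" "\<theta> \<in> D (Suc k) A"
  shows "\<exists>q. homogeneous k q \<and> der \<theta> (F A) = F A * q"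
proof -
  have fA: "finite A" using assms(1) by (simp add: arr_def)
  have "\<exists>h. app a \<theta> = lf a * h \<and> homogeneous k h" if "a \<in> A" for a
    using quotient_exists[OF assms that] .
  then obtain h where h: "\<And>a. a \<in> A \<Longrightarrow> app a \<theta> = lf a * h a \<and> homogeneous k (h a)" by metis
  have "der \<theta> (F A) = (\<Sum>a\<in>A. F A * h a)"
    unfolding der_F[OF fA]
  proof (rule sum.cong[OF refl])
    fix a assume a: "a \<in> A"
    have "F A = lf a * F (A - {a})" unfolding F_def by (rule prod.remove[OF fA a])
    then show "app a \<theta> * F (A - {a}) = F A * h a" using h[OF a] by simp
  qed
  also have "\<dots> = F A * (\<Sum>a\<in>A. h a)" by (simp add: sum_distrib_left)
  finally show ?thesis using h by (intro exI[of _ "\<Sum>a\<in>A. h a"] conjI homogeneous_sum) auto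
qed

lemma der_Euler: "finite A \<Longrightarrow> der Euler (F A) = of_nat (card A) * F A"
proof -
  assume fA: "finite A"
  have "der Euler (F A) = (\<Sum>a\<in>A. F A)"
    unfolding der_F[OF fA]
  proof (rule sum.cong[OF refl])
    fix a assume a: "a \<in> A"
    show "app a Euler * F (A - {a}) = F A" unfolding app_Euler F_def by (rule prod.remove[OF fA a, symmetric])
  qed
  then show ?thesis by simp
qed

section \<open>Graded saturated modules\<close>

definition hc :: "nat \<Rightarrow> poly3^3 \<Rightarrow> poly3^3" where
  "hc k \<theta> = (\<chi> i. hcomp k (\<theta> $ i))"

text \<open>The properties of the module of Jacobian relations that enter the estimates: it is a graded submodule of \<open>S\<^sup>3\<close> with
torsion-free quotient.\<close>

locale graded_saturated =
  fixes M :: "(poly3^3) set"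
  assumes M_0: "0 \<in> M" and M_add: "x \<in> M \<Longrightarrow> y \<in> M \<Longrightarrow> x + y \<in> M" and M_smult: "x \<in> M \<Longrightarrow> q *s x \<in> M"
    and M_hc: "x \<in> M \<Longrightarrow> hc k x \<in> M" and M_sat: "q *s x \<in> M \<Longrightarrow> q \<noteq> 0 \<Longrightarrow> x \<in> M"
begin

definition Mk :: "nat \<Rightarrow> (poly3^3) set" where "Mk k = {x \<in> M. homogeneous_triple k x}"

lemma Mk_0: "0 \<in> Mk k" and Mk_add: "x \<in> Mk k \<Longrightarrow> y \<in> Mk k \<Longrightarrow> x + y \<in> Mk k"
  and Mk_cmult: "x \<in> Mk k \<Longrightarrow> const_poly c *s x \<in> Mk k"
  and Mk_smult: "homogeneous j q \<Longrightarrow> x \<in> Mk k \<Longrightarrow> q *s x \<in> Mk (j + k)"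
  by (auto simp: Mk_def M_0 M_add M_smult homogeneous_triple_add homogeneous_triple_cmult homogeneous_triple_smult)

lemma Mk_lf: "x \<in> Mk k \<Longrightarrow> lf a *s x \<in> Mk (Suc k)"
  using Mk_smult[OF homogeneous_lf, of x k a] by simp

lemma subspace_Mk: "cV.subspace (Mk k)"
  by (simp add: cV.subspace_def Mk_0 Mk_add Mk_cmult)

lemma fin_dim_Mk: "cV.fin_dim (Mk k)"
  by (rule cV.fin_dim_subset[OF fin_dim_homogeneous_triple[of k]]) (auto simp: Mk_def)

lemma S1_Mk: "S1 (Mk k) \<subseteq> Mk (Suc k)"
proof
  fix x assume "x \<in> S1 (Mk k)"
  then obtain f where f: "x = (\<Sum>i\<in>UNIV. Xv i *s f i)" "\<forall>i. f i \<in> Mk k" unfolding S1_def by blast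
  have "Xv i *s f i \<in> Mk (Suc k)" for i using Mk_smult[OF homogeneous_Xv, of "f i" k i] f(2) by simp
  then show "x \<in> Mk (Suc k)" unfolding f(1) using Mk_add by (simp add: sum_3)
qed

lemma subspace_S1: "cV.subspace (S1 (Mk k))"
proof -
  have "0 \<in> S1 (Mk k)" by (rule S1_I[of "\<lambda>_. 0"]) (auto simp: Mk_0)
  moreover have "const_poly c *s x \<in> S1 (Mk k)" if "x \<in> S1 (Mk k)" for c x
  proof -
    obtain f where f: "x = (\<Sum>i\<in>UNIV. Xv i *s f i)" "\<forall>i. f i \<in> Mk k" using \<open>x \<in> S1 (Mk k)\<close> unfolding S1_def by blast
    show ?thesis
      by (rule S1_I[of "\<lambda>i. const_poly c *s f i"]) (use f Mk_cmult in \<open>auto simp: sum_3 vec_eq_iff algebra_simps\<close>)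
  qed
  ultimately show ?thesis using S1_add[OF Mk_add] by (simp add: cV.subspace_def)
qed

lemma fin_dim_S1: "cV.fin_dim (S1 (Mk k))" by (rule cV.fin_dim_subset[OF fin_dim_Mk S1_Mk])

lemma dim_lf_Mk:
  assumes "b \<noteq> 0"
  shows "cV.dim ((\<lambda>x. lf b *s x) ` Mk k) = cV.dim (Mk k)"
    "cV.fin_dim ((\<lambda>x. lf b *s x) ` Mk k)" "cV.subspace ((\<lambda>x. lf b *s x) ` Mk k)"
proof -
  show "cV.dim ((\<lambda>x. lf b *s x) ` Mk k) = cV.dim (Mk k)"
    by (rule cVV.dim_image_inj[OF linear_smult subspace_Mk fin_dim_Mk])
      (use assms in \<open>auto simp: vec_eq_iff lf_eq_0_iff\<close>)
qed (rule cVV.rank_nullity(2,3)[OF linear_smult subspace_Mk fin_dim_Mk])+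

end

lemma (in frame) lf_indep_dvd:
  assumes "homogeneous k p" "homogeneous k q" "lf l * p = lf m * q"
  shows "\<exists>r. p = lf m * r \<and> q = lf l * r"
proof -
  have "\<not> lf m dvd lf l"
  proof
    assume "lf m dvd lf l"
    then obtain c where "l = c *s m" using lf_dvd_lf covectors_neq_0 by blast
    then have "dot l u = c * dot m u" by (simp add: dot_scale_left)
    then show False by simp
  qed
  moreover have "lf m dvd lf l * p" using assms(3) by simp
  ultimately have "lf m dvd p" using lf_prime[OF covectors_neq_0(3) homogeneous_lf assms(1)] by blast
  then obtain r where r: "p = lf m * r" by blast
  then have "lf m * (q - lf l * r) = 0" using assms(3)[symmetric] by (simp add: algebra_simps)
  then have "q = lf l * r" using covectors_neq_0 by (simp add: lf_eq_0_iff)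
  then show ?thesis using r by blast
qed

locale graded_frame = graded_saturated M + frame a v l m u w for M a v l m u w
begin

abbreviation im :: "complex^3 \<Rightarrow> nat \<Rightarrow> (poly3^3) set" where "im b k \<equiv> (\<lambda>x. lf b *s x) ` Mk k"

text \<open>The module \<open>S\<^sub>1 M\<^sub>k\<close> is \<open>l M\<^sub>k + m M\<^sub>k + a M\<^sub>k\<close>; its dimension is computed by adding the
summands one after the other. Here \<open>J\<close> is the sum of the first two.\<close>

definition J :: "nat \<Rightarrow> (poly3^3) set" where "J k = {x + y |x y. x \<in> im l k \<and> y \<in> im m k}"

lemma dim_im: "cV.dim (im a k) = cV.dim (Mk k)" "cV.dim (im l k) = cV.dim (Mk k)" "cV.dim (im m k) = cV.dim (Mk k)"
  "cV.fin_dim (im b k)" "cV.subspace (im b k)"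
  using dim_lf_Mk covectors_neq_0 cVV.rank_nullity(2,3)[OF linear_smult subspace_Mk fin_dim_Mk] by blast+

lemma fin_dim_J: "cV.fin_dim (J k)" and subspace_J: "cV.subspace (J k)"
  unfolding J_def using cV.fin_dim_sums[OF dim_im(4,4)] cV.subspace_sums[OF dim_im(5,5)] by blast+

lemma S1_eq: "S1 (Mk k) = {x + y |x y. x \<in> J k \<and> y \<in> im a k}"
proof (intro equalityI subsetI)
  fix x assume "x \<in> S1 (Mk k)"
  then obtain y z t where yzt: "y \<in> Mk k" "z \<in> Mk k" "t \<in> Mk k" "x = lf a *s y + lf l *s z + lf m *s t"
    using S1_frame[OF _ Mk_add Mk_cmult] by metis
  have "x = (lf l *s z + lf m *s t) + lf a *s y" using yzt(4) by (simp add: algebra_simps)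
  moreover have "lf l *s z + lf m *s t \<in> J k" unfolding J_def using yzt by blast
  ultimately show "x \<in> {x + y |x y. x \<in> J k \<and> y \<in> im a k}" using yzt(1) by blast
next
  fix x assume "x \<in> {x + y |x y. x \<in> J k \<and> y \<in> im a k}"
  then obtain y z t where yzt: "y \<in> Mk k" "z \<in> Mk k" "t \<in> Mk k" "x = lf l *s y + lf m *s z + lf a *s t"
    unfolding J_def by blast
  then show "x \<in> S1 (Mk k)"
    using S1_add[OF Mk_add S1_add[OF Mk_add S1_lf[OF Mk_cmult] S1_lf[OF Mk_cmult]] S1_lf[OF Mk_cmult]] by blast
qed

text \<open>The intersection of \<open>l M\<close> and \<open>m M\<close> is \<open>l m M\<close>, in one degree less, because \<open>M\<close> is saturated.\<close>

lemma dim_J: "cV.dim (J (Suc k)) + cV.dim (Mk k) = 2 * cV.dim (Mk (Suc k))"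
proof -
  have "im l (Suc k) \<inter> im m (Suc k) = (\<lambda>x. (lf l * lf m) *s x) ` Mk k"
  proof (intro equalityI subsetI)
    fix x assume "x \<in> im l (Suc k) \<inter> im m (Suc k)"
    then obtain y z where yz: "y \<in> Mk (Suc k)" "z \<in> Mk (Suc k)" "x = lf l *s y" "x = lf m *s z" by blast
    have "\<exists>r. y $ i = lf m * r \<and> z $ i = lf l * r" for i
    proof (rule lf_indep_dvd[of "Suc k"])
      show "homogeneous (Suc k) (y $ i)" "homogeneous (Suc k) (z $ i)"
        using yz by (auto simp: Mk_def homogeneous_triple_def)
      have "(lf l *s y) $ i = (lf m *s z) $ i" using yz by simp
      then show "lf l * y $ i = lf m * z $ i" by simp
    qed
    then obtain r where r: "\<And>i. y $ i = lf m * r i" by metis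
    define \<sigma> where "\<sigma> = (\<chi> i. r i)"
    have y: "y = lf m *s \<sigma>" by (simp add: vec_eq_iff \<sigma>_def r)
    have m0: "lf m \<noteq> 0" using covectors_neq_0 by (simp add: lf_eq_0_iff)
    have "\<sigma> \<in> M" using M_sat[of "lf m" \<sigma>] yz(1) y m0 by (simp add: Mk_def)
    moreover have "homogeneous k (\<sigma> $ i)" for i
      using homogeneous_factor[of "Suc 0" "lf m" k "\<sigma> $ i"] yz(1) y m0
      by (auto simp: Mk_def homogeneous_triple_def)
    ultimately have "\<sigma> \<in> Mk k" by (simp add: Mk_def homogeneous_triple_def)
    moreover have "x = (lf l * lf m) *s \<sigma>" using yz(3) y by (simp add: vector_smult_assoc)
    ultimately show "x \<in> (\<lambda>x. (lf l * lf m) *s x) ` Mk k" by blast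
  next
    fix x assume "x \<in> (\<lambda>x. (lf l * lf m) *s x) ` Mk k"
    then obtain \<sigma> where s: "\<sigma> \<in> Mk k" "x = (lf l * lf m) *s \<sigma>" by blast
    have "x = lf l *s (lf m *s \<sigma>)" "x = lf m *s (lf l *s \<sigma>)"
      using s(2) by (simp_all add: vector_smult_assoc mult.commute)
    then show "x \<in> im l (Suc k) \<inter> im m (Suc k)" using Mk_lf[OF s(1)] by blast
  qed
  moreover have "cV.dim ((\<lambda>x. (lf l * lf m) *s x) ` Mk k) = cV.dim (Mk k)"
    by (rule cVV.dim_image_inj[OF linear_smult subspace_Mk fin_dim_Mk])
       (use covectors_neq_0 in \<open>auto simp: vec_eq_iff lf_eq_0_iff\<close>)
  ultimately show ?thesis
    using cV.dim_sums_Int_fin_dim[OF dim_im(5,4)[of l "Suc k"] dim_im(5,4)[of m "Suc k"]]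
    by (simp add: J_def dim_im)
qed

lemma dim_S1: "cV.dim (S1 (Mk k)) + cV.dim (J k \<inter> im a k) = cV.dim (J k) + cV.dim (Mk k)"
  unfolding S1_eq using cV.dim_sums_Int_fin_dim[OF subspace_J fin_dim_J dim_im(5,4), of k a k] by (simp add: dim_im)

text \<open>The Koszul relations: \<open>a (l y + m z) = l (a y) + m (a z)\<close> lies in both summands.\<close>

lemma dim_S1_upper: "cV.dim (S1 (Mk (Suc (Suc k)))) + 3 * cV.dim (Mk (Suc k)) \<le> 3 * cV.dim (Mk (Suc (Suc k))) + cV.dim (Mk k)"
proof -
  let ?K = "(\<lambda>x. lf a *s x) ` J (Suc k)"
  have "?K \<subseteq> J (Suc (Suc k)) \<inter> im a (Suc (Suc k))"
  proof
    fix x assume "x \<in> ?K"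
    then obtain y z where yz: "y \<in> Mk (Suc k)" "z \<in> Mk (Suc k)" "x = lf a *s (lf l *s y + lf m *s z)"
      unfolding J_def by blast
    have "x = lf l *s (lf a *s y) + lf m *s (lf a *s z)"
      using yz(3) by (simp add: vec_eq_iff algebra_simps)
    then have "x \<in> J (Suc (Suc k))" unfolding J_def using Mk_lf yz(1,2) by blast
    moreover have "x \<in> im a (Suc (Suc k))" using yz Mk_add[OF Mk_lf Mk_lf] by blast
    ultimately show "x \<in> J (Suc (Suc k)) \<inter> im a (Suc (Suc k))" by blast
  qed
  moreover have "cV.dim ?K = cV.dim (J (Suc k))"
    by (rule cVV.dim_image_inj[OF linear_smult subspace_J fin_dim_J])
       (use covectors_neq_0 in \<open>auto simp: vec_eq_iff lf_eq_0_iff\<close>)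
  moreover have "cV.subspace ?K" by (rule cVV.rank_nullity(3)[OF linear_smult subspace_J fin_dim_J])
  moreover have "cV.subspace (J (Suc (Suc k)) \<inter> im a (Suc (Suc k)))"
    using cV.subspace_inter[OF subspace_J dim_im(5)] .
  moreover have "cV.fin_dim (J (Suc (Suc k)) \<inter> im a (Suc (Suc k)))"
    using cV.fin_dim_subset[OF fin_dim_J] by blast
  ultimately have "cV.dim (J (Suc k)) \<le> cV.dim (J (Suc (Suc k)) \<inter> im a (Suc (Suc k)))"
    using cV.dim_mono_fin_dim by metis
  then show ?thesis using dim_S1[of "Suc (Suc k)"] dim_J[of k] dim_J[of "Suc k"] by linarith
qed

end

section \<open>Growth of a graded saturated module\<close>

lemma (in linspace) independent_card_le:
  assumes "fin_dim V" "subspace V" "B \<subseteq> V" "independent B"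
  shows "card B \<le> dim V"
proof -
  obtain C where C: "C \<subseteq> V" "independent C" "finite C" "span C = V" "card C = dim V"
    by (rule fin_dim_basis[OF assms(1,2)])
  then show ?thesis using independent_span_bound[OF C(3) assms(4)] assms(3) by simp
qed

global_interpretation cC: linspace "\<lambda>c (x::complex^3). c *s x" ..
global_interpretation cVC: linspace_pair scale_vec "\<lambda>c (x::complex^3). c *s x" ..

lemma linear_evv: "Vector_Spaces.linear scale_vec (\<lambda>c (x::complex^3). c *s x) (evv p)"
  unfolding Vector_Spaces.linear_iff
  by (intro conjI allI cV.vector_space_axioms vec.vector_space_axioms)
    (simp_all add: evv_def vec_eq_iff ev.sub_add ev.sub_mult ev.sub_const)

lemma dot_commute: "dot a b = dot b a" by (simp add: dot_def mult.commute)

text \<open>Any point can be made the point \<open>l = m = 0\<close> of a frame: exchange the roles of the forms and the vectors.\<close>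

lemma frame_at_point:
  assumes "p \<noteq> 0" shows "\<exists>a l m u w. frame a p l m u w"
proof -
  obtain a u l w m where "frame p a u w l m" using frame_exists[OF assms] by blast
  then interpret f: frame p a u w l m .
  have "frame a p l m u w"
  proof
    fix x
    have "x = dot x a *s p + dot x l *s u + dot x m *s w" by (rule f.covector_expand)
    then show "x = dot a x *s p + dot l x *s u + dot m x *s w" by (simp add: dot_commute[of x])
  qed (use f.dual in \<open>simp_all add: dot_commute\<close>)
  then show ?thesis by blast
qed

text \<open>If \<open>a x\<close> lies in \<open>l M + m M\<close>, then evaluation at the point \<open>v\<close>, where \<open>l = m = 0\<close> and \<open>a = 1\<close>, gives \<open>x(v) = 0\<close>. So the overlap of
the third summand with the other two is no larger than the kernel of the evaluation at \<open>v\<close>.\<close>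

lemma (in graded_frame) dim_S1_lower:
  "2 * cV.dim (Mk (Suc k)) + vec.dim (evv v ` Mk (Suc k)) \<le> cV.dim (S1 (Mk (Suc k))) + cV.dim (Mk k)"
proof -
  let ?V = "Mk (Suc k)"
  let ?K = "{x \<in> ?V. evv v x = 0}"
  let ?L = "(\<lambda>x. lf a *s x) ` ?K"
  have ev1: "ev v (lf a) = 1" "ev v (lf l) = 0" "ev v (lf m) = 0"
    using eval_lf[of a v] eval_lf[of l v] eval_lf[of m v] by (simp_all add: eval_poly_ev)
  have sK: "cV.subspace ?K" using cVC.subspace_kernel_on[OF linear_evv subspace_Mk] .
  have fK: "cV.fin_dim ?K" by (rule cV.fin_dim_subset[OF fin_dim_Mk[of "Suc k"]]) auto
  have "J (Suc k) \<inter> im a (Suc k) \<subseteq> ?L"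
  proof
    fix x assume "x \<in> J (Suc k) \<inter> im a (Suc k)"
    then obtain y z t where yzt: "y \<in> ?V" "z \<in> ?V" "t \<in> ?V" "x = lf l *s y + lf m *s z" "x = lf a *s t"
      unfolding J_def by blast
    have "ev v (t $ i) = 0" for i
    proof -
      have "lf a * t $ i = lf l * y $ i + lf m * z $ i" using yzt(4,5) by (metis vector_add_component vector_smult_component)
      then have "ev v (lf a * t $ i) = ev v (lf l * y $ i + lf m * z $ i)" by simp
      then show ?thesis by (simp add: ev.sub_add ev.sub_mult ev1)
    qed
    then have "evv v t = 0" by (simp add: evv_def vec_eq_iff)
    then show "x \<in> ?L" using yzt by blast
  qed
  moreover have "cV.fin_dim ?L" "cV.subspace ?L" by (rule cVV.rank_nullity(2,3)[OF linear_smult sK fK])+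
  moreover have "cV.subspace (J (Suc k) \<inter> im a (Suc k))" using cV.subspace_inter[OF subspace_J dim_im(5)] .
  ultimately have "cV.dim (J (Suc k) \<inter> im a (Suc k)) \<le> cV.dim ?L" using cV.dim_mono_fin_dim by blast
  moreover have "cV.dim ?L = cV.dim ?K"
    by (rule cVV.dim_image_inj[OF linear_smult sK fK])
      (use covectors_neq_0 in \<open>auto simp: vec_eq_iff lf_eq_0_iff\<close>)
  moreover have "cV.dim ?V = cV.dim ?K + vec.dim (evv v ` ?V)"
    by (rule cVC.rank_nullity(1)[OF linear_evv subspace_Mk fin_dim_Mk])
  ultimately show ?thesis using dim_S1[of "Suc k"] dim_J[of k] by linarith
qed

context graded_saturated
begin

lemma dim_S1_lower_at:
  assumes "p \<noteq> 0"
  shows "2 * cV.dim (Mk (Suc k)) + vec.dim (evv p ` Mk (Suc k)) \<le> cV.dim (S1 (Mk (Suc k))) + cV.dim (Mk k)"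
proof -
  obtain a l m u w where "frame a p l m u w" using frame_at_point[OF assms] by blast
  then interpret f: frame a p l m u w .
  interpret g: graded_frame M a p l m u w ..
  show ?thesis by (rule g.dim_S1_lower)
qed

lemma dim_S1_upper_any:
  "cV.dim (S1 (Mk (Suc (Suc k)))) + 3 * cV.dim (Mk (Suc k)) \<le> 3 * cV.dim (Mk (Suc (Suc k))) + cV.dim (Mk k)"
proof -
  have "(axis 1 1 :: complex^3) \<noteq> 0" by simp
  then obtain a l m u w where "frame a (axis 1 1) l m u w" using frame_at_point by blast
  then interpret f: frame a "axis 1 1" l m u w .
  interpret g: graded_frame M a "axis 1 1" l m u w ..
  show ?thesis by (rule g.dim_S1_upper)
qed

lemma nonzero_at_point:
  assumes "homogeneous (Suc k) p" "p \<noteq> 0"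
  obtains x where "x \<noteq> 0" "ev x p \<noteq> 0"
proof -
  obtain x where x: "ev x p \<noteq> 0" using ev_all_0[of p] assms(2) by blast
  moreover have "x \<noteq> 0"
  proof
    assume "x = 0"
    then show False using x ev_scale[OF assms(1), of 0 x] by simp
  qed
  ultimately show ?thesis using that by blast
qed

lemma fin_dim_evv: "cC.fin_dim (evv p ` Mk k)" "vec.subspace (evv p ` Mk k)"
  by (rule cVC.rank_nullity(2,3)[OF linear_evv subspace_Mk fin_dim_Mk])+

lemma dim_S1_ge_1:
  assumes "cV.dim (Mk (Suc k)) \<noteq> 0"
  shows "2 * cV.dim (Mk (Suc k)) + 1 \<le> cV.dim (S1 (Mk (Suc k))) + cV.dim (Mk k)"
proof -
  have "Mk (Suc k) \<noteq> {0}" using assms cV.dim_trivial by metis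
  then obtain x where x: "x \<in> Mk (Suc k)" "x \<noteq> 0" using Mk_0 by blast
  then obtain i where i: "x $ i \<noteq> 0" by (auto simp: vec_eq_iff)
  obtain p where p: "p \<noteq> 0" "ev p (x $ i) \<noteq> 0"
    using nonzero_at_point[of k "x $ i"] x i by (auto simp: Mk_def homogeneous_triple_def)
  have "evv p x \<noteq> 0" using p by (auto simp: evv_def vec_eq_iff)
  then have "vec.independent {evv p x}" by simp
  then have "1 \<le> vec.dim (evv p ` Mk (Suc k))"
    using cC.independent_card_le[OF fin_dim_evv(1)[of p "Suc k"] fin_dim_evv(2), of "{evv p x}"] x(1) by simp
  then show ?thesis using dim_S1_lower_at[OF p(1), of k] by simp
qed

text \<open>Two relations that are not parallel have linearly independent values at some point, and there
the evaluation has rank at least two.\<close>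

lemma dim_S1_ge_2:
  assumes x: "x \<in> Mk (Suc k)" and y: "y \<in> Mk (Suc k)" and np: "x $ i * y $ j \<noteq> x $ j * y $ i"
  shows "2 * cV.dim (Mk (Suc k)) + 2 \<le> cV.dim (S1 (Mk (Suc k))) + cV.dim (Mk k)"
proof -
  have h: "homogeneous (Suc k) (x $ i)" "homogeneous (Suc k) (y $ i)" for i
    using x y by (auto simp: Mk_def homogeneous_triple_def)
  have "homogeneous (Suc (k + Suc k)) (x $ i * y $ j - x $ j * y $ i)"
    using homogeneous_diff[OF homogeneous_mult[OF h] homogeneous_mult[OF h]] by simp
  moreover have "x $ i * y $ j - x $ j * y $ i \<noteq> 0" using np by simp
  ultimately obtain p where p: "p \<noteq> 0" "ev p (x $ i * y $ j - x $ j * y $ i) \<noteq> 0"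
    by (rule nonzero_at_point)
  let ?a = "evv p x"
  let ?b = "evv p y"
  have ab: "?a $ i * ?b $ j \<noteq> ?a $ j * ?b $ i"
    using p(2) by (simp add: evv_def ev.sub_diff ev.sub_mult)
  have "?b \<noteq> 0" using ab by auto
  then have "vec.independent {?b}" by simp
  moreover have na: "?a \<notin> vec.span {?b}"
  proof
    assume "?a \<in> vec.span {?b}"
    then obtain c where "?a = c *s ?b" by (auto simp: vec.span_singleton)
    then show False using ab by simp
  qed
  ultimately have "vec.independent {?a, ?b}" by (rule vec.independent_insertI[rotated])
  moreover have "?a \<noteq> ?b" using na vec.span_base by force
  ultimately have "2 \<le> vec.dim (evv p ` Mk (Suc k))"
    using cC.independent_card_le[OF fin_dim_evv(1)[of p "Suc k"] fin_dim_evv(2), of "{?a, ?b}"] x y by simp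
  then show ?thesis using dim_S1_lower_at[OF p(1), of k] by simp
qed

text \<open>Dividing by common factors, \<open>\<theta> = a \<sigma>\<close> and \<open>\<phi> = b \<sigma>\<close> with \<open>\<sigma>\<close> in the saturated module. All components of \<open>\<sigma>\<close> have degree
at least \<open>k\<close>, since there is nothing below; so \<open>a\<close> has degree zero.\<close>

lemma parallel_multiple:
  assumes \<theta>: "\<theta> \<in> Mk k" "\<theta> \<noteq> 0" and low: "\<And>j. j < k \<Longrightarrow> Mk j = {0}"
    and \<phi>: "\<phi> \<in> Mk k'" "k \<le> k'" and par: "\<And>i j. \<theta> $ i * \<phi> $ j = \<theta> $ j * \<phi> $ i"
  shows "\<exists>q. homogeneous (k' - k) q \<and> \<phi> = q *s \<theta>"
proof -
  obtain i where i: "\<theta> $ i \<noteq> 0" using \<theta>(2) by (auto simp: vec_eq_iff)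
  obtain g a b where gab: "\<theta> $ i = g * a" "\<phi> $ i = g * b" "\<And>c d. b * c = a * d \<Longrightarrow> a dvd c"
    using common_factor[OF i] by blast
  have g0: "g \<noteq> 0" and a0: "a \<noteq> 0" using i gab(1) by auto
  have ab: "b * \<theta> $ j = a * \<phi> $ j" for j
  proof -
    have "g * (b * \<theta> $ j) = g * (a * \<phi> $ j)" using par[of i j, symmetric]
      by (simp only: gab(1,2) mult.assoc mult.commute[of "\<theta> $ j"])
    then show ?thesis using g0 by (simp only: mult_left_cancel[OF g0])
  qed
  have "\<forall>j. \<exists>s. \<theta> $ j = a * s" using gab(3)[OF ab] by (auto simp: dvd_def)
  then obtain s where s: "\<And>j. \<theta> $ j = a * s j" by metis
  define \<sigma> where "\<sigma> = (\<chi> j. s j)"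
  have t\<sigma>: "\<theta> = a *s \<sigma>" by (simp add: vec_eq_iff \<sigma>_def s)
  have \<phi>\<sigma>: "\<phi> = b *s \<sigma>"
  proof -
    have "a * \<phi> $ j = a * (b * \<sigma> $ j)" for j
      using ab[of j, symmetric] by (simp add: t\<sigma> mult.left_commute)
    then show ?thesis using a0 by (simp add: vec_eq_iff)
  qed
  have \<sigma>M: "\<sigma> \<in> M" using M_sat[of a \<sigma>] \<theta>(1) t\<sigma> a0 by (simp add: Mk_def)
  have \<sigma>i: "\<sigma> $ i \<noteq> 0" using i t\<sigma> by auto
  have "coeff (gr (\<sigma> $ i)) j = 0" if "j < k" for j
  proof -
    have "hc j \<sigma> \<in> Mk j" using M_hc[OF \<sigma>M] by (simp add: Mk_def homogeneous_triple_def hc_def homogeneous_hcomp)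
    then have "hc j \<sigma> = 0" using low[OF that] by simp
    then have "hcomp j (\<sigma> $ i) = 0" by (metis hc_def vec_lambda_beta zero_index)
    then show ?thesis by (simp add: hcomp_def)
  qed
  moreover have gr0: "gr p \<noteq> 0" if "p \<noteq> 0" for p using sum_hcomp[of p] that by (auto simp: hcomp_def)
  ultimately have "k \<le> degree (gr (\<sigma> $ i))" using \<sigma>i by (meson leI leading_coeff_0_iff)
  moreover have "degree (gr a) + degree (gr (\<sigma> $ i)) = k"
  proof -
    have "degree (gr (\<theta> $ i)) = k"
      using \<theta>(1) i homogeneous_iff_gr by (simp add: Mk_def homogeneous_triple_def degree_monom_eq)
    moreover have "gr (\<theta> $ i) = gr a * gr (\<sigma> $ i)" by (simp add: t\<sigma> gr.sub_mult)
    ultimately show ?thesis using gr0[OF a0] gr0[OF \<sigma>i] by (simp add: degree_mult_eq)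
  qed
  ultimately have "degree (gr a) = 0" by simp
  then have "a = hcomp 0 a" using sum_hcomp[of a] by simp
  then have "homogeneous 0 a" using homogeneous_hcomp[of 0 a] by simp
  then obtain c where c: "a = const_poly c" using homogeneous_0_const by blast
  define q where "q = const_poly (1 / c) * b"
  have "c \<noteq> 0" using a0 c by auto
  then have cc: "const_poly (1 / c) * const_poly c = 1" by (simp flip: const_poly_mult)
  have q: "\<phi> = q *s \<theta>"
  proof -
    have "b * \<sigma> $ j = q * (a * \<sigma> $ j)" for j
    proof -
      have "q * (a * \<sigma> $ j) = (const_poly (1 / c) * const_poly c) * (b * \<sigma> $ j)"
        by (simp only: q_def c mult_ac)
      then show ?thesis unfolding cc by (simp only: mult_1_left)
    qed
    then show ?thesis unfolding \<phi>\<sigma> t\<sigma> vec_eq_iff vector_smult_component by blast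
  qed
  have "\<phi> $ j = hcomp (k' - k) q * \<theta> $ j" for j
  proof -
    have "hcomp k' (\<phi> $ j) = \<phi> $ j" 
      using \<phi>(1) hcomp_homogeneous[of k' "\<phi> $ j" k'] by (simp add: Mk_def homogeneous_triple_def)
    moreover have "hcomp k' (\<theta> $ j * q) = \<theta> $ j * hcomp (k' - k) q"
      using \<theta>(1) \<phi>(2) by (subst hcomp_mult[of k]) (auto simp: Mk_def homogeneous_triple_def)
    ultimately show ?thesis using q by (simp add: mult.commute)
  qed
  then have "\<phi> = hcomp (k' - k) q *s \<theta>" by (simp add: vec_eq_iff)
  then show ?thesis using homogeneous_hcomp by blast
qed

lemma nonparallel_min_degree:
  assumes low: "\<And>j. j < k \<Longrightarrow> Mk j = {0}" and d: "cV.dim (Mk k) \<ge> 2"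
  shows "\<exists>x\<in>Mk k. \<exists>y\<in>Mk k. \<exists>i j. x $ i * y $ j \<noteq> x $ j * y $ i"
proof (rule ccontr)
  assume neg: "\<not> ?thesis"
  have "Mk k \<noteq> {0}" using d cV.dim_trivial by fastforce
  then obtain x where x: "x \<in> Mk k" "x \<noteq> 0" using Mk_0 by blast
  have "y \<in> cV.span {x}" if y: "y \<in> Mk k" for y
  proof -
    obtain q where q: "homogeneous (k - k) q" "y = q *s x"
      using parallel_multiple[OF x low y order_refl] neg x(1) y by blast
    then obtain c where "q = const_poly c" using homogeneous_0_const by auto
    then show ?thesis using q(2) by (simp add: cV.span_base cV.span_scale)
  qed
  then have "cV.dim (Mk k) \<le> card {x}" by (intro cV.dim_le_card) auto
  then show False using d by simp
qed

lemma dim_S1_min_degree: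
  assumes low: "\<And>j. j < Suc k \<Longrightarrow> Mk j = {0}" and d: "cV.dim (Mk (Suc k)) \<ge> 2"
  shows "2 * cV.dim (Mk (Suc k)) + 2 \<le> cV.dim (S1 (Mk (Suc k)))"
proof -
  obtain x y i j where "x \<in> Mk (Suc k)" "y \<in> Mk (Suc k)" "x $ i * y $ j \<noteq> x $ j * y $ i"
    using nonparallel_min_degree[OF low d] by blast
  moreover have "cV.dim (Mk k) = 0" using low[of k] cV.dim_trivial by simp
  ultimately show ?thesis using dim_S1_ge_2 by fastforce
qed

text \<open>One degree above the minimal one, there are two relations that are not parallel if there are two of minimal degree, or if
a new generator appears.\<close>

lemma dim_S1_next_degree:
  assumes low: "\<And>j. j < k \<Longrightarrow> Mk j = {0}" and d: "cV.dim (Mk k) \<noteq> 0"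
    and more: "cV.dim (Mk k) \<ge> 2 \<or> cV.dim (S1 (Mk k)) < cV.dim (Mk (Suc k))"
  shows "2 * cV.dim (Mk (Suc k)) + 2 \<le> cV.dim (S1 (Mk (Suc k))) + cV.dim (Mk k)"
proof -
  define b where "b = (axis 1 1 :: complex^3)"
  have b0: "lf b \<noteq> 0" by (simp add: b_def lf_eq_0_iff)
  have "\<exists>x\<in>Mk (Suc k). \<exists>y\<in>Mk (Suc k). \<exists>i j. x $ i * y $ j \<noteq> x $ j * y $ i"
  proof (cases "cV.dim (Mk k) \<ge> 2")
    case True
    then obtain x y i j where xy: "x \<in> Mk k" "y \<in> Mk k" "x $ i * y $ j \<noteq> x $ j * y $ i"
      using nonparallel_min_degree[OF low] by blast
    have "(lf b *s x) $ i * (lf b *s y) $ j - (lf b *s x) $ j * (lf b *s y) $ i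
      = lf b * lf b * (x $ i * y $ j - x $ j * y $ i)" by (simp add: algebra_simps)
    then have "(lf b *s x) $ i * (lf b *s y) $ j \<noteq> (lf b *s x) $ j * (lf b *s y) $ i" using xy(3) b0 by auto
    then show ?thesis using Mk_lf xy(1,2) by blast
  next
    case False
    then have less: "cV.dim (S1 (Mk k)) < cV.dim (Mk (Suc k))" using more by simp
    have "Mk k \<noteq> {0}" using d cV.dim_trivial by metis
    then obtain x where x: "x \<in> Mk k" "x \<noteq> 0" using Mk_0 by blast
    have "S1 (Mk k) \<noteq> Mk (Suc k)" using less by auto
    then obtain y where y: "y \<in> Mk (Suc k)" "y \<notin> S1 (Mk k)" using S1_Mk by blast
    have "\<exists>i j. x $ i * y $ j \<noteq> x $ j * y $ i"
    proof (rule ccontr)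
      assume "\<not> ?thesis"
      then obtain q where q: "homogeneous (Suc k - k) q" "y = q *s x"
        using parallel_multiple[OF x low y(1)] by auto
      then obtain c where "q = lf c" using linear_form_lf[of q] by auto
      then show False using q(2) y(2) S1_lf[OF Mk_cmult x(1)] by blast
    qed
    then obtain i j where ij: "x $ i * y $ j \<noteq> x $ j * y $ i" by blast
    have "(lf b *s x) $ i * y $ j - (lf b *s x) $ j * y $ i = lf b * (x $ i * y $ j - x $ j * y $ i)"
      by (simp add: algebra_simps)
    then have "(lf b *s x) $ i * y $ j \<noteq> (lf b *s x) $ j * y $ i" using ij b0 by auto
    then show ?thesis using Mk_lf[OF x(1)] y(1) by blast
  qed
  then show ?thesis using dim_S1_ge_2 by blast
qed

end

section \<open>Minimal generators\<close>

global_interpretation mp: module "\<lambda>(c::poly3) (x::poly3^3). c *s x"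
  by (rule module_vec)

lemma hc_add: "hc k (x + y) = hc k x + hc k y"
  by (simp add: hc_def vec_eq_iff hcomp_add)

lemma hc_0: "hc k 0 = 0" by (simp add: hc_def vec_eq_iff)

lemma hc_sum: "hc k (sum f S) = (\<Sum>x\<in>S. hc k (f x))"
  by (induction S rule: infinite_finite_induct) (auto simp: hc_add hc_0)

lemma hc_id: "homogeneous_triple k x \<Longrightarrow> hc k x = x"
  using hcomp_homogeneous[of k _ k] by (simp add: hc_def vec_eq_iff homogeneous_triple_def)

lemma hc_smult:
  assumes "homogeneous_triple e x"
  shows "hc k (q *s x) = (if e \<le> k then hcomp (k - e) q *s x else 0)"
proof -
  have "hcomp k (q * x $ i) = (if e \<le> k then hcomp (k - e) q * x $ i else 0)" for i
    using hcomp_mult[of e "x $ i" k q] assms by (simp add: homogeneous_triple_def mult.commute)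
  then show ?thesis by (simp add: hc_def vec_eq_iff)
qed

lemma sum_hcomp_le: "degree (gr p) \<le> N \<Longrightarrow> (\<Sum>j\<le>N. hcomp j p) = p"
proof -
  assume "degree (gr p) \<le> N"
  then have "(\<Sum>j\<le>N. hcomp j p) = (\<Sum>j\<le>degree (gr p). hcomp j p)"
    by (intro sum.mono_neutral_right) (auto simp: hcomp_def coeff_eq_0)
  then show ?thesis by (simp add: sum_hcomp)
qed

lemma sum_hc: "\<exists>N. x = (\<Sum>j\<le>N. hc j x)"
proof -
  define N where "N = (\<Sum>i\<in>UNIV. degree (gr (x $ i)))"
  have le: "degree (gr (x $ i)) \<le> N" for i unfolding N_def by (rule member_le_sum) auto
  have "(\<Sum>j\<le>N. hc j x) $ i = x $ i" for i
    using sum_hcomp_le[OF le] by (simp add: hc_def)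
  then show ?thesis by (intro exI[of _ N]) (simp add: vec_eq_iff)
qed

lemma homogeneous_triple_hc: "homogeneous_triple k (hc k x)"
  by (simp add: homogeneous_triple_def hc_def homogeneous_hcomp)

context graded_saturated
begin

text \<open>The part of degree \<open>k\<close> that is generated in lower degrees. Degree \<open>0\<close> must be treated separately.\<close>

definition S1p :: "nat \<Rightarrow> (poly3^3) set" where
  "S1p k = (case k of 0 \<Rightarrow> {0} | Suc j \<Rightarrow> S1 (Mk j))"

definition mu :: "nat \<Rightarrow> nat" where "mu k = cV.dim (Mk k) - cV.dim (S1p k)"

lemma subspace_S1p: "cV.subspace (S1p k)" and fin_dim_S1p: "cV.fin_dim (S1p k)" and S1p_Mk: "S1p k \<subseteq> Mk k"
  using subspace_S1 fin_dim_S1 S1_Mk Mk_0 by (auto simp: S1p_def split: nat.split intro: cV.fin_dim_subset[OF fin_dim_Mk[of 0]])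

lemma subspace_M: "mp.subspace M"
  by (simp add: mp.subspace_def M_0 M_add M_smult)

lemma S1_smult:
  assumes "homogeneous (Suc j) q" "x \<in> Mk i"
  shows "q *s x \<in> S1 (Mk (j + i))"
proof -
  obtain z where z: "\<And>i. homogeneous j (z i)" "q = (\<Sum>i\<in>UNIV. Xv i * z i)"
    using homogeneous_Suc_decomp[OF assms(1)] by blast
  show ?thesis
    by (rule S1_I[of "\<lambda>i. z i *s x"])
      (use Mk_smult[OF z(1) assms(2)] z(2) in \<open>auto simp: sum_3 vec_eq_iff algebra_simps\<close>)
qed

text \<open>Taking the component of degree \<open>k\<close> of a representation makes its coefficients homogeneous and removes the generators of
larger degree.\<close>

lemma span_degree:
  assumes G: "finite G" "mp.span G = M" "\<And>g. g \<in> G \<Longrightarrow> homogeneous_triple (e g) g" and x: "x \<in> Mk k"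
  shows "\<exists>p. (\<forall>g. homogeneous (k - e g) (p g)) \<and> x = (\<Sum>g\<in>{g \<in> G. e g \<le> k}. p g *s g)"
proof -
  have "x \<in> mp.span G" using x G(2) by (simp add: Mk_def)
  then obtain u where u: "x = (\<Sum>g\<in>G. u g *s g)" using mp.span_finite[OF G(1)] by auto
  have "x = hc k x" using x by (simp add: Mk_def hc_id)
  also have "\<dots> = (\<Sum>g\<in>G. if e g \<le> k then hcomp (k - e g) (u g) *s g else 0)"
    unfolding u hc_sum by (rule sum.cong) (auto simp: hc_smult[OF G(3)])
  also have "\<dots> = (\<Sum>g\<in>{g \<in> G. e g \<le> k}. hcomp (k - e g) (u g) *s g)"
    using G(1) by (simp add: sum.inter_filter)
  finally show ?thesis by (intro exI[of _ "\<lambda>g. hcomp (k - e g) (u g)"] conjI allI homogeneous_hcomp)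
qed

text \<open>Graded Nakayama: the generators of degree \<open>k\<close> in an irredundant homogeneous generating set form a basis of \<open>M\<^sub>k\<close> modulo the part
generated in lower degrees. They span it by \<open>span_degree\<close>. A linear relation among them modulo that part would express
one generator by the others.\<close>

lemma card_generators_of_degree:
  assumes G: "finite G" "mp.span G = M" "\<And>g. g \<in> G \<Longrightarrow> homogeneous_triple (e g) g"
    and irr: "\<And>g. g \<in> G \<Longrightarrow> g \<notin> mp.span (G - {g})"
  shows "card {g \<in> G. e g = k} = mu k"
proof -
  let ?P = "{g \<in> G. e g = k}"
  let ?W = "S1p k"
  have fP: "finite ?P" using G(1) by simp
  have GM: "g \<in> Mk (e g)" if "g \<in> G" for g using that G(2,3) mp.span_base[of g G] by (simp add: Mk_def)
  have W: "?W \<subseteq> mp.span {g \<in> G. e g < k}"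
  proof (cases k)
    case 0
    then show ?thesis by (simp add: S1p_def mp.span_zero)
  next
    case (Suc j)
    show ?thesis
    proof
      fix x assume "x \<in> ?W"
      then obtain f where f: "x = (\<Sum>i\<in>UNIV. Xv i *s f i)" "\<forall>i. f i \<in> Mk j" unfolding S1p_def Suc S1_def by auto
      have "f i \<in> mp.span {g \<in> G. e g < k}" for i
      proof -
        obtain p where p: "f i = (\<Sum>g\<in>{g \<in> G. e g \<le> j}. p g *s g)" using span_degree[OF G] f(2) by blast
        show ?thesis unfolding p by (intro mp.span_sum mp.span_scale mp.span_base) (use Suc in auto)
      qed
      then show "x \<in> mp.span {g \<in> G. e g < k}" unfolding f(1) by (intro mp.span_sum mp.span_scale)
    qed
  qed
  have zero: "c g0 = 0" if c: "(\<Sum>g\<in>?P. const_poly (c g) *s g) \<in> ?W" and g0: "g0 \<in> ?P" for c g0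
  proof (rule ccontr)
    assume n0: "c g0 \<noteq> 0"
    have "(\<Sum>g\<in>?P. const_poly (c g) *s g) \<in> mp.span (G - {g0})"
      using W c mp.span_mono[of "{g \<in> G. e g < k}" "G - {g0}"] g0 by auto
    moreover have "(\<Sum>g\<in>?P - {g0}. const_poly (c g) *s g) \<in> mp.span (G - {g0})"
      by (intro mp.span_sum mp.span_scale mp.span_base) auto
    ultimately have "(\<Sum>g\<in>?P. const_poly (c g) *s g) - (\<Sum>g\<in>?P - {g0}. const_poly (c g) *s g) \<in> mp.span (G - {g0})"
      by (rule mp.span_diff)
    then have "const_poly (c g0) *s g0 \<in> mp.span (G - {g0})"
      using sum.remove[OF fP g0, of "\<lambda>g. const_poly (c g) *s g"] by simp
    then have "const_poly (1 / c g0) *s (const_poly (c g0) *s g0) \<in> mp.span (G - {g0})"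
      by (rule mp.span_scale)
    then have "g0 \<in> mp.span (G - {g0})" using n0 by (simp add: vector_smult_assoc flip: const_poly_mult)
    then show False using irr g0 by blast
  qed
  have ind: "cV.independent ?P"
    by (rule cV.independent_if_scalars_zero[OF fP]) (use zero cV.subspace_0[OF subspace_S1p[of k]] in auto)
  have int0: "?W \<inter> cV.span ?P = {0}"
  proof -
    have "y = 0" if y: "y \<in> ?W" "y \<in> cV.span ?P" for y
    proof -
      obtain c where c: "y = (\<Sum>g\<in>?P. const_poly (c g) *s g)" using y(2) cV.span_finite[OF fP] by auto
      then have "c g = 0" if "g \<in> ?P" for g using zero[of c g] y(1) that by simp
      then show ?thesis using c by simp
    qed
    then show ?thesis using cV.subspace_0[OF subspace_S1p[of k]] cV.span_zero by blast
  qed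
  have "Mk k = {x + y |x y. x \<in> ?W \<and> y \<in> cV.span ?P}"
  proof (intro equalityI subsetI)
    fix x assume "x \<in> Mk k"
    then obtain p where p: "\<And>g. homogeneous (k - e g) (p g)" "x = (\<Sum>g\<in>{g \<in> G. e g \<le> k}. p g *s g)"
      using span_degree[OF G] by blast
    have "{g \<in> G. e g \<le> k} = {g \<in> G. e g < k} \<union> ?P" by auto
    then have x: "x = (\<Sum>g\<in>{g \<in> G. e g < k}. p g *s g) + (\<Sum>g\<in>?P. p g *s g)"
      unfolding p(2) using G(1) by (simp only:) (intro sum.union_disjoint, auto)
    have "p g *s g \<in> ?W" if g: "g \<in> G" "e g < k" for g
    proof -
      obtain j where j: "k - e g = Suc j" using g(2) by (cases "k - e g") auto
      then have "k = Suc (j + e g)" using g(2) by simp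
      then have "S1p k = S1 (Mk (j + e g))" by (simp add: S1p_def)
      then show ?thesis using S1_smult[of j "p g" g "e g"] p(1)[of g] j GM[OF g(1)] by simp
    qed
    then have "(\<Sum>g\<in>{g \<in> G. e g < k}. p g *s g) \<in> ?W" by (intro cV.subspace_sum subspace_S1p) auto
    moreover have "p g *s g \<in> cV.span ?P" if g: "g \<in> ?P" for g
    proof -
      obtain c where "p g = const_poly c" using homogeneous_0_const p(1)[of g] g by auto
      then show ?thesis using cV.span_scale[OF cV.span_base[OF g]] by simp
    qed
    then have "(\<Sum>g\<in>?P. p g *s g) \<in> cV.span ?P" by (intro cV.span_sum)
    ultimately show "x \<in> {x + y |x y. x \<in> ?W \<and> y \<in> cV.span ?P}" using x by blast
  next
    fix x assume "x \<in> {x + y |x y. x \<in> ?W \<and> y \<in> cV.span ?P}"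
    moreover have "cV.span ?P \<subseteq> Mk k" using GM by (intro cV.span_minimal subspace_Mk) auto
    ultimately show "x \<in> Mk k" using S1p_Mk Mk_add by blast
  qed
  then have "cV.dim (Mk k) = cV.dim ?W + cV.dim (cV.span ?P)"
    using cV.dim_sums_Int_fin_dim[OF subspace_S1p[of k] fin_dim_S1p cV.subspace_span, of ?P] int0 cV.dim_trivial fP
    by (simp add: cV.fin_dim_def) blast
  moreover have "cV.dim (cV.span ?P) = card ?P" by (rule cV.dim_span_eq_card_independent[OF ind])
  ultimately show ?thesis by (simp add: mu_def)
qed

lemma minimal_generating_iff:
  "minimal_generating_set M G \<longleftrightarrow> mp.span G = M \<and> (\<forall>g\<in>G. g \<notin> mp.span (G - {g}))"
proof
  assume m: "minimal_generating_set M G"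
  then have s: "mp.span G = M" and n: "\<And>H. H \<subset> G \<Longrightarrow> mp.span H \<noteq> M" by (auto simp: minimal_generating_set_def)
  have "g \<notin> mp.span (G - {g})" if g: "g \<in> G" for g
  proof
    assume "g \<in> mp.span (G - {g})"
    then have "G \<subseteq> mp.span (G - {g})" using mp.span_superset[of "G - {g}"] by auto
    then have "mp.span G \<subseteq> mp.span (G - {g})" by (intro mp.span_minimal mp.subspace_span)
    moreover have "mp.span (G - {g}) \<subseteq> mp.span G" by (rule mp.span_mono) auto
    ultimately show False using n[of "G - {g}"] g s by blast
  qed
  then show "mp.span G = M \<and> (\<forall>g\<in>G. g \<notin> mp.span (G - {g}))" using s by blast
next
  assume a: "mp.span G = M \<and> (\<forall>g\<in>G. g \<notin> mp.span (G - {g}))"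
  have "mp.span H \<noteq> M" if H: "H \<subset> G" for H
  proof
    assume e: "mp.span H = M"
    obtain g where g: "g \<in> G" "g \<notin> H" using H by blast
    then have "mp.span H \<subseteq> mp.span (G - {g})" using H by (intro mp.span_mono) auto
    moreover have "g \<in> mp.span G" using g(1) by (rule mp.span_base)
    ultimately show False using a e g by blast
  qed
  then show "minimal_generating_set M G" using a by (simp add: minimal_generating_set_def)
qed

definition exps :: "nat \<Rightarrow> nat list" where
  "exps K = concat (map (\<lambda>k. replicate (mu k) k) [0..<K])"

lemma exps_Suc: "exps (Suc K) = exps K @ replicate (mu K) K" by (simp add: exps_def)

lemma set_exps: "set (exps K) \<subseteq> {..<K}" by (auto simp: exps_def)

lemma sorted_exps: "sorted (exps K)"
proof (induction K)
  case (Suc K)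
  then show ?case using set_exps[of K] by (auto simp: exps_Suc sorted_append sorted_replicate less_imp_le)
qed (simp add: exps_def)

lemma card_count_list:
  assumes "distinct gs" "list_all2 Q es gs" "\<And>k g. Q k g \<Longrightarrow> g \<in> set gs \<Longrightarrow> e g = k"
  shows "count (mset es) k = card {g \<in> set gs. e g = k}"
  using assms(2,1,3)
proof (induction es gs rule: list_all2_induct)
  case (Cons x xs g gs)
  have "e g = x" using Cons.hyps(1) Cons.prems(2) by auto
  moreover have "count (mset xs) k = card {g \<in> set gs. e g = k}" using Cons.IH Cons.prems by auto
  moreover have "{h \<in> set (g # gs). e h = k} = (if e g = k then insert g {h \<in> set gs. e h = k} else {h \<in> set gs. e h = k})"
    by auto
  ultimately show ?case using Cons.prems(1) by auto
qed simp

lemma homogeneous_triple_unique: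
  assumes "homogeneous_triple j x" "homogeneous_triple k x" "x \<noteq> 0" shows "j = k"
proof -
  obtain i where "x $ i \<noteq> 0" using assms(3) by (auto simp: vec_eq_iff)
  then show ?thesis
    using assms(1,2) hcomp_homogeneous[of j "x $ i" j] hcomp_homogeneous[of k "x $ i" j]
    by (auto simp: homogeneous_triple_def split: if_splits)
qed

lemma count_exponents:
  assumes "distinct gs" "list_all2 homogeneous_triple es gs" "minimal_generating_set M (set gs)"
  shows "count (mset es) k = mu k"
proof -
  have m: "mp.span (set gs) = M" "\<And>g. g \<in> set gs \<Longrightarrow> g \<notin> mp.span (set gs - {g})"
    using assms(3) unfolding minimal_generating_iff by auto
  have n0: "g \<noteq> 0" if "g \<in> set gs" for g using m(2)[OF that] mp.span_zero by auto
  have "\<exists>k. homogeneous_triple k g" if "g \<in> set gs" for g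
    using assms(2) that by (metis in_set_conv_nth list_all2_conv_all_nth)
  then obtain e where e: "\<And>g. g \<in> set gs \<Longrightarrow> homogeneous_triple (e g) g" by metis
  have "count (mset es) k = card {g \<in> set gs. e g = k}"
    by (rule card_count_list[OF assms(1,2)]) (use e n0 homogeneous_triple_unique in blast)
  also have "\<dots> = mu k" by (rule card_generators_of_degree[OF _ m(1) e m(2)]) auto
  finally show ?thesis .
qed

text \<open>Conversely, complements of the parts generated in lower degrees, taken for all degrees up to the last one
in which generators are needed, form a minimal generating set.\<close>

lemma generators_exist:
  assumes gen: "\<And>k. k \<ge> K \<Longrightarrow> Mk (Suc k) \<subseteq> S1 (Mk k)"
  shows "\<exists>gs. distinct gs \<and> list_all2 homogeneous_triple (exps (Suc K)) gs \<and> minimal_generating_set M (set gs)"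
proof -
  have "\<exists>B C. B \<inter> C = {} \<and> finite C \<and> cV.independent (B \<union> C) \<and> cV.span B = S1p k \<and> cV.span (B \<union> C) = Mk k \<and> card C = mu k" for k
  proof -
    obtain B C where "B \<inter> C = {}" "finite B" "finite C" "cV.independent (B \<union> C)" "cV.span B = S1p k"
      "cV.span (B \<union> C) = Mk k" "card B = cV.dim (S1p k)" "card B + card C = cV.dim (Mk k)"
      by (rule cV.fin_dim_relative_basis[OF fin_dim_Mk subspace_Mk subspace_S1p S1p_Mk])
    then show ?thesis by (intro exI[of _ B] exI[of _ C]) (auto simp: mu_def)
  qed
  then obtain B C where BC: "\<And>k. B k \<inter> C k = {}" "\<And>k. finite (C k)" "\<And>k. cV.independent (B k \<union> C k)"
    "\<And>k. cV.span (B k) = S1p k" "\<And>k. cV.span (B k \<union> C k) = Mk k" "\<And>k. card (C k) = mu k" by metis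
  have CM: "C k \<subseteq> Mk k" for k using BC(5)[of k] cV.span_superset by blast
  have C0: "0 \<notin> C k" for k using cV.dependent_zero[of "B k \<union> C k"] BC(3)[of k] by blast
  obtain xs where xs: "\<And>k. set (xs k) = C k" "\<And>k. distinct (xs k)" using finite_distinct_list[OF BC(2)] by metis
  have lx: "length (xs k) = mu k" for k using xs BC(6) distinct_card by metis
  define gl where "gl n = concat (map xs [0..<n])" for n
  have gl_Suc: "gl (Suc n) = gl n @ xs n" for n by (simp add: gl_def)
  have set_gl: "set (gl n) = (\<Union>k<n. C k)" for n by (auto simp: gl_def xs(1))
  have uniq: "j = k" if "x \<in> C j" "x \<in> C k" for x j k
    using that CM C0 homogeneous_triple_unique[of j x k] by (auto simp: Mk_def)
  have d: "distinct (gl n)" for n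
  proof (induction n)
    case (Suc n)
    have "x \<notin> C n" if "x \<in> C k" "k < n" for x k using uniq[of x k n] that by blast
    then have "set (gl n) \<inter> set (xs n) = {}" unfolding set_gl xs(1) by blast
    then show ?case using Suc xs(2)[of n] by (simp add: gl_Suc)
  qed (simp add: gl_def)
  have la: "list_all2 homogeneous_triple (exps n) (gl n)" for n
  proof (induction n)
    case (Suc n)
    have "list_all2 homogeneous_triple (replicate (mu n) n) (xs n)"
      using CM[of n] xs(1)[of n] by (auto simp: list_all2_conv_all_nth lx Mk_def)
    then show ?case using Suc by (simp add: exps_Suc gl_Suc list_all2_appendI)
  qed (simp add: exps_def gl_def)
  define G where "G = (\<Union>k<Suc K. C k)"
  have GM: "G \<subseteq> M" using CM by (auto simp: G_def Mk_def)
  have Mk_span: "Mk k \<subseteq> mp.span G" for k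
  proof (induction k rule: less_induct)
    case (less k)
    have S: "S1p k \<subseteq> mp.span G"
    proof (cases k)
      case 0 then show ?thesis by (simp add: S1p_def mp.span_zero)
    next
      case (Suc j)
      then have IH: "Mk j \<subseteq> mp.span G" using less by simp
      show ?thesis
      proof
        fix x assume "x \<in> S1p k"
        then obtain f where f: "x = (\<Sum>i\<in>UNIV. Xv i *s f i)" "\<forall>i. f i \<in> Mk j" unfolding S1p_def Suc S1_def by auto
        then show "x \<in> mp.span G" using IH by (auto intro!: mp.span_sum mp.span_scale)
      qed
    qed
    show ?case
    proof (cases "k < Suc K")
      case True
      have "B k \<subseteq> mp.span G" using S BC(4)[of k] cV.span_superset[of "B k"] by blast
      moreover have "C k \<subseteq> mp.span G" using True mp.span_superset[of G] by (auto simp: G_def)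
      moreover have "cV.subspace (mp.span G)"
        by (simp add: cV.subspace_def mp.span_zero mp.span_add mp.span_scale)
      ultimately show ?thesis using BC(5)[of k] cV.span_minimal[of "B k \<union> C k" "mp.span G"] by blast
    next
      case False
      then obtain j where j: "k = Suc j" "j \<ge> K" by (cases k) auto
      then have "Mk k \<subseteq> S1p k" using gen by (simp add: S1p_def)
      then show ?thesis using S by blast
    qed
  qed
  have "mp.span G = M"
  proof
    show "mp.span G \<subseteq> M" using GM by (intro mp.span_minimal subspace_M)
    show "M \<subseteq> mp.span G"
    proof
      fix x assume x: "x \<in> M"
      obtain N where N: "x = (\<Sum>j\<le>N. hc j x)" using sum_hc by blast
      have "hc j x \<in> mp.span G" for j using Mk_span[of j] M_hc[OF x] homogeneous_triple_hc by (auto simp: Mk_def)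
      then show "x \<in> mp.span G" by (subst N) (intro mp.span_sum)
    qed
  qed
  moreover have "g0 \<notin> mp.span (G - {g0})" if "g0 \<in> G" for g0
  proof
    assume sp: "g0 \<in> mp.span (G - {g0})"
    have "\<exists>k. k < Suc K \<and> g0 \<in> C k" using that by (simp only: G_def UN_iff lessThan_iff Bex_def)
    then obtain k where k: "k < Suc K" "g0 \<in> C k" by (elim exE conjE)
    have fG: "finite (G - {g0})" using BC(2) by (auto simp: G_def)
    have "\<forall>g\<in>G. \<exists>j. g \<in> C j" by (auto simp only: G_def UN_iff)
    from bchoice[OF this] obtain e where e': "\<forall>g\<in>G. g \<in> C (e g)" ..
    then have e: "\<And>g. g \<in> G \<Longrightarrow> g \<in> C (e g)" by simp
    then have eM: "g \<in> Mk (e g)" if "g \<in> G" for g using that CM by blast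
    obtain u where u: "g0 = (\<Sum>g\<in>G - {g0}. u g *s g)" using sp mp.span_finite[OF fG] by auto
    have "g0 \<in> Mk k" using k(2) CM by blast
    then have "g0 = hc k g0" by (simp add: Mk_def hc_id)
    also have "hc k g0 = hc k (\<Sum>g\<in>G - {g0}. u g *s g)" using u by (rule arg_cong)
    also have "\<dots> = (\<Sum>g\<in>G - {g0}. hc k (u g *s g))" by (rule hc_sum)
    also have "\<dots> \<in> cV.span (B k \<union> (C k - {g0}))"
    proof (rule cV.span_sum)
      fix g assume g: "g \<in> G - {g0}"
      then have hg: "homogeneous_triple (e g) g" using eM by (auto simp: Mk_def)
      consider "e g < k" | "e g = k" | "e g > k" by linarith
      then show "hc k (u g *s g) \<in> cV.span (B k \<union> (C k - {g0}))"
      proof cases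
        case 1
        then obtain j where j: "k - e g = Suc j" by (cases "k - e g") auto
        then have "k = Suc (j + e g)" using 1 by simp
        then have "S1p k = S1 (Mk (j + e g))" by (simp add: S1p_def)
        then have "hcomp (k - e g) (u g) *s g \<in> S1p k"
          using S1_smult[of j "hcomp (k - e g) (u g)" g "e g"] homogeneous_hcomp[of "k - e g" "u g"] j eM g by simp
        then show ?thesis using 1 hc_smult[OF hg] BC(4)[of k] cV.span_mono[of "B k" "B k \<union> (C k - {g0})"] by auto
      next
        case 2
        then have "g \<in> B k \<union> (C k - {g0})" using e g by auto
        moreover obtain c where "hcomp 0 (u g) = const_poly c" using homogeneous_0_const homogeneous_hcomp by blast
        ultimately show ?thesis using 2 hc_smult[OF hg, of k "u g"] cV.span_scale[OF cV.span_base] by simp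
      next
        case 3
        then show ?thesis using hc_smult[OF hg] cV.span_zero by simp
      qed
    qed
    finally have "g0 \<in> cV.span (B k \<union> (C k - {g0}))" .
    moreover have "B k \<union> (C k - {g0}) = (B k \<union> C k) - {g0}" using BC(1)[of k] k by blast
    ultimately show False using BC(3)[of k] k cV.dependent_def[of "B k \<union> C k"] by auto
  qed
  ultimately have "minimal_generating_set M G" unfolding minimal_generating_iff by blast
  moreover have "set (gl (Suc K)) = G" by (simp only: set_gl G_def)
  ultimately show ?thesis using d la by blast
qed

lemma exponents_unique:
  assumes gen: "\<And>k. k \<ge> K \<Longrightarrow> Mk (Suc k) \<subseteq> S1 (Mk k)"
  shows "(THE es. sorted es \<and> (\<exists>gs. distinct gs \<and> list_all2 homogeneous_triple es gs \<and>
           minimal_generating_set M (set gs))) = exps (Suc K)"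
proof (rule the_equality)
  show ex: "sorted (exps (Suc K)) \<and> (\<exists>gs. distinct gs \<and> list_all2 homogeneous_triple (exps (Suc K)) gs \<and>
           minimal_generating_set M (set gs))"
    using generators_exist[OF gen] sorted_exps by blast
  fix es assume es: "sorted es \<and> (\<exists>gs. distinct gs \<and> list_all2 homogeneous_triple es gs \<and>
           minimal_generating_set M (set gs))"
  have "mset es = mset (exps (Suc K))"
    using ex es count_exponents by (intro multiset_eqI) metis
  then show "es = exps (Suc K)" using es sorted_exps by (metis properties_for_sort)
qed

end

section \<open>Jacobian relations as a graded module\<close>

lemma linear_der: "Vector_Spaces.linear scale_vec scale_poly (\<lambda>x. der x f)"
  unfolding Vector_Spaces.linear_iff
  by (intro conjI allI cV.vector_space_axioms cS.vector_space_axioms) (simp_all add: der_vec)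

lemma graded_saturated_AR:
  assumes "homogeneous (Suc d) f"
  shows "graded_saturated (AR f)"
proof
  fix x k assume x: "x \<in> AR f"
  have "der (hc k x) f = hcomp (d + k) (der x f)"
  proof -
    have "hcomp (d + k) (x $ i * partial i f) = hcomp k (x $ i) * partial i f" for i
      using hcomp_mult[OF homogeneous_partial[OF assms], of "d + k" i "x $ i"] by (simp add: mult.commute)
    then show ?thesis by (simp add: der_def hc_def hcomp_sum)
  qed
  then show "hc k x \<in> AR f" using x by (simp add: AR_der)
qed (auto simp: AR_der der_vec)

locale jacobian =
  fixes A :: "(complex^3) set"
  assumes arr: "arr A" and nonempty: "A \<noteq> {}"
begin

lemma finA: "finite A" using arr by (simp add: arr_def)

sublocale graded_saturated "AR (F A)"
proof -
  obtain d where "card A = Suc d" using finA nonempty by (metis card_eq_0_iff not0_implies_Suc)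
  then show "graded_saturated (AR (F A))" using graded_saturated_AR homogeneous_F[OF finA] by metis
qed

lemma Mk_D: "Mk k = {x \<in> D k A. der x (F A) = 0}"
proof -
  have mem: "x \<in> Mk k \<longleftrightarrow> der x (F A) = 0 \<and> homogeneous_triple k x" for x
    unfolding Mk_def by (simp add: AR_der)
  show ?thesis
  proof (intro equalityI subsetI)
    fix x assume "x \<in> Mk k"
    then have *: "der x (F A) = 0" "homogeneous_triple k x" using mem by auto
    then have "x \<in> AR (F A)" by (simp add: AR_der)
    then show "x \<in> {x \<in> D k A. der x (F A) = 0}" using * AR_subset_D[OF arr] by simp
  next
    fix x assume "x \<in> {x \<in> D k A. der x (F A) = 0}"
    then show "x \<in> Mk k" using mem by (simp add: D_def)
  qed
qed

lemma der_Euler_multiple: "der (q *s Euler) (F A) = of_nat (card A) * q * F A"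
  by (simp add: der_vec der_Euler[OF finA] mult.left_commute mult.assoc)

lemma der_Euler_0: "der (q *s Euler) (F A) = 0 \<longleftrightarrow> q = 0"
  using F_neq_0[OF arr] finA nonempty by (simp add: der_Euler_multiple)

lemma Mk_trivial: assumes "only_Euler k A" shows "Mk k = {0}"
proof -
  have "x = 0" if x: "x \<in> Mk k" for x
  proof -
    have x': "x \<in> D k A" "der x (F A) = 0" using x by (auto simp: Mk_D)
    then obtain q where q: "x = q *s Euler" using assms unfolding only_Euler_def by blast
    then have "q = 0" using x' der_Euler_0[of q] by simp
    then show ?thesis using q by simp
  qed
  then show ?thesis using Mk_0 by blast
qed

lemma Mk_trivial_below: assumes "Mk (Suc k) = {0}" shows "Mk k = {0}"
proof -
  have "x = 0" if "x \<in> Mk k" for x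
  proof -
    have "lf (axis 1 1) *s x = 0" using Mk_lf[OF that, of "axis 1 1"] assms by simp
    moreover have "lf (axis 1 1) \<noteq> 0" by (simp add: lf_eq_0_iff)
    ultimately show ?thesis by (simp add: vec_eq_iff)
  qed
  then show ?thesis using Mk_0 by blast
qed

lemma Euler_multiple_exists:
  assumes "homogeneous k p"
  shows "\<exists>q. homogeneous k q \<and> der (q *s Euler) (F A) = F A * p"
proof -
  define c where "c = (of_nat (card A) :: complex)"
  have c0: "c \<noteq> 0" using finA nonempty by (simp add: c_def)
  have cc: "(of_nat (card A) :: poly3) = const_poly c"
    by (simp add: c_def const_poly_def single_of_nat)
  have "const_poly c * (const_poly (1 / c) * p) = p" using c0 by (simp flip: const_poly_mult mult.assoc)
  then have "der ((const_poly (1 / c) * p) *s Euler) (F A) = F A * p"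
    by (simp add: der_Euler_multiple cc mult.commute)
  then show ?thesis using homogeneous_cmult[OF assms] by blast
qed

lemma D_decompose:
  assumes "x \<in> D (Suc k) A"
  shows "\<exists>q y. homogeneous k q \<and> y \<in> Mk (Suc k) \<and> x = y + q *s Euler"
proof -
  obtain p where p: "homogeneous k p" "der x (F A) = F A * p" using der_F_D[OF arr assms] by blast
  obtain q where q: "homogeneous k q" "der (q *s Euler) (F A) = F A * p"
    using Euler_multiple_exists[OF p(1)] by blast
  have "der (x - q *s Euler) (F A) = 0"
    using p(2) q(2) der_vec(1)[of "x - q *s Euler" "q *s Euler" "F A"] by simp
  then have "x - q *s Euler \<in> Mk (Suc k)" using D_diff[OF assms D_Euler[OF q(1)]] by (simp add: Mk_D)
  then show ?thesis using q(1) by (intro exI[of _ q] exI[of _ "x - q *s Euler"]) simp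
qed

lemma dim_D_Mk: "cV.dim (D (Suc k) A) = cV.dim (Mk (Suc k)) + cS.dim (HS k)"
proof -
  have "(\<lambda>x. der x (F A)) ` D (Suc k) A = (\<lambda>p. F A * p) ` HS k"
  proof (intro equalityI subsetI)
    fix p assume "p \<in> (\<lambda>x. der x (F A)) ` D (Suc k) A"
    then show "p \<in> (\<lambda>p. F A * p) ` HS k" using der_F_D[OF arr] by blast
  next
    fix p assume "p \<in> (\<lambda>p. F A * p) ` HS k"
    then obtain q where q: "homogeneous k q" "p = F A * q" by blast
    obtain r where "homogeneous k r" "der (r *s Euler) (F A) = p"
      using Euler_multiple_exists[OF q(1)] q(2) by blast
    moreover from this(1) have "r *s Euler \<in> D (Suc k) A" by (rule D_Euler)
    ultimately show "p \<in> (\<lambda>x. der x (F A)) ` D (Suc k) A" by blast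
  qed
  moreover have "cS.dim ((\<lambda>p. F A * p) ` HS k) = cS.dim (HS k)"
    by (rule cSS.dim_image_inj[OF linear_mult subspace_HS fin_dim_HS]) (use F_neq_0[OF arr] in auto)
  ultimately show ?thesis
    using cVS.rank_nullity(1)[OF linear_der[of "F A"] subspace_D[of "Suc k" A] fin_dim_D] by (simp add: Mk_D)
qed

text \<open>Subtract from the coefficients of a logarithmic representation their Euler parts; these cancel because the
total is a Jacobian relation.\<close>

lemma Mk_generated:
  assumes "D (Suc (Suc k)) A \<subseteq> S1 (D (Suc k) A)"
  shows "Mk (Suc (Suc k)) \<subseteq> S1 (Mk (Suc k))"
proof
  fix x assume x: "x \<in> Mk (Suc (Suc k))"
  then have "x \<in> S1 (D (Suc k) A)" using assms by (auto simp: Mk_D)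
  then obtain f where f: "x = (\<Sum>i\<in>UNIV. Xv i *s f i)" "\<forall>i. f i \<in> D (Suc k) A" unfolding S1_def by blast
  then have "\<forall>i. \<exists>q y. homogeneous k q \<and> y \<in> Mk (Suc k) \<and> f i = y + q *s Euler" using D_decompose by blast
  then obtain q y where qy: "\<And>i. homogeneous k (q i)" "\<And>i. y i \<in> Mk (Suc k)" "\<And>i. f i = y i + q i *s Euler" by metis
  have xe: "x = (\<Sum>i\<in>UNIV. Xv i *s y i) + (\<Sum>i\<in>UNIV. Xv i * q i) *s Euler"
    unfolding f(1) qy(3) by (simp add: sum_3 vec_eq_iff algebra_simps)
  have S: "(\<Sum>i\<in>UNIV. Xv i *s y i) \<in> S1 (Mk (Suc k))" using qy(2) by (intro S1_I[of y]) auto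
  have "(\<Sum>i\<in>UNIV. Xv i * q i) = 0"
  proof -
    have "(\<Sum>i\<in>UNIV. Xv i *s y i) \<in> Mk (Suc (Suc k))" using S S1_Mk by blast
    then have "der (\<Sum>i\<in>UNIV. Xv i *s y i) (F A) = 0" by (simp add: Mk_D)
    moreover have "der x (F A) = 0" using x by (simp add: Mk_D)
    ultimately have "der ((\<Sum>i\<in>UNIV. Xv i * q i) *s Euler) (F A) = 0"
      unfolding xe der_vec(1) by simp
    then show ?thesis by (simp only: der_Euler_0)
  qed
  then show "x \<in> S1 (Mk (Suc k))" using S xe by simp
qed

end

section \<open>Points of the arrangement\<close>

lemma common_point:
  assumes "arr A" "a \<in> A" "b \<in> A" "a \<noteq> b"
  shows "\<exists>z. z \<noteq> 0 \<and> dot a z = 0 \<and> dot b z = 0 \<and> (\<forall>x. dot a x = 0 \<longrightarrow> dot b x = 0 \<longrightarrow> (\<exists>t. x = t *s z))"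
proof -
  obtain v l m u w where fr: "arr_frame a v l m u w (A - {a})" using arr_frame_at[OF assms(1,2)] .
  then interpret arr_frame a v l m u w "A - {a}" .
  have b: "b \<in> A - {a}" using assms by blast
  show ?thesis
    using pt_neq_0 dot_pt_0[OF b] on_line_point[OF _ _ b] by (intro exI[of _ "pt (par b)"]) auto
qed

lemma arr_nonconcurrent_triple:
  assumes "arr A" "card A > 3"
  obtains a b c where "a \<in> A" "b \<in> A" "c \<in> A" "nonconcurrent {a, b, c}"
proof -
  have fA: "finite A" using assms by (simp add: arr_def)
  have "\<exists>a\<in>A. \<exists>b\<in>A. a \<noteq> b"
  proof (rule ccontr)
    assume "\<not> ?thesis"
    then have "card A \<le> Suc 0" using fA by (auto simp: card_le_Suc0_iff_eq)
    then show False using assms(2) by simp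
  qed
  then obtain a b where ab: "a \<in> A" "b \<in> A" "a \<noteq> b" by blast
  obtain z where z: "z \<noteq> 0" "dot a z = 0" "dot b z = 0" "\<And>x. dot a x = 0 \<Longrightarrow> dot b x = 0 \<Longrightarrow> \<exists>t. x = t *s z"
    using common_point[OF assms(1) ab] by blast
  have "card {c \<in> A. dot c z = 0} \<le> 3" using assms(1) z(1) by (simp add: arr_def)
  then have "{c \<in> A. dot c z = 0} \<noteq> A" using assms(2) by auto
  then obtain c where c: "c \<in> A" "dot c z \<noteq> 0" by blast
  have "nonconcurrent {a, b, c}"
    unfolding nonconcurrent_def
  proof (intro allI impI)
    fix x assume x: "\<forall>d\<in>{a, b, c}. dot d x = 0"
    then obtain t where "x = t *s z" using z(4) by auto
    then show "x = 0" using x c(2) by (auto simp: dot_scale)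
  qed
  then show ?thesis using that ab c by blast
qed

text \<open>The arrangement given as a list of linear polynomials, together with the list of their coefficient vectors.\<close>

locale list_arrangement =
  fixes A :: "poly3 list" and cs :: "(complex^3) list"
  assumes A_cs: "A = map lf cs" and la: "line_arrangement A" and mm: "max_multiplicity A \<le> 3" and ne: "A \<noteq> []"
begin

abbreviation C where "C \<equiv> set cs"

lemma not_proportional: "i < length cs \<Longrightarrow> j < length cs \<Longrightarrow> i \<noteq> j \<Longrightarrow> A ! i \<noteq> const_poly c * A ! j"
  using la by (simp add: line_arrangement_def A_cs)

lemma distinct_cs: "distinct cs"
proof -
  have "cs ! i \<noteq> cs ! j" if "i < length cs" "j < length cs" "i \<noteq> j" for i j
  proof
    assume "cs ! i = cs ! j"
    then have "A ! i = const_poly 1 * A ! j" using that by (simp add: A_cs)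
    then show False using not_proportional[OF that] by blast
  qed
  then show ?thesis by (simp add: distinct_conv_nth)
qed

lemma card_C: "card C = length A" using distinct_cs by (simp add: A_cs distinct_card)

lemma defining_poly_F: "defining_poly A = F C"
  unfolding defining_poly_def F_def A_cs using prod.distinct_set_conv_list[OF distinct_cs] by metis

definition lines :: "(complex^3) set \<Rightarrow> (complex^3) set" where "lines P = {a \<in> C. \<forall>v\<in>P. dot a v = 0}"

lemma multiplicity_lines: "multiplicity_at A P = card (lines P)"
proof -
  have "bij_betw (\<lambda>i. cs ! i) {i. i < length A \<and> (\<forall>v\<in>P. eval_poly (A ! i) v = 0)} (lines P)"
  proof (rule bij_betw_imageI)
    show "inj_on (\<lambda>i. cs ! i) {i. i < length A \<and> (\<forall>v\<in>P. eval_poly (A ! i) v = 0)}"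
      using distinct_cs by (auto intro!: inj_onI simp: A_cs nth_eq_iff_index_eq)
    show "(\<lambda>i. cs ! i) ` {i. i < length A \<and> (\<forall>v\<in>P. eval_poly (A ! i) v = 0)} = lines P"
    proof (intro equalityI subsetI)
      fix a assume "a \<in> lines P"
      then obtain i where "i < length cs" "a = cs ! i" "\<forall>v\<in>P. dot a v = 0" by (auto simp: lines_def in_set_conv_nth)
      then show "a \<in> (\<lambda>i. cs ! i) ` {i. i < length A \<and> (\<forall>v\<in>P. eval_poly (A ! i) v = 0)}"
        by (intro image_eqI[of _ _ i]) (auto simp: A_cs eval_lf)
    qed (auto simp: lines_def A_cs eval_lf)
  qed
  then show ?thesis unfolding multiplicity_at_def by (rule bij_betw_same_card)
qed

lemma lines_span: "lines (vec.span {x}) = {a \<in> C. dot a x = 0}"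
proof -
  have "(\<forall>v\<in>vec.span {x}. dot a v = 0) \<longleftrightarrow> dot a x = 0" for a
    by (auto simp: vec.span_singleton dot_scale intro: exI[of _ 1] dest: bspec[of _ _ "1 *s x"])
  then show ?thesis by (simp add: lines_def)
qed

lemma multiplicity_le: assumes "P \<in> proj_plane" shows "card (lines P) \<le> 3"
proof -
  have "multiplicity_at A ` proj_plane \<subseteq> {..length A}"
    unfolding multiplicity_lines lines_def using card_C by (auto intro!: card_mono simp flip: card_C)
  then have "finite (multiplicity_at A ` proj_plane)" using finite_subset by blast
  then have "multiplicity_at A P \<le> max_multiplicity A"
    unfolding max_multiplicity_def using assms by (intro Max_ge) auto
  then show ?thesis using mm by (simp add: multiplicity_lines)
qed

lemma arr_C: "arr C"
  unfolding arr_def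
proof (intro conjI ballI allI impI)
  show "0 \<notin> C"
  proof
    assume "0 \<in> C"
    then have "lf 0 \<in> set A" by (simp add: A_cs)
    then show False using la by (auto simp: line_arrangement_def lf_eq_0_iff)
  qed
next
  fix a b c assume "a \<in> C" "b \<in> C" "a \<noteq> b"
  then obtain i j where ij: "i < length cs" "j < length cs" "a = cs ! i" "b = cs ! j" "i \<noteq> j"
    by (metis in_set_conv_nth)
  show "a \<noteq> c *s b"
  proof
    assume "a = c *s b"
    then have "A ! i = const_poly c * A ! j" using ij by (simp add: A_cs lf_scale)
    then show False using not_proportional[OF ij(1,2,5)] by blast
  qed
next
  fix x :: "complex^3" assume "x \<noteq> 0"
  then have "vec.span {x} \<in> proj_plane" by (auto simp: proj_plane_def)
  then show "card {a \<in> C. dot a x = 0} \<le> 3" using multiplicity_le lines_span by metis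
qed simp

lemma point_eq:
  assumes P: "P \<in> proj_plane" and Q: "Q \<in> proj_plane" and ab: "a \<in> lines P" "b \<in> lines P" "a \<in> lines Q" "b \<in> lines Q" "a \<noteq> b"
  shows "P = Q"
proof -
  have "a \<in> C" "b \<in> C" using ab by (auto simp: lines_def)
  then obtain z where z: "z \<noteq> 0" "\<And>x. dot a x = 0 \<Longrightarrow> dot b x = 0 \<Longrightarrow> \<exists>t. x = t *s z"
    using common_point[OF arr_C _ _ ab(5)] by blast
  have "R = vec.span {z}" if R: "R \<in> proj_plane" "a \<in> lines R" "b \<in> lines R" for R
  proof -
    obtain x where x: "R = vec.span {x}" "x \<noteq> 0" using R(1) by (auto simp: proj_plane_def)
    then have "dot a x = 0" "dot b x = 0" using R by (auto simp: lines_span)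
    then obtain t where t: "x = t *s z" using z(2) by blast
    then have t0: "t \<noteq> 0" using x(2) by auto
    have "x \<in> vec.span {z}" unfolding t by (intro vec.span_scale vec.span_base) simp
    moreover have "z = (1 / t) *s x" using t0 t by (simp add: vector_smult_assoc)
    then have "z \<in> vec.span {x}" by (metis vec.span_scale vec.span_base singletonI)
    ultimately show ?thesis unfolding x(1) by (intro equalityI vec.span_minimal vec.subspace_span) auto
  qed
  then show ?thesis using P Q ab by metis
qed

text \<open>The multiple points. Each is determined by the set of lines through it.\<close>

definition Pts :: "(complex^3) set set" where "Pts = {P \<in> proj_plane. card (lines P) \<ge> 2}"

lemma lines_sub: "lines P \<subseteq> C" by (auto simp: lines_def)

lemma finite_lines: "finite (lines P)" by (rule finite_subset[OF lines_sub]) simp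

lemma two_lines: assumes "card (lines P) \<ge> 2" obtains a b where "a \<in> lines P" "b \<in> lines P" "a \<noteq> b"
proof -
  have "\<not> card (lines P) \<le> Suc 0 \<longleftrightarrow> (\<exists>a\<in>lines P. \<exists>b\<in>lines P. a \<noteq> b)"
    using finite_lines by (auto simp: card_le_Suc0_iff_eq)
  then show ?thesis using assms that by auto
qed

lemma inj_lines: "inj_on lines Pts"
proof (rule inj_onI)
  fix P Q assume PQ: "P \<in> Pts" "Q \<in> Pts" "lines P = lines Q"
  obtain a b where "a \<in> lines P" "b \<in> lines P" "a \<noteq> b" using two_lines PQ(1) by (auto simp: Pts_def)
  then show "P = Q" using point_eq[of P Q a b] PQ by (auto simp: Pts_def)
qed

lemma finite_Pts: "finite Pts"
proof (rule inj_on_finite[OF inj_lines])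
  show "lines ` Pts \<subseteq> Pow C" using lines_sub by blast
qed simp

lemma num_points_3: "num_points 3 A = card (triples C)"
proof -
  have "lines ` {P \<in> proj_plane. card (lines P) = 3} = triples C"
  proof (intro equalityI subsetI)
    fix X assume "X \<in> lines ` {P \<in> proj_plane. card (lines P) = 3}"
    then obtain P where P: "P \<in> proj_plane" "card (lines P) = 3" "X = lines P" by blast
    then obtain x where "P = vec.span {x}" "x \<noteq> 0" by (auto simp: proj_plane_def)
    then show "X \<in> triples C" using P lines_span[of x] by (auto simp: triples_def)
  next
    fix X assume "X \<in> triples C"
    then obtain x where x: "X \<subseteq> C" "card X = 3" "x \<noteq> 0" "\<forall>a\<in>X. dot a x = 0" by (auto simp: triples_def)
    have P: "vec.span {x} \<in> proj_plane" using x(3) by (auto simp: proj_plane_def)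
    have sub: "X \<subseteq> lines (vec.span {x})" using x by (auto simp: lines_span)
    note f = finite_lines[of "vec.span {x}"]
    have "X = lines (vec.span {x})"
      using card_subset_eq[OF f sub] card_mono[OF f sub] multiplicity_le[OF P] x(2) by simp
    then show "X \<in> lines ` {P \<in> proj_plane. card (lines P) = 3}" using P x(2) by blast
  qed
  moreover have "inj_on lines {P \<in> proj_plane. card (lines P) = 3}"
    by (rule inj_on_subset[OF inj_lines]) (auto simp: Pts_def)
  from card_image[OF this] have "card (lines ` {P \<in> proj_plane. card (lines P) = 3}) = num_points 3 A"
    by (simp add: num_points_def multiplicity_lines)
  ultimately show ?thesis by simp
qed

text \<open>Any two lines meet in exactly one point: every pair of lines is contained in the set of lines through exactly
one multiple point.\<close>

lemma pair_count: "num_points 2 A + 3 * num_points 3 A = length A choose 2"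
proof -
  define Pr where "Pr P = {X. X \<subseteq> lines P \<and> card X = 2}" for P
  note fl = finite_lines
  have "{X. X \<subseteq> C \<and> card X = 2} = (\<Union>P\<in>Pts. Pr P)"
  proof (intro equalityI subsetI)
    fix X assume X: "X \<in> {X. X \<subseteq> C \<and> card X = 2}"
    then obtain a b where ab: "X = {a, b}" "a \<noteq> b" "a \<in> C" "b \<in> C" by (auto simp: card_2_iff)
    obtain z where z: "z \<noteq> 0" "dot a z = 0" "dot b z = 0" using common_point[OF arr_C ab(3,4,2)] by blast
    have sub: "X \<subseteq> lines (vec.span {z})" using ab z by (auto simp: lines_span)
    have "2 \<le> card (lines (vec.span {z}))" using card_mono[OF fl sub] X by simp
    then have "vec.span {z} \<in> Pts" using z(1) by (auto simp: Pts_def proj_plane_def)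
    then show "X \<in> (\<Union>P\<in>Pts. Pr P)" using sub X by (auto simp: Pr_def)
  qed (use lines_sub in \<open>auto simp: Pr_def\<close>)
  moreover have "card (\<Union>P\<in>Pts. Pr P) = (\<Sum>P\<in>Pts. card (Pr P))"
  proof (rule card_UN_disjoint[OF finite_Pts])
    show "\<forall>P\<in>Pts. finite (Pr P)" using fl by (auto simp: Pr_def intro: finite_subset[of _ "Pow (lines _)"])
    show "\<forall>P\<in>Pts. \<forall>Q\<in>Pts. P \<noteq> Q \<longrightarrow> Pr P \<inter> Pr Q = {}"
    proof (intro ballI impI equals0I)
      fix P Q X assume PQ: "P \<in> Pts" "Q \<in> Pts" "P \<noteq> Q" and "X \<in> Pr P \<inter> Pr Q"
      then obtain a b where "X = {a, b}" "a \<noteq> b" "X \<subseteq> lines P" "X \<subseteq> lines Q" by (auto simp: Pr_def card_2_iff)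
      then show False using point_eq[of P Q a b] PQ by (auto simp: Pts_def)
    qed
  qed
  moreover have "(\<Sum>P\<in>Pts. card (Pr P)) = (\<Sum>P\<in>Pts. if card (lines P) = 2 then 1 else 3)"
  proof (rule sum.cong[OF refl])
    fix P assume P: "P \<in> Pts"
    have "card (Pr P) = card (lines P) choose 2" unfolding Pr_def by (rule n_subsets[OF fl])
    moreover have "card (lines P) = 2 \<or> card (lines P) = 3" using P multiplicity_le[of P] by (auto simp: Pts_def)
    ultimately show "card (Pr P) = (if card (lines P) = 2 then 1 else 3)"
      by (auto simp: choose_two)
  qed
  moreover have "(\<Sum>P\<in>Pts. if card (lines P) = 2 then 1 else 3) = num_points 2 A + 3 * num_points 3 A"
  proof -
    have "(\<Sum>P\<in>Pts. if card (lines P) = 2 then 1 else (3::nat))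
      = card {P \<in> Pts. card (lines P) = 2} + 3 * card {P \<in> Pts. card (lines P) \<noteq> 2}"
    proof -
      have "Pts \<inter> {P. card (lines P) = 2} = {P \<in> Pts. card (lines P) = 2}"
        "Pts \<inter> - {P. card (lines P) = 2} = {P \<in> Pts. card (lines P) \<noteq> 2}" by blast+
      then show ?thesis by (subst sum.If_cases[OF finite_Pts]) simp
    qed
    moreover have "{P \<in> Pts. card (lines P) = 2} = {P \<in> proj_plane. card (lines P) = 2}" by (auto simp: Pts_def)
    moreover have "card (lines P) \<ge> 2 \<and> card (lines P) \<noteq> 2 \<longleftrightarrow> card (lines P) = 3" if "P \<in> proj_plane" for P
      using multiplicity_le[OF that] by auto
    then have "{P \<in> Pts. card (lines P) \<noteq> 2} = {P \<in> proj_plane. card (lines P) = 3}"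
      unfolding Pts_def by blast
    ultimately show ?thesis by (simp add: num_points_def multiplicity_lines)
  qed
  moreover have "card {X. X \<subseteq> C \<and> card X = 2} = length A choose 2"
    using n_subsets[of C 2] by (simp add: card_C)
  ultimately show ?thesis by simp
qed

lemma num_points_large: assumes "k > 3" shows "num_points k A = 0"
proof -
  have "{P \<in> proj_plane. card (lines P) = k} = {}" using multiplicity_le assms by fastforce
  then show ?thesis unfolding num_points_def multiplicity_lines by (simp only: card.empty)
qed

end

lemma list_arrangement_exists:
  assumes "line_arrangement A" "max_multiplicity A \<le> 3" "A \<noteq> []"
  obtains cs where "list_arrangement A cs"
proof -
  have "\<forall>l\<in>set A. \<exists>a. l = lf a" using assms(1) linear_form_lf by (auto simp: line_arrangement_def)
  then obtain cs where "A = map lf cs" by (metis ex_map_conv)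
  then show ?thesis using that assms by (simp add: list_arrangement_def)
qed

section \<open>Eight lines\<close>

locale eight_lines = jacobian +
  assumes card8: "card A = 8"
begin

text \<open>The number of triple points and the dimensions of \<open>AR\<^sub>k\<close> and \<open>S\<^sub>1 AR\<^sub>k\<close>.\<close>

definition n where "n = card (triples A)"
definition d where "d k = cV.dim (Mk k)"
definition s where "s k = cV.dim (S1 (Mk k))"

lemma nonconcurrent_split: obtains a b c G where "nonconcurrent {a, b, c}" "A = G \<union> {a, b, c}" "finite G" "G \<inter> {a, b, c} = {}" "card G = 5"
proof -
  obtain a b c where abc: "a \<in> A" "b \<in> A" "c \<in> A" "nonconcurrent {a, b, c}"
    using arr_nonconcurrent_triple[OF arr] card8 by auto
  have "card (A - {a, b, c}) = 5"
    using nonconcurrent_card[OF abc(4)] card8 abc by (subst card_Diff_subset) auto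
  then show ?thesis using that[of a b c "A - {a, b, c}"] abc finA by auto
qed

lemma dim_Mk_5: "d 5 = n" and dim_Mk_6: "d 6 = n + 7"
proof -
  obtain a b c G where G: "nonconcurrent {a, b, c}" "A = G \<union> {a, b, c}" "finite G" "G \<inter> {a, b, c} = {}" "card G = 5"
    by (rule nonconcurrent_split)
  have arrG: "arr (G \<union> {a, b, c})" using arr G(2) by simp
  have 1: "cV.dim (D (Suc k) A) + 5 * (k + 2) = 3 * cS.dim (HS k) + n" if "5 \<le> Suc k" for k
    using dim_D[OF G(1,3,4) arrG, of k] that G(5) unfolding n_def G(2)[symmetric] by simp
  have "cS.dim (HS 4) = 15" "cS.dim (HS 5) = 21" using dim_HS[of 4] dim_HS[of 5] by simp_all
  then show "d 5 = n" "d 6 = n + 7"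
    using 1[of 4] 1[of 5] dim_D_Mk[of 4] dim_D_Mk[of 5] by (simp_all add: d_def)
qed

lemma generated_from_6: "k \<ge> 6 \<Longrightarrow> Mk (Suc k) \<subseteq> S1 (Mk k)"
proof -
  assume k: "k \<ge> 6"
  obtain a b c G where G: "nonconcurrent {a, b, c}" "A = G \<union> {a, b, c}" "finite G" "G \<inter> {a, b, c} = {}" "card G = 5"
    by (rule nonconcurrent_split)
  have arrG: "arr (G \<union> {a, b, c})" using arr G(2) by simp
  have "D (Suc k) A \<subseteq> S1 (D k A)" using generation[OF G(1,3,4) arrG, of k] k G(5) unfolding G(2)[symmetric] by simp
  moreover obtain j where "k = Suc j" using k by (cases k) auto
  ultimately show ?thesis using Mk_generated by blast
qed

lemma no_relations_below_4: "j < 4 \<Longrightarrow> Mk j = {0}"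
proof -
  assume "j < 4"
  have M3: "Mk 3 = {0}" using Mk_trivial only_Euler_low_degree[OF arr, of 3] card8 by simp
  then have M2: "Mk 2 = {0}" using Mk_trivial_below[of 2] by simp
  then have M1: "Mk 1 = {0}" using Mk_trivial_below[of 1] by (simp add: numeral_2_eq_2)
  then have M0: "Mk 0 = {0}" using Mk_trivial_below[of 0] by simp
  have "j = 0 \<or> j = 1 \<or> j = 2 \<or> j = 3" using \<open>j < 4\<close> by auto
  then show ?thesis using M0 M1 M2 M3 by auto
qed

lemma d_below_4: "j < 4 \<Longrightarrow> d j = 0"
  using no_relations_below_4 cV.dim_trivial by (simp add: d_def)

lemma four_triples: "d 4 \<noteq> 0 \<Longrightarrow> n \<ge> 4"
proof (rule ccontr)
  assume "d 4 \<noteq> 0" "\<not> n \<ge> 4"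
  then have "Mk 4 = {0}" using Mk_trivial only_Euler_few_triples[OF arr, of 4] card8 by (simp add: n_def)
  then show False using \<open>d 4 \<noteq> 0\<close> cV.dim_trivial by (simp add: d_def)
qed

lemma n_le_8: "n \<le> 8"
proof -
  have "triples_through A a \<le> 3" if "a \<in> A" for a using triples_through_le[OF arr that] card8 by simp
  then have "(\<Sum>a\<in>A. triples_through A a) \<le> (\<Sum>a\<in>A. 3)" by (rule sum_mono)
  then show ?thesis using sum_triples_through[OF finA] card8 by (simp add: n_def)
qed

lemma s_le: "s k \<le> d (Suc k)"
  unfolding s_def d_def by (rule cV.dim_mono_fin_dim[OF fin_dim_Mk S1_Mk subspace_S1 subspace_Mk])

lemma s4_upper: "s 4 \<le> 3 * d 4"
  using dim_S1_upper_any[of 2] d_below_4[of 2] d_below_4[of 3] by (simp add: s_def d_def numeral_eq_Suc)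

lemma s5_upper: "s 5 + 3 * d 4 \<le> 3 * n"
  using dim_S1_upper_any[of 3] d_below_4[of 3] dim_Mk_5 by (simp add: s_def d_def numeral_eq_Suc)

lemma s4_lower: "d 4 \<noteq> 0 \<Longrightarrow> 2 * d 4 + 1 \<le> s 4"
  using dim_S1_ge_1[of 3] d_below_4[of 3] by (simp add: s_def d_def numeral_eq_Suc)

lemma s4_lower_2: "d 4 \<ge> 2 \<Longrightarrow> 2 * d 4 + 2 \<le> s 4"
  using dim_S1_min_degree[of 3] no_relations_below_4 by (simp add: s_def d_def numeral_eq_Suc)

lemma s5_lower: "n \<noteq> 0 \<Longrightarrow> 2 * n + 1 \<le> s 5 + d 4"
  using dim_S1_ge_1[of 4] dim_Mk_5 by (simp add: s_def d_def numeral_eq_Suc)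

lemma s5_lower_0:
  assumes "d 4 = 0" "n \<ge> 2" shows "2 * n + 2 \<le> s 5"
proof -
  have "Mk 4 = {0}" using cV.dim_zero_fin_dim[OF fin_dim_Mk subspace_Mk] assms(1) by (simp add: d_def)
  moreover have "j = 4 \<or> j < 4" if "j < Suc 4" for j :: nat using that by auto
  ultimately have "Mk j = {0}" if "j < Suc 4" for j using no_relations_below_4 that by blast
  then show ?thesis using dim_S1_min_degree[of 4] assms(2) dim_Mk_5 by (simp add: s_def d_def numeral_eq_Suc)
qed

lemma s5_lower_2:
  assumes "d 4 \<noteq> 0" "d 4 \<ge> 2 \<or> s 4 < n" shows "2 * n + 2 \<le> s 5 + d 4"
  using dim_S1_next_degree[OF no_relations_below_4, of 4] assms dim_Mk_5 by (simp add: s_def d_def numeral_eq_Suc)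

definition exponent_list where "exponent_list = (THE es. sorted es \<and> (\<exists>gs. distinct gs \<and> list_all2 homogeneous_triple es gs \<and>
           minimal_generating_set (AR (F A)) (set gs)))"

lemma exponent_list_eq: "exponent_list = replicate (d 4) 4 @ replicate (n - s 4) 5 @ replicate (n + 7 - s 5) 6"
proof -
  have "exponent_list = exps (Suc 6)" unfolding exponent_list_def by (rule exponents_unique) (rule generated_from_6)
  moreover have "exps 4 = []"
  proof -
    have "mu j = 0" if "j < 4" for j using d_below_4[OF that] by (simp add: mu_def d_def)
    then show ?thesis by (auto simp: exps_def)
  qed
  moreover have "mu 4 = d 4"
  proof -
    have "S1 (Mk 3) = {0}"
    proof -
      have "s 3 = 0" using dim_S1_upper_any[of 1] d_below_4[of 1] d_below_4[of 2] d_below_4[of 3]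
        by (simp add: s_def d_def numeral_eq_Suc)
      then show ?thesis using cV.dim_zero_fin_dim[OF fin_dim_S1 subspace_S1] by (simp add: s_def)
    qed
    then have "S1p 4 = {0}" by (simp add: S1p_def numeral_eq_Suc)
    then show ?thesis using cV.dim_trivial by (simp add: mu_def d_def)
  qed
  moreover have "mu 5 = n - s 4" using dim_Mk_5 by (simp add: mu_def d_def S1p_def s_def numeral_eq_Suc)
  moreover have "mu 6 = n + 7 - s 5" using dim_Mk_6 by (simp add: mu_def d_def S1p_def s_def numeral_eq_Suc)
  moreover have "exps (Suc 6) = exps 4 @ replicate (mu 4) 4 @ replicate (mu 5) 5 @ replicate (mu 6) 6"
    using exps_Suc[of 4] exps_Suc[of 5] exps_Suc[of 6] by (simp add: numeral_eq_Suc)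
  ultimately show ?thesis by simp
qed

text \<open>The tuples are the number of triple points followed by the numbers of generators of degree \<open>4\<close>, \<open>5\<close> and \<open>6\<close>. Everything
except linear arithmetic is in the bounds on \<open>s 4\<close> and \<open>s 5\<close>; that there are at least four triple
points if \<open>AR\<^sub>4 \<noteq> 0\<close> excludes the tuple \<open>(3, 1, 0, 4)\<close>.\<close>

lemma numerical_cases:
  assumes "n \<ge> 1"
  shows "(n, d 4, n - s 4, n + 7 - s 5) \<in> {(1,0,1,5), (2,0,2,3), (3,0,3,1), (3,0,3,2), (4,1,1,2), (4,0,4,0), (4,0,4,1),
    (5,1,2,0), (5,1,2,1), (5,0,5,0), (6,1,3,0), (6,2,0,1), (7,2,1,0), (8,3,0,0)}"
proof -
  have s4n: "s 4 \<le> n" and s5n: "s 5 \<le> n + 7" using s_le[of 4] s_le[of 5] dim_Mk_5 dim_Mk_6 by (simp_all add: numeral_eq_Suc)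
  note facts = s4n s5n n_le_8 assms s5_upper
  consider "d 4 = 0" | "d 4 = 1" | "d 4 = 2" | "d 4 = 3" | "d 4 \<ge> 4" by linarith
  then show ?thesis
  proof cases
    case 1
    then have s4: "s 4 = 0" using s4_upper by simp
    have "2 * n + 1 \<le> s 5" using s5_lower 1 assms by simp
    moreover have "n = 1 \<or> 2 * n + 2 \<le> s 5" using s5_lower_0[OF 1] assms by (cases "n = 1") simp_all
    moreover have "s 5 \<le> 3 * n" using s5_upper 1 by simp
    ultimately have "(n = 1 \<and> s 5 = 3) \<or> (n = 2 \<and> s 5 = 6) \<or> (n = 3 \<and> (s 5 = 8 \<or> s 5 = 9)) \<or>
      (n = 4 \<and> (s 5 = 10 \<or> s 5 = 11)) \<or> (n = 5 \<and> s 5 = 12)"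
      using s5n by presburger
    then show ?thesis using s4 1 by (elim disjE conjE) simp_all
  next
    case 2
    then have s4: "s 4 = 3" using s4_upper s4_lower by simp
    have n4: "n \<ge> 4" using four_triples 2 by simp
    then have "2 * n + 2 \<le> s 5 + 1" using s5_lower_2 2 s4 by simp
    moreover from this have "n = 4 \<or> n = 5 \<or> n = 6" using facts n4 by linarith
    ultimately have "(n = 4 \<and> s 5 = 9) \<or> (n = 5 \<and> (s 5 = 11 \<or> s 5 = 12)) \<or> (n = 6 \<and> s 5 = 13)"
      using s5n s5_upper 2 by presburger
    then show ?thesis using s4 2 by (elim disjE conjE) simp_all
  next
    case 3
    then have s4: "s 4 = 6" using s4_upper s4_lower_2 by simp
    have l: "2 * n + 2 \<le> s 5 + 2" using s5_lower_2 3 by simp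
    then have "n = 6 \<or> n = 7" using facts s4 by linarith
    then have "(n = 6 \<and> s 5 = 12) \<or> (n = 7 \<and> s 5 = 14)"
      using s5n s5_upper 3 l by presburger
    then show ?thesis using s4 3 by (elim disjE conjE) simp_all
  next
    case 4
    then have s4: "s 4 \<ge> 8" using s4_lower_2 by simp
    have l: "2 * n + 2 \<le> s 5 + 3" using s5_lower_2 4 by simp
    have "n = 8" "s 4 = 8" "s 5 = 15" using facts s4 l by linarith+
    then show ?thesis using 4 by simp
  next
    case 5
    then have "s 4 \<ge> 10" using s4_lower_2 by simp
    then show ?thesis using facts by linarith
  qed
qed

lemma mdr_value:
  assumes "n \<ge> 1"
  shows "(LEAST k. \<exists>\<rho>\<in>AR (F A). \<rho> \<noteq> 0 \<and> homogeneous_triple k \<rho>) = (if d 4 = 0 then 5 else 4)"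
proof (rule Least_equality)
  have ex: "\<exists>\<rho>\<in>AR (F A). \<rho> \<noteq> 0 \<and> homogeneous_triple k \<rho>" if "d k \<noteq> 0" for k
  proof -
    have "Mk k \<noteq> {0}"
    proof
      assume "Mk k = {0}"
      then show False using that by (simp add: d_def)
    qed
    then obtain x where "x \<in> Mk k" "x \<noteq> 0" using Mk_0 by blast
    then show ?thesis by (intro bexI[of _ x]) (simp_all add: Mk_def)
  qed
  show "\<exists>\<rho>\<in>AR (F A). \<rho> \<noteq> 0 \<and> homogeneous_triple (if d 4 = 0 then 5 else 4) \<rho>"
    using ex[of 4] ex[of 5] dim_Mk_5 assms by simp
  fix k assume "\<exists>\<rho>\<in>AR (F A). \<rho> \<noteq> 0 \<and> homogeneous_triple k \<rho>"
  then obtain x where x: "x \<in> AR (F A)" "x \<noteq> 0" "homogeneous_triple k x" by blast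
  then have "x \<in> Mk k" by (simp add: Mk_def)
  then have nz: "Mk k \<noteq> {0}" using x(2) by blast
  then have "\<not> k < 4" using no_relations_below_4 by blast
  moreover have "k \<noteq> 4" if "d 4 = 0"
    using nz cV.dim_zero_fin_dim[OF fin_dim_Mk[of 4] subspace_Mk] that unfolding d_def by blast
  ultimately show "(if d 4 = 0 then 5 else 4) \<le> k" by auto
qed

end

theorem theorem4p5:
  fixes A :: "poly3 list" and r :: nat
  assumes "line_arrangement A"
    and "length A = 8"
    and "max_multiplicity A = 3"
    and "r = mdr A"
  shows "tjurina A \<in> {29, 30, 31, 32, 33, 34, 35, 36} \<and>
    (tjurina A = 36 \<longrightarrow>
       r = 4 \<and> num_points 3 A = 8 \<and> nearly_free A \<and> exponents A = [4,4,4]) \<and>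
    (tjurina A = 35 \<longrightarrow>
       r = 4 \<and> num_points 3 A = 7 \<and> minimal_plus_one_generated A \<and> exponents A = [4,4,5]) \<and>
    (tjurina A = 34 \<longrightarrow>
       r = 4 \<and> num_points 3 A = 6 \<and>
       (plus_one_generated A \<and> exponents A = [4,4,6] \<or>
        arrangement_type A = 2 \<and> exponents A = [4,5,5,5])) \<and>
    (tjurina A = 33 \<longrightarrow>
       num_points 3 A = 5 \<and>
       (arrangement_type A = 2 \<and> exponents A = [4,5,5] \<and> r = 4 \<or>
        arrangement_type A = 2 \<and> exponents A = [4,5,5,6] \<and> r = 4 \<or>
        arrangement_type A = 3 \<and> exponents A = [5,5,5,5,5] \<and> r = 5)) \<and>
    (tjurina A = 32 \<longrightarrow>
       num_points 3 A = 4 \<and>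
       (arrangement_type A = 2 \<and> exponents A = [4,5,6,6] \<or>
        arrangement_type A = 3 \<and> exponents A = [5,5,5,5] \<or>
        arrangement_type A = 3 \<and> exponents A = [5,5,5,5,6])) \<and>
    (tjurina A = 31 \<longrightarrow>
       r = 5 \<and> num_points 3 A = 3 \<and>
       (arrangement_type A = 3 \<and> exponents A = [5,5,5,6] \<or>
        arrangement_type A = 3 \<and> exponents A = [5,5,5,6,6])) \<and>
    (tjurina A = 30 \<longrightarrow>
       r = 5 \<and> num_points 3 A = 2 \<and>
       arrangement_type A = 3 \<and> exponents A = [5,5,6,6,6]) \<and>
    (tjurina A = 29 \<longrightarrow>
       r = 5 \<and> num_points 3 A = 1 \<and>
       arrangement_type A = 4 \<and> exponents A = [5,6,6,6,6,6])"
proof -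
  have "A \<noteq> []" using assms(2) by auto
  then obtain cs where "list_arrangement A cs"
    using list_arrangement_exists[OF assms(1)] assms(3) by auto
  then interpret list_arrangement A cs .
  interpret E: eight_lines "set cs"
    by unfold_locales (use arr_C card_C assms(2) in auto)
  have pc: "num_points 2 A + 3 * num_points 3 A = 28"
    using pair_count assms(2) by (simp add: choose_two)
  have tj: "tjurina A = num_points 2 A + 4 * num_points 3 A"
  proof -
    have "{2..8} = {2, 3, 4, 5, 6, 7, 8::nat}" by auto
    then show ?thesis using assms(2) by (simp add: tjurina_def num_points_large)
  qed
  have n: "num_points 3 A = E.n" using num_points_3 by (simp add: E.n_def)
  have t: "tjurina A = 28 + E.n" using pc tj n by simp
  have n1: "E.n \<ge> 1"
  proof -
    have "multiplicity_at A ` proj_plane \<subseteq> {..3}"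
      using multiplicity_le by (auto simp: multiplicity_lines)
    then have fin: "finite (multiplicity_at A ` proj_plane)" using finite_subset by blast
    have "(axis 1 1 :: complex^3) \<noteq> 0" by simp
    then have "proj_plane \<noteq> {}" unfolding proj_plane_def by blast
    then have "3 \<in> multiplicity_at A ` proj_plane"
      using Max_in[OF fin] assms(3) by (simp add: max_multiplicity_def)
    then obtain P where P: "P \<in> proj_plane" "card (lines P) = 3" by (auto simp: multiplicity_lines)
    then obtain x where x: "P = vec.span {x}" "x \<noteq> 0" by (auto simp: proj_plane_def)
    then have "lines P \<in> triples (set cs)" using P(2) lines_span[of x] by (auto simp: triples_def)
    then have "triples (set cs) \<noteq> {}" by blast
    then show ?thesis using finite_triples[of "set cs"] by (simp add: E.n_def Suc_le_eq card_gt_0_iff)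
  qed
  have r: "r = (if E.d 4 = 0 then 5 else 4)"
    unfolding assms(4) mdr_def defining_poly_F by (rule E.mdr_value[OF n1])
  have e: "exponents A = replicate (E.d 4) 4 @ replicate (E.n - E.s 4) 5 @ replicate (E.n + 7 - E.s 5) 6"
    using E.exponent_list_eq by (simp add: exponents_def defining_poly_F E.exponent_list_def)
  show ?thesis
    using E.numerical_cases[OF n1] t r e n
    by (simp only: insert_iff empty_iff prod.inject, elim disjE conjE) (simp_all add: nearly_free_def minimal_plus_one_generated_def plus_one_generated_def
        arrangement_type_def assms(2) numeral_eq_Suc)
qed

end
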